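(* There is $\varepsilon_0>0$ such that for every $\varepsilon\in(0,\varepsilon_0)$ there exists a constant $C<\infty$ (depending only on $\varepsilon$ and the kernel $\Phi$) with the following property. Let $\zeta, \tau_1, Y_2, Y_3, u$ be smooth real functions on $\mathbb{R}\times\mathbb{R}^3$ and $C_1,C_2\in\mathbb{R}$. Put $\tau_2:=\tau_1^2-C_1$ and $\tau_3:=\tau_1^3-3C_1\tau_1$. Assume that pointwise on $P$ $$(\partial_t-\Delta)\tau_1=\zeta,\qquad (\partial_t-\Delta)Y_2=\tau_2,\qquad (\partial_t-\Delta)Y_3=\tau_3,$$ $$(\partial_t-\Delta)u=-u^3+\zeta+(3C_1-9C_2)u ,$$ and set $v:=u-\tau_1$ (so that $(\partial_t-\Delta)v=-v^3-3v^2\tau_1-3v\tau_2-\tau_3-9C_2(v+\tau_1)$ on $P$). Define the nine quantities $Q_1=[\tau_1]_{-\frac12-\varepsilon}$, $Q_2=[\tau_2]_{-1-2\varepsilon}$, $Q_3=[\tau_3]_{-\frac32-3\varepsilon}$, $Q_4=[Y_2]_{1-2\varepsilon}$, $Q_5=[Y_3]_{\frac12-3\varepsilon}$, $$Q_6=\sup_{x\in P}\sup_{T<1}T^{2\varepsilon}\Big|\int X(y-x)\,\tau_2(y)\,\Psi_T(x-y)\,dy\Big|,$$ $$Q_7=\sup_{x\in P}\sup_{T<1}T^{4\varepsilon}\Big|\int \big(Y_2(y)\tau_2(y)-C_2-Y_2(x)\tau_2(y)\big)\Psi_T(x-y)\,dy\Big|,$$ $$Q_8=\sup_{x\in P}\sup_{T<1}T^{4\varepsilon}\Big|\int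 \big(Y_3(y)\tau_1(y)-Y_3(x)\tau_1(y)\big)\Psi_T(x-y)\,dy\Big|,$$ $$Q_9=\sup_{x\in P}\sup_{T<1}T^{\frac12+5\varepsilon}\Big|\int \big(Y_3(y)\tau_2(y)-3C_2\tau_1(y)-Y_3(x)\tau_2(y)\big)\Psi_T(x-y)\,dy\Big|,$$ with associated integers $(n_1,\dots,n_9)=(1,2,3,2,3,2,4,4,5)$. Then for every $R\in(0,1)$, $$\|v\|_{P_R}\le C\max\Big\{\frac1R,\;Q_i^{\frac{1}{n_i(\frac12-\varepsilon)}},\ i=1,\dots,9\Big\}.$$
   Context: Space-time points are $z=(t,x)\in\mathbb{R}\times\mathbb{R}^3$; $|x|$ is the supremum norm on $\mathbb{R}^3$, $X(z)=x$ is the spatial projection, and the parabolic metric is $d((t,x),(\bar t,\bar x))=\max\{\sqrt{|t-\bar t|},|x-\bar x|\}$. The past parabolic ball is $B(z,R)=\{\bar z=(\bar t,\bar x): d(z,\bar z)<R,\ \bar t<t\}$. $P=(0,1)\times(-1,1)^3$ and $P_R=(R^2,1)\times\{x:|x|<1-R\}$. $\|f\|_B=\sup_B|f|$. Kernel: fix a smooth $\Phi\ge0$ with values in $[0,1]$, integral $1$, symmetric under $x\mapsto -x$, supported in $\{(t,x):0<t<1,|x|<1\}$ (so that convolution at $z$ only sees $B(z,\cdot)$). Set $\Phi_T(t,x)=T^{-5}\Phi(t/T^2,x/T)$, $\Psi_{T,n}=\Phi_{T2^{-1}}*\Phi_{T2^{-2}}*\cdots*\Phi_{T2^{-n}}$,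 $\Psi_T=\lim_{n\to\infty}\Psi_{T,n}$, and $(f)_T(z)=\int\Psi_T(z-w)f(w)\,dw$. Norms: for $\alpha<0$, $[\theta]_\alpha=\sup_{z\in P}\sup_{T\le1}T^{-\alpha}|(\theta)_T(z)|$; for $\alpha\in(0,1)$, $[f]_\alpha=\sup_{z\neq\bar z}|f(z)-f(\bar z)|/d(z,\bar z)^\alpha$; for $\alpha\in(1,2)$, $[f]_\alpha=\sup_{z\ne\bar z}|f(\bar z)-f(z)-\nabla f(z)\cdot(\bar x-x)|/d(z,\bar z)^\alpha$ ($\nabla$ the spatial gradient), suprema over $\mathbb{R}\times\mathbb{R}^3$. *)

theory Defs
  imports "HOL-Analysis.Analysis"
begin

type_synonym pt = "real \<times> (real^3)"

definition pdist :: "pt \<Rightarrow> pt \<Rightarrow> real" where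
  "pdist z w = max (sqrt \<bar>fst z - fst w\<bar>) (infnorm (snd z - snd w))"

coinductive smooth :: "('a::euclidean_space \<Rightarrow> real) \<Rightarrow> bool" where
  "(\<And>z. f differentiable (at z)) \<Longrightarrow>
   (\<And>b. b \<in> Basis \<Longrightarrow> smooth (\<lambda>z. frechet_derivative f (at z) b)) \<Longrightarrow> smooth f"

definition dt :: "(pt \<Rightarrow> real) \<Rightarrow> pt \<Rightarrow> real" where
  "dt f z = frechet_derivative f (at z) (1, 0)"

definition dx :: "3 \<Rightarrow> (pt \<Rightarrow> real) \<Rightarrow> pt \<Rightarrow> real" where
  "dx i f z = frechet_derivative f (at z) (0, axis i 1)"

definition lap :: "(pt \<Rightarrow> real) \<Rightarrow> pt \<Rightarrow> real" where
  "lap f z = (\<Sum>i\<in>UNIV. dx i (dx i f) z)"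

definition heat :: "(pt \<Rightarrow> real) \<Rightarrow> pt \<Rightarrow> real" where
  "heat f z = dt f z - lap f z"

definition Pset :: "pt set" where
  "Pset = {(t, x). 0 < t \<and> t < 1 \<and> infnorm x < 1}"

definition PRset :: "real \<Rightarrow> pt set" where
  "PRset R = {(t, x). R\<^sup>2 < t \<and> t < 1 \<and> infnorm x < 1 - R}"

definition kernel :: "(pt \<Rightarrow> real) \<Rightarrow> bool" where
  "kernel \<Phi> \<longleftrightarrow> smooth \<Phi> \<and> (\<forall>z. 0 \<le> \<Phi> z \<and> \<Phi> z \<le> 1) \<and> (\<Phi> has_integral 1) UNIV
     \<and> (\<forall>t x. \<Phi> (t, - x) = \<Phi> (t, x))
     \<and> closure {z. \<Phi> z \<noteq> 0} \<subseteq> {(t, x). 0 < t \<and> t < 1 \<and> infnorm x < 1}"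

definition conv :: "(pt \<Rightarrow> real) \<Rightarrow> (pt \<Rightarrow> real) \<Rightarrow> pt \<Rightarrow> real" where
  "conv f g z = integral UNIV (\<lambda>w. f (z - w) * g w)"

definition PhiT :: "(pt \<Rightarrow> real) \<Rightarrow> real \<Rightarrow> pt \<Rightarrow> real" where
  "PhiT \<Phi> T z = T powr (-5) * \<Phi> (fst z / T\<^sup>2, (1 / T) *\<^sub>R snd z)"

text \<open>PsiTn Phi T n = Psi_{T,n+1} = Phi_{T/2} * ... * Phi_{T/2^(n+1)}.\<close>
primrec PsiTn :: "(pt \<Rightarrow> real) \<Rightarrow> real \<Rightarrow> nat \<Rightarrow> pt \<Rightarrow> real" where
  "PsiTn \<Phi> T 0 = PhiT \<Phi> (T / 2)"
| "PsiTn \<Phi> T (Suc n) = conv (PsiTn \<Phi> T n) (PhiT \<Phi> (T / 2 ^ (n + 2)))"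

definition PsiT :: "(pt \<Rightarrow> real) \<Rightarrow> real \<Rightarrow> pt \<Rightarrow> real" where
  "PsiT \<Phi> T z = lim (\<lambda>n. PsiTn \<Phi> T n z)"

definition mollify :: "(pt \<Rightarrow> real) \<Rightarrow> real \<Rightarrow> (pt \<Rightarrow> real) \<Rightarrow> pt \<Rightarrow> real" where
  "mollify \<Phi> T f z = conv (PsiT \<Phi> T) f z"

definition negnorm :: "(pt \<Rightarrow> real) \<Rightarrow> real \<Rightarrow> (pt \<Rightarrow> real) \<Rightarrow> ereal" where
  "negnorm \<Phi> \<alpha> \<theta> = (SUP z\<in>Pset. SUP T\<in>{0<..1}. ereal (T powr (-\<alpha>) * \<bar>mollify \<Phi> T \<theta> z\<bar>))"

definition hoelder :: "real \<Rightarrow> (pt \<Rightarrow> real) \<Rightarrow> ereal" where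
  "hoelder \<alpha> f = (SUP p\<in>{(z, w). z \<noteq> w}. ereal (\<bar>f (fst p) - f (snd p)\<bar> / pdist (fst p) (snd p) powr \<alpha>))"

definition wsup :: "(pt \<Rightarrow> real) \<Rightarrow> real \<Rightarrow> (pt \<Rightarrow> pt \<Rightarrow> real) \<Rightarrow> ereal" where
  "wsup \<Phi> a F = (SUP x\<in>Pset. SUP T\<in>{0<..<1}.
      ereal (T powr a * \<bar>integral UNIV (\<lambda>y. F x y * PsiT \<Phi> T (x - y))\<bar>))"

definition wsupX :: "(pt \<Rightarrow> real) \<Rightarrow> real \<Rightarrow> (pt \<Rightarrow> real) \<Rightarrow> ereal" where
  "wsupX \<Phi> a g = (SUP x\<in>Pset. SUP T\<in>{0<..<1}.
      ereal (T powr a * infnorm (integral UNIV (\<lambda>y. (g y * PsiT \<Phi> T (x - y)) *\<^sub>R snd (y - x)))))"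

text \<open>Power on nonnegative extended reals (infinity stays infinity).\<close>
definition epow :: "ereal \<Rightarrow> real \<Rightarrow> ereal" where
  "epow q a = (case q of ereal r \<Rightarrow> ereal (r powr a) | PInfty \<Rightarrow> \<infinity> | MInfty \<Rightarrow> 0)"

end

theory Submission
  imports Defs
begin

text \<open>Let $d$ be the parabolic distance to the past boundary of $P$ and let $p$ maximise $|v| \min(d, R)$; put
$M = |v(p)|$. On the past cylinder of radius of order $1/M$ at $p$ one has $|v| \<le> 2M$, and if $M$ exceeds a large multiple of
the claimed bound, then after parabolic rescaling by $1/M$ every noise quantity is small. So it suffices to show: small noise
and $|v| \<le> 2$ on a large past cylinder imply $|v(0)| < 1$.

Locally $v(y) = v(z) - (Y_3(y) - Y_3(z)) - 3 v(z) (Y_2(y) - Y_2(z)) + \<nu>(z) \<cdot> (y - z) + O(d^{5/4})$. The remainder is bounded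
by a Campanato iteration: reconstruction controls the mollified right hand side at each scale, linear in the
remainder and with a small factor from the noise, and the interior regularity of the heat equation comes from the maximum
principle alone. The smallness lets the remainder be absorbed.

Finally the mollification $v_T$ solves $(\<partial>_t - \<Delta>) v_T = - v_T^3 + \mathrm{small}$, and comparison with
$1/2 + b (|x|^2 - t)$ gives $|v_T(0)| \<le> 1/2$.\<close>

section \<open>Convolution with compactly supported kernels\<close>

text \<open>The exponent 5/4 of the remainder lies in a window. It must exceed 21/20, so that
  remainder times \<open>\<tau>2\<close> has positive total order and can be reconstructed. It must
  stay below 7/5, the order left when the coefficient \<open>v\<close> is frozen: 9/20 for the
  oscillation of \<open>v\<close>, minus 21/20 for \<open>\<tau>2\<close>, plus 2 from the heat
  operator. The bound |v| <= 2 keeps every estimate linear in the remainder constant N, even those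
  for powers of \<open>v\<close>; a quadratic dependence could not be absorbed. Absorption needs N
  to be finite beforehand, which is a qualitative consequence of regularity on a compact cylinder.
  Interior estimates lose a boundary layer; therefore N is a supremum over all subcylinders,
  weighted by the power of the radius under which the remainder is scale invariant. One step turns N
  into N/4 + K with K depending on the kernel only. Constants are fixed in the order: scale ratio l,
  then K and N, then the mollification scale T, then the noise size \<open>\<delta>\<close>. The
  numbers n_i (1/2 - \<open>\<epsilon>\<close>) are the scaling dimensions of the Q_i, so one
  dilation by 1/M makes all nine small at once.\<close>

declare split_paired_All [simp del] split_paired_Ex [simp del]

lemma infnorm_le_iff: "infnorm (x::real^3) \<le> r \<longleftrightarrow> (\<forall>i. \<bar>x$i\<bar> \<le> r)"
proof
  assume "infnorm x \<le> r"
  then show "\<forall>i. \<bar>x$i\<bar> \<le> r" using component_le_infnorm_cart[of x] by (meson order_trans)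
next
  assume *: "\<forall>i. \<bar>x$i\<bar> \<le> r"
  show "infnorm x \<le> r"
    unfolding infnorm_cart by (rule cSup_least) (use * in auto)
qed

text \<open>Written as a \<open>cbox\<close>, so that compactness, integrals over boxes and the
  content come from the library. Only nonnegative times occur: a kernel supported here, convolved at
  \<open>z\<close>, sees only the past of \<open>z\<close>.\<close>

definition supp_box :: "real \<Rightarrow> pt set" where
  "supp_box r = cbox (0, \<chi> i. - r) (r\<^sup>2, \<chi> i. r)"

lemma mem_supp_box: "z \<in> supp_box r \<longleftrightarrow> 0 \<le> fst z \<and> fst z \<le> r\<^sup>2 \<and> infnorm (snd z) \<le> r"
  by (cases z) (auto simp: supp_box_def cbox_Pair_eq mem_box_cart infnorm_le_iff abs_le_iff minus_le_iff)

definition cont_csupp :: "(pt \<Rightarrow> real) \<Rightarrow> bool" where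
  "cont_csupp \<psi> \<longleftrightarrow> continuous_on UNIV \<psi> \<and> (\<exists>K. compact K \<and> (\<forall>z. z \<notin> K \<longrightarrow> \<psi> z = 0))"

text \<open>The properties collected here survive convolution (with radii adding) and the limit of
  the iterated kernels. Positivity gives sup bounds, unit mass preserves constants, and evenness in
  \<open>x\<close> preserves affine functions.\<close>

definition bump :: "real \<Rightarrow> (pt \<Rightarrow> real) \<Rightarrow> bool" where
  "bump r \<psi> \<longleftrightarrow> 0 \<le> r \<and> continuous_on UNIV \<psi> \<and> (\<forall>z. 0 \<le> \<psi> z) \<and> (\<forall>z. \<psi> z \<noteq> 0 \<longrightarrow> z \<in> supp_box r)
    \<and> (\<forall>t x. \<psi> (t, - x) = \<psi> (t, x)) \<and> (LINT z|lborel. \<psi> z) = 1"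

lemma bump_cont_csupp: "bump r \<psi> \<Longrightarrow> cont_csupp \<psi>"
  unfolding bump_def cont_csupp_def by (metis supp_box_def compact_cbox)

lemma integrable_compact_supp:
  fixes f :: "'a::euclidean_space \<Rightarrow> real"
  assumes "continuous_on UNIV f" "compact K" "\<And>z. z \<notin> K \<Longrightarrow> f z = 0"
  shows "integrable lborel f"
proof -
  have "integrable lborel (\<lambda>x. indicator K x *\<^sub>R f x)"
    by (rule borel_integrable_compact) (auto intro: continuous_on_subset assms)
  moreover have "(\<lambda>x. indicator K x *\<^sub>R f x) = f"
    using assms(3) by (auto simp: indicator_def fun_eq_iff)
  ultimately show ?thesis by simp
qed

text \<open>Independent factors in time and space cover all substitutions needed later: translation,
  reflection of all variables, reflection of space alone, and parabolic dilation.\<close>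

lemma lborel_integral_affine:
  fixes f :: "pt \<Rightarrow> real"
  assumes f[measurable]: "f \<in> borel_measurable borel" and ab: "a \<noteq> 0" "b \<noteq> 0"
  shows "(LINT y|lborel. f y) = \<bar>a\<bar> * \<bar>b\<bar>^3 * (LINT y|lborel. f (fst p + a * fst y, snd p + b *\<^sub>R snd y))"
proof -
  \<comment> \<open>A basis vector of the product is spatial exactly when its time component
    vanishes.\<close>
  define c where "c = (\<lambda>j::pt. if fst j = 0 then b else a)"
  define T where "T = (\<lambda>y::pt. p + (\<Sum>j\<in>Basis. (c j * (y \<bullet> j)) *\<^sub>R j))"
  have T: "T y = (fst p + a * fst y, snd p + b *\<^sub>R snd y)" for y
  proof -
    have "(\<Sum>j\<in>Basis. (c j * (y \<bullet> j)) *\<^sub>R j) =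
       (\<Sum>i\<in>Basis. (a * (fst y \<bullet> i)) *\<^sub>R (i, 0)) + (\<Sum>i\<in>Basis. (b * (snd y \<bullet> i)) *\<^sub>R (0, i))"
      unfolding sum_Basis_prod_eq
      by (intro arg_cong2[where f="(+)"] sum.cong) (auto simp: c_def inner_Pair_0 zero_prod_def)
    also have "\<dots> = (a * fst y, b *\<^sub>R snd y)"
    proof -
      have "(\<Sum>i\<in>Basis. (b * (snd y \<bullet> i)) *\<^sub>R (0::real, i)) = (0, \<Sum>i\<in>Basis. (b * (snd y \<bullet> i)) *\<^sub>R i)"
        by (simp add: sum_prod)
      also have "(\<Sum>i\<in>Basis. (b * (snd y \<bullet> i)) *\<^sub>R i) = b *\<^sub>R snd y"
        by (simp add: scaleR_scaleR[symmetric] scaleR_sum_right[symmetric] euclidean_representation del: scaleR_scaleR)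
      finally show ?thesis by simp
    qed
    finally show ?thesis by (simp add: T_def prod_eq_iff)
  qed
  have c0: "c j \<noteq> 0" for j using ab by (simp add: c_def)
  have [measurable]: "T \<in> borel \<rightarrow>\<^sub>M borel" unfolding T_def by simp
  have prod: "(\<Prod>j\<in>Basis. \<bar>c j\<bar>) = \<bar>a\<bar> * \<bar>b\<bar>^3"
  proof -
    have "(\<Prod>j\<in>Basis. \<bar>c j\<bar>) = (\<Prod>j\<in>(\<lambda>u. (u, 0)) ` (Basis::real set). \<bar>c j\<bar>) * (\<Prod>j\<in>(\<lambda>u. (0, u)) ` (Basis::(real^3) set). \<bar>c j\<bar>)"
      unfolding Basis_prod_def by (rule prod.union_disjoint) auto
    also have "\<dots> = (\<Prod>j\<in>(Basis::real set). \<bar>a\<bar>) * (\<Prod>j\<in>(Basis::(real^3) set). \<bar>b\<bar>)"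
      by (subst (1 2) prod.reindex) (auto simp: inj_on_def c_def)
    finally show ?thesis by simp
  qed
  have "(LINT y|lborel. f y) = integral\<^sup>L (density (distr lborel borel T) (\<lambda>_. (\<Prod>j\<in>Basis. \<bar>c j\<bar>))) f"
    unfolding T_def using c0 by (subst lborel_affine_euclidean[of c p]) (auto simp: ennreal_mult prod_ennreal)
  also have "\<dots> = (LINT y|distr lborel borel T. (\<bar>a\<bar> * \<bar>b\<bar>^3) *\<^sub>R f y)"
    unfolding prod by (rule integral_density) auto
  also have "\<dots> = (LINT y|lborel. (\<bar>a\<bar> * \<bar>b\<bar>^3) *\<^sub>R f (T y))"
    by (rule integral_distr) auto
  finally show ?thesis by (simp add: T)
qed

text \<open>Bridge from the gauge integral in \<open>conv\<close> to the Lebesgue integral, for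
  which Fubini and substitution are at hand. Compact support of one factor provides the
  integrability.\<close>

lemma conv_swap:
  assumes "cont_csupp \<psi>" "continuous_on UNIV f"
  shows "integrable lborel (\<lambda>y. \<psi> y * f (z - y))"
    and "conv \<psi> f z = (LINT y|lborel. \<psi> y * f (z - y))"
    and "conv \<psi> f z = (LINT y|lborel. \<psi> (z - y) * f y)"
    and "integrable lborel (\<lambda>y. \<psi> (z - y) * f y)"
proof -
  from assms obtain K where K: "compact K" "\<And>z. z \<notin> K \<Longrightarrow> \<psi> z = 0" and c: "continuous_on UNIV \<psi>"
    by (auto simp: cont_csupp_def)
  note [continuous_intros] = continuous_on_compose2[OF c] continuous_on_compose2[OF assms(2)]
  show "integrable lborel (\<lambda>y. \<psi> y * f (z - y))"
    by (rule integrable_compact_supp[OF _ K(1)]) (auto intro!: continuous_intros simp: K)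
  show i: "integrable lborel (\<lambda>y. \<psi> (z - y) * f y)"
  proof (rule integrable_compact_supp)
    show "compact ((\<lambda>y. z - y) ` K)"
      by (intro compact_continuous_image continuous_intros K)
    show "\<And>y. y \<notin> (\<lambda>y. z - y) ` K \<Longrightarrow> \<psi> (z - y) * f y = 0"
    proof -
      fix y assume n: "y \<notin> (\<lambda>y. z - y) ` K"
      have "y = z - (z - y)" by simp
      with n have "z - y \<notin> K" by blast
      then show "\<psi> (z - y) * f y = 0" by (simp add: K(2))
    qed
  qed (auto intro!: continuous_intros)
  show 1: "conv \<psi> f z = (LINT y|lborel. \<psi> (z - y) * f y)"
    unfolding conv_def by (rule integral_lborel[OF i])
  have "(LINT y|lborel. \<psi> (z - y) * f y) = \<bar>-1\<bar> * \<bar>-1\<bar>^3 * (LINT y|lborel. \<psi> (z - (fst z + (-1) * fst y, snd z + (-1) *\<^sub>R snd y)) * f (fst z + (-1) * fst y, snd z + (-1) *\<^sub>R snd y))"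
    by (rule lborel_integral_affine) (use i in \<open>auto dest: borel_measurable_integrable\<close>)
  moreover have "(fst z + (-1) * fst y, snd z + (-1) *\<^sub>R snd y) = z - y" for y by (simp add: prod_eq_iff)
  ultimately show "conv \<psi> f z = (LINT y|lborel. \<psi> y * f (z - y))"
    using 1 by simp
qed

lemma conv_add:
  assumes "cont_csupp \<psi>" "continuous_on UNIV f" "continuous_on UNIV g"
  shows "conv \<psi> (\<lambda>y. f y + g y) z = conv \<psi> f z + conv \<psi> g z"
  using assms by (simp add: conv_swap continuous_on_add distrib_left)

lemma conv_cmult:
  assumes "cont_csupp \<psi>" "continuous_on UNIV f"
  shows "conv \<psi> (\<lambda>y. c * f y) z = c * conv \<psi> f z"
  using assms by (simp add: conv_swap continuous_on_mult mult.left_commute)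

lemma conv_diff:
  assumes "cont_csupp \<psi>" "continuous_on UNIV f" "continuous_on UNIV g"
  shows "conv \<psi> (\<lambda>y. f y - g y) z = conv \<psi> f z - conv \<psi> g z"
  using assms by (simp add: conv_swap continuous_on_diff right_diff_distrib)

lemma conv_cbox:
  assumes "cont_csupp \<psi>" "continuous_on UNIV f" "\<And>y. y \<notin> cbox a b \<Longrightarrow> \<psi> y = 0"
  shows "conv \<psi> f z = integral (cbox a b) (\<lambda>y. \<psi> y * f (z - y))"
proof -
  have "conv \<psi> f z = integral UNIV (\<lambda>y. \<psi> y * f (z - y))"
    using conv_swap[OF assms(1,2)] integral_lborel by metis
  also have "\<dots> = integral UNIV (\<lambda>y. if y \<in> cbox a b then \<psi> y * f (z - y) else 0)"
    using assms(3) by (intro arg_cong[where f="integral UNIV"]) auto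
  finally show ?thesis by (simp add: integral_restrict_UNIV)
qed

lemma cont_csupp_cbox: 
  assumes "cont_csupp \<psi>" obtains a b where "\<And>y. y \<notin> cbox a b \<Longrightarrow> \<psi> y = 0"
proof -
  from assms obtain K where K: "compact K" "\<And>z. z \<notin> K \<Longrightarrow> \<psi> z = 0" by (auto simp: cont_csupp_def)
  then obtain a b where "K \<subseteq> cbox a b" using bounded_subset_cbox_symmetric[OF compact_imp_bounded] by metis
  with K show thesis by (intro that[of a b]) auto
qed

lemma continuous_conv:
  assumes "cont_csupp \<psi>" "continuous_on UNIV f"
  shows "continuous_on UNIV (conv \<psi> f)"
proof -
  from cont_csupp_cbox[OF assms(1)] obtain a b where ab: "\<And>y. y \<notin> cbox a b \<Longrightarrow> \<psi> y = 0" by blast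
  have c: "continuous_on UNIV \<psi>" using assms by (simp add: cont_csupp_def)
  note [continuous_intros] = continuous_on_compose2[OF c] continuous_on_compose2[OF assms(2)]
  have "continuous_on UNIV (\<lambda>z. integral (cbox a b) (\<lambda>y. \<psi> y * f (z - y)))"
    by (rule integral_continuous_on_param) (auto intro!: continuous_intros simp: split_beta)
  moreover have "conv \<psi> f = (\<lambda>z. integral (cbox a b) (\<lambda>y. \<psi> y * f (z - y)))"
    by (intro ext conv_cbox[OF assms ab])
  ultimately show ?thesis by simp
qed

lemma lborel_swap:
  fixes F :: "pt \<Rightarrow> pt \<Rightarrow> real"
  assumes "continuous_on UNIV (\<lambda>(x, y). F x y)" "compact K" "compact K'"
    "\<And>x y. \<not> (x \<in> K \<and> y \<in> K') \<Longrightarrow> F x y = 0"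
  shows "(LINT x|lborel. LINT y|lborel. F x y) = (LINT y|lborel. LINT x|lborel. F x y)"
proof -
  have "integrable lborel (case_prod F)"
    by (rule integrable_compact_supp[where K="K \<times> K'"]) (use assms in \<open>auto simp: compact_Times\<close>)
  then have "integrable (lborel \<Otimes>\<^sub>M lborel) (case_prod F)" by (simp add: lborel_prod)
  from lborel_pair.Fubini_integral[OF this] show ?thesis by simp
qed

lemma cont_csupp_conv:
  assumes "cont_csupp \<phi>" "cont_csupp \<psi>" shows "cont_csupp (conv \<phi> \<psi>)"
proof -
  from assms obtain K where K: "compact K" "\<And>z. z \<notin> K \<Longrightarrow> \<psi> z = 0" by (auto simp: cont_csupp_def)
  from assms obtain K' where K': "compact K'" "\<And>z. z \<notin> K' \<Longrightarrow> \<phi> z = 0" by (auto simp: cont_csupp_def)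
  have "conv \<phi> \<psi> z = 0" if "z \<notin> {x + y |x y. x \<in> K' \<and> y \<in> K}" for z
  proof -
    have "\<phi> y * \<psi> (z - y) = 0" for y
    proof (cases "y \<in> K' \<and> z - y \<in> K")
      case True
      then have "z \<in> {x + y |x y. x \<in> K' \<and> y \<in> K}" by (intro CollectI exI[of _ y] exI[of _ "z - y"]) simp
      with that show ?thesis by blast
    qed (auto simp: K K')
    then have "(LINT y|lborel. \<phi> y * \<psi> (z - y)) = 0" by (simp only: Bochner_Integration.integral_zero)
    then show ?thesis using conv_swap(2)[OF assms(1)] assms(2) by (simp add: cont_csupp_def)
  qed
  moreover have "continuous_on UNIV (conv \<phi> \<psi>)"
    using continuous_conv[OF assms(1)] assms(2) by (simp add: cont_csupp_def)
  ultimately show ?thesis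
    unfolding cont_csupp_def using compact_sums[OF K'(1) K(1)] by blast
qed

text \<open>Fubini followed by the translation \<open>u = w + y\<close>; the compact supports
  confine the integrand to a compact subset of the product, where continuity makes it
  integrable.\<close>

lemma conv_assoc:
  assumes "cont_csupp \<phi>" "cont_csupp \<psi>" "continuous_on UNIV f"
  shows "conv (conv \<phi> \<psi>) f z = conv \<phi> (conv \<psi> f) z"
proof -
  from assms obtain K where K: "compact K" "\<And>z. z \<notin> K \<Longrightarrow> \<psi> z = 0" and c\<psi>: "continuous_on UNIV \<psi>" by (auto simp: cont_csupp_def)
  from assms obtain K' where K': "compact K'" "\<And>z. z \<notin> K' \<Longrightarrow> \<phi> z = 0" and c\<phi>: "continuous_on UNIV \<phi>" by (auto simp: cont_csupp_def)
  note [continuous_intros] = continuous_on_compose2[OF c\<psi>] continuous_on_compose2[OF c\<phi>] continuous_on_compose2[OF assms(3)]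
  have "conv (conv \<phi> \<psi>) f z = (LINT u|lborel. conv \<phi> \<psi> u * f (z - u))"
    by (rule conv_swap) (use cont_csupp_conv assms in auto)
  also have "\<dots> = (LINT u|lborel. LINT w|lborel. \<phi> (u - w) * \<psi> w * f (z - u))"
    by (simp add: conv_swap(3)[OF assms(1) c\<psi>])
  also have "\<dots> = (LINT w|lborel. LINT u|lborel. \<phi> (u - w) * \<psi> w * f (z - u))"
  proof (rule lborel_swap)
    show "compact {x + y |x y. x \<in> K' \<and> y \<in> K}" by (rule compact_sums[OF K'(1) K(1)])
    show "\<phi> (x - y) * \<psi> y * f (z - x) = 0" if "\<not> (x \<in> {x + y |x y. x \<in> K' \<and> y \<in> K} \<and> y \<in> K)" for x y
    proof (cases "y \<in> K \<and> x - y \<in> K'")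
      case True
      then have "x \<in> {x + y |x y. x \<in> K' \<and> y \<in> K}" by (intro CollectI exI[of _ "x - y"] exI[of _ y]) simp
      with that True show ?thesis by blast
    qed (auto simp: K K')
  qed (auto intro!: continuous_intros K simp: split_beta)
  also have "\<dots> = (LINT w|lborel. LINT y|lborel. \<phi> y * \<psi> w * f (z - y - w))"
  proof (rule Bochner_Integration.integral_cong[OF refl])
    fix w :: pt
    have "(LINT u|lborel. \<phi> (u - w) * \<psi> w * f (z - u)) =
      \<bar>1\<bar> * \<bar>1\<bar>^3 * (LINT y|lborel. \<phi> ((fst w + 1 * fst y, snd w + 1 *\<^sub>R snd y) - w) * \<psi> w * f (z - (fst w + 1 * fst y, snd w + 1 *\<^sub>R snd y)))"
      by (rule lborel_integral_affine) (auto intro!: borel_measurable_continuous_onI continuous_intros)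
    moreover have "(fst w + 1 * fst y, snd w + 1 *\<^sub>R snd y) = w + y" for y by (simp add: prod_eq_iff)
    ultimately show "(LINT u|lborel. \<phi> (u - w) * \<psi> w * f (z - u)) = (LINT y|lborel. \<phi> y * \<psi> w * f (z - y - w))"
      by (simp add: diff_diff_eq add.commute)
  qed
  also have "\<dots> = (LINT y|lborel. LINT w|lborel. \<phi> y * \<psi> w * f (z - y - w))"
    by (rule lborel_swap[OF _ K(1) K'(1)]) (use K K' in \<open>auto intro!: continuous_intros simp: split_beta\<close>)
  also have "\<dots> = (LINT y|lborel. \<phi> y * conv \<psi> f (z - y))"
    by (simp add: conv_swap(2)[OF assms(2,3)] mult.assoc)
  also have "\<dots> = conv \<phi> (conv \<psi> f) z"
    by (rule conv_swap(2)[symmetric]) (use assms continuous_conv in auto)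
  finally show ?thesis .
qed

lemma conv_const: "bump r \<psi> \<Longrightarrow> conv \<psi> (\<lambda>_. c) z = c"
  using conv_swap(2)[OF bump_cont_csupp, of r \<psi> "\<lambda>_. c" z] by (simp add: bump_def)

text \<open>Positivity of the kernel. Pointwise information is required on the support only, which
  is what localises all later estimates to past cylinders.\<close>

lemma conv_mono_bound:
  assumes b: "bump r \<psi>" and f: "continuous_on UNIV f" and g: "continuous_on UNIV g"
    and le: "\<And>y. y \<in> supp_box r \<Longrightarrow> f (z - y) \<le> g (z - y)"
  shows "conv \<psi> f z \<le> conv \<psi> g z"
  unfolding conv_swap(2)[OF bump_cont_csupp[OF b] f] conv_swap(2)[OF bump_cont_csupp[OF b] g]
proof (rule integral_mono)
  show "\<psi> y * f (z - y) \<le> \<psi> y * g (z - y)" for y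
    using b le[of y] by (cases "\<psi> y = 0") (auto simp: bump_def intro: mult_left_mono)
qed (intro conv_swap bump_cont_csupp[OF b] f g)+

lemma conv_bound:
  assumes b: "bump r \<psi>" and f: "continuous_on UNIV f"
    and le: "\<And>y. y \<in> supp_box r \<Longrightarrow> \<bar>f (z - y)\<bar> \<le> B"
  shows "\<bar>conv \<psi> f z\<bar> \<le> B"
proof -
  have "conv \<psi> f z \<le> conv \<psi> (\<lambda>_. B) z" "conv \<psi> (\<lambda>_. - B) z \<le> conv \<psi> f z"
    by (intro conv_mono_bound[OF b]; use f le in \<open>force simp: abs_le_iff\<close>)+
  then show ?thesis using conv_const[OF b] by simp
qed

lemma conv_cong:
  assumes b: "bump r \<psi>" and f: "continuous_on UNIV f" and g: "continuous_on UNIV g"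
    and eq: "\<And>y. y \<in> supp_box r \<Longrightarrow> f (z - y) = g (z - y)"
  shows "conv \<psi> f z = conv \<psi> g z"
  by (rule antisym; rule conv_mono_bound[OF b]) (use f g eq in auto)

text \<open>Time extents add up to \<open>r^2 + s^2\<close>, which is at most
  \<open>(r + s)^2\<close>; hence parabolic radii add.\<close>

lemma supp_box_add:
  assumes "x \<in> supp_box r" "y \<in> supp_box s" "0 \<le> r" "0 \<le> s" shows "x + y \<in> supp_box (r + s)"
proof -
  have "fst x + fst y \<le> (r + s)\<^sup>2"
    using assms by (auto simp: mem_supp_box power2_sum intro: add_increasing2)
  moreover have "infnorm (snd x + snd y) \<le> r + s"
    using assms infnorm_triangle[of "snd x" "snd y"] by (auto simp: mem_supp_box)
  ultimately show ?thesis using assms by (auto simp: mem_supp_box)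
qed

lemma lborel_integral_neg_space:
  fixes f :: "pt \<Rightarrow> real"
  assumes "continuous_on UNIV f"
  shows "(LINT y|lborel. f y) = (LINT y|lborel. f (fst y, - snd y))"
  using lborel_integral_affine[of f 1 "-1" 0] assms by (simp add: borel_measurable_continuous_onI)

text \<open>An odd integrand against an even kernel. It removes the affine part when a mollified
  remainder is compared with the remainder itself.\<close>

lemma conv_linear_zero:
  assumes b: "bump r \<psi>"
  shows "conv \<psi> (\<lambda>y. snd (y - z) $ i) z = 0"
proof -
  have c: "continuous_on UNIV \<psi>" using b by (simp add: bump_def)
  note [continuous_intros] = continuous_on_compose2[OF c]
  have eq: "conv \<psi> (\<lambda>y. snd (y - z) $ i) z = (LINT y|lborel. \<psi> y * (- (snd y $ i)))"
    by (subst conv_swap(2)[OF bump_cont_csupp[OF b]]) (auto intro!: continuous_intros)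
  also have "\<dots> = (LINT y|lborel. \<psi> (fst y, - snd y) * (- (snd (fst y, - snd y) $ i)))"
    by (rule lborel_integral_neg_space) (auto intro!: continuous_intros)
  also have "\<dots> = - (LINT y|lborel. \<psi> y * (- (snd y $ i)))"
    using b unfolding bump_def by (simp flip: integral_minus) 
  finally show ?thesis using eq by simp
qed

lemma bump_conv:
  assumes b: "bump r \<phi>" "bump s \<psi>" shows "bump (r + s) (conv \<phi> \<psi>)"
proof -
  note c = bump_cont_csupp[OF b(1)] bump_cont_csupp[OF b(2)]
  have co: "continuous_on UNIV \<psi>" "continuous_on UNIV \<phi>" using b by (auto simp: bump_def)
  note [continuous_intros] = continuous_on_compose2[OF co(1)] continuous_on_compose2[OF co(2)]
  have 1: "0 \<le> conv \<phi> \<psi> z" for z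
    using conv_mono_bound[OF b(1), of "\<lambda>_. 0" \<psi> z] b by (auto simp: bump_def conv_const[OF b(1)])
  have 2: "z \<in> supp_box (r + s)" if "conv \<phi> \<psi> z \<noteq> 0" for z
  proof (rule ccontr)
    assume n: "z \<notin> supp_box (r + s)"
    have "\<phi> y * \<psi> (z - y) = 0" for y
    proof (rule ccontr)
      assume "\<phi> y * \<psi> (z - y) \<noteq> 0"
      then have "y + (z - y) \<in> supp_box (r + s)"
        using b by (intro supp_box_add) (auto simp: bump_def)
      with n show False by simp
    qed
    then have "(LINT y|lborel. \<phi> y * \<psi> (z - y)) = 0" by (simp only: Bochner_Integration.integral_zero)
    then show False using conv_swap(2)[OF c(1) co(1)] that by simp
  qed
  have 3: "conv \<phi> \<psi> (t, - x) = conv \<phi> \<psi> (t, x)" for t x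
  proof -
    have "conv \<phi> \<psi> (t, - x) = (LINT y|lborel. \<phi> y * \<psi> ((t, - x) - y))" by (rule conv_swap) (use c co in auto)
    also have "\<dots> = (LINT y|lborel. \<phi> (fst y, - snd y) * \<psi> ((t, - x) - (fst y, - snd y)))"
      by (rule lborel_integral_neg_space) (auto intro!: continuous_intros)
    also have "\<dots> = (LINT y|lborel. \<phi> y * \<psi> ((t, x) - y))"
    proof (rule Bochner_Integration.integral_cong[OF refl])
      fix y :: pt
      have "(t, - x) - (fst y, - snd y) = (t - fst y, - (x - snd y))" by (simp add: prod_eq_iff)
      then have "\<psi> ((t, - x) - (fst y, - snd y)) = \<psi> (t - fst y, x - snd y)" using b(2) unfolding bump_def by metis
      also have "(t - fst y, x - snd y) = (t, x) - y" by (simp add: prod_eq_iff)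
      finally show "\<phi> (fst y, - snd y) * \<psi> ((t, - x) - (fst y, - snd y)) = \<phi> y * \<psi> ((t, x) - y)"
        using b(1) by (simp add: bump_def)
    qed
    also have "\<dots> = conv \<phi> \<psi> (t, x)" by (rule conv_swap(2)[symmetric]) (use c co in auto)
    finally show ?thesis .
  qed
  have 4: "(LINT z|lborel. conv \<phi> \<psi> z) = 1"
  proof -
    have "(LINT z|lborel. conv \<phi> \<psi> z) = conv (conv \<phi> \<psi>) (\<lambda>_. 1) 0"
      by (subst conv_swap(2)[OF cont_csupp_conv[OF c]]) auto
    also have "\<dots> = 1" using conv_assoc[OF c, of "\<lambda>_. 1" 0] conv_const[OF b(2), of 1] conv_const[OF b(1), of 1 0]
      by (metis (no_types, lifting) ext continuous_on_const)
    finally show ?thesis .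
  qed
  show ?thesis unfolding bump_def
    using 1 2 3 4 b continuous_conv[OF c(1) co(1)] by (auto simp: bump_def)
qed

section \<open>The mollifying kernels\<close>

lemma smooth_imp: 
  assumes "smooth f"
  shows "f differentiable (at z)" "b \<in> Basis \<Longrightarrow> smooth (\<lambda>z. frechet_derivative f (at z) b)"
  using assms by (auto elim: smooth.cases)

lemma smooth_continuous: "smooth f \<Longrightarrow> continuous_on UNIV f"
  by (meson smooth_imp(1) differentiable_imp_continuous_within continuous_on_eq_continuous_within)

lemma bump_mono:
  assumes "bump r \<psi>" "r \<le> s" shows "bump s \<psi>"
proof -
  have "r\<^sup>2 \<le> s\<^sup>2" using assms by (intro power_mono) (auto simp: bump_def)
  then have "supp_box r \<subseteq> supp_box s" using assms(2) by (auto simp: mem_supp_box)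
  then show ?thesis using assms by (auto simp: bump_def)
qed

lemma kernel_bump: assumes "kernel \<Phi>" shows "bump 1 \<Phi>"
proof -
  have c: "continuous_on UNIV \<Phi>" using assms smooth_continuous by (auto simp: kernel_def)
  have s: "z \<in> supp_box 1" if "\<Phi> z \<noteq> 0" for z
  proof -
    have "z \<in> closure {z. \<Phi> z \<noteq> 0}" using that by (intro closure_subset[THEN subsetD] CollectI)
    then have "z \<in> {(t, x). 0 < t \<and> t < 1 \<and> infnorm x < 1}" using assms unfolding kernel_def by blast
    then show ?thesis by (auto simp: mem_supp_box)
  qed
  have "integrable lborel \<Phi>"
    by (rule integrable_compact_supp[OF c, of "supp_box 1"]) (use s in \<open>auto simp: supp_box_def\<close>)
  then have "(LINT z|lborel. \<Phi> z) = integral UNIV \<Phi>" by (simp add: integral_lborel)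
  also have "\<dots> = 1" using assms by (auto simp: kernel_def)
  finally show ?thesis using c s assms by (auto simp: bump_def kernel_def)
qed

lemma smooth_compact_lipschitz:
  fixes f :: "'a::euclidean_space \<Rightarrow> real"
  assumes f: "smooth f" and K: "compact K" "\<And>z. z \<notin> K \<Longrightarrow> f z = 0"
  obtains \<Lambda> where "\<Lambda> \<ge> 0" "\<And>z w. \<bar>f z - f w\<bar> \<le> \<Lambda> * norm (z - w)"
proof -
  let ?pdv = "\<lambda>z. frechet_derivative f (at z)"
  have d: "(f has_derivative ?pdv z) (at z)" for z
    using smooth_imp(1)[OF f] by (simp add: frechet_derivative_works)
  have z0: "?pdv z b = 0" if "z \<notin> K" for z b
  proof -
    have "open (- K)" using K compact_imp_closed by blast
    then have "(f has_derivative (\<lambda>_. 0)) (at z)"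
      by (rule has_derivative_transform_within_open[OF has_derivative_const[of 0]]) (use that K in auto)
    with d[of z] have "?pdv z = (\<lambda>_. 0)" by (rule has_derivative_unique)
    then show ?thesis by simp
  qed
  have "\<exists>M\<ge>0. \<forall>z. \<bar>?pdv z b\<bar> \<le> M" if "b \<in> Basis" for b
  proof -
    have "continuous_on K (\<lambda>z. ?pdv z b)"
      using smooth_continuous[OF smooth_imp(2)[OF f that]] continuous_on_subset by blast
    then have "compact ((\<lambda>z. ?pdv z b) ` K)" using K compact_continuous_image by blast
    then have "bounded ((\<lambda>z. ?pdv z b) ` K)" by (rule compact_imp_bounded)
    then obtain M where M: "\<forall>z\<in>K. \<bar>?pdv z b\<bar> \<le> M" unfolding bounded_iff by auto
    have "\<bar>?pdv z b\<bar> \<le> max M 0" for z using M z0[of z b] by (cases "z \<in> K") (auto simp: le_max_iff_disj)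
    then show ?thesis by (intro exI[of _ "max M 0"]) auto
  qed
  then obtain M where M: "\<And>b. b \<in> Basis \<Longrightarrow> M b \<ge> 0 \<and> (\<forall>z. \<bar>?pdv z b\<bar> \<le> M b)" by metis
  define \<Lambda> where "\<Lambda> = (\<Sum>b\<in>(Basis::'a set). M b)"
  have "onorm (?pdv z) \<le> \<Lambda>" for z
  proof (rule onorm_le)
    fix h :: 'a
    have l: "linear (?pdv z)" using d has_derivative_linear by blast
    have "?pdv z h = ?pdv z (\<Sum>b\<in>Basis. (h \<bullet> b) *\<^sub>R b)" by (simp add: euclidean_representation)
    also have "\<dots> = (\<Sum>b\<in>Basis. (h \<bullet> b) * ?pdv z b)" using l by (simp add: linear_sum linear_cmul)
    finally have "\<bar>?pdv z h\<bar> \<le> (\<Sum>b\<in>Basis. \<bar>h \<bullet> b\<bar> * \<bar>?pdv z b\<bar>)" by (metis (no_types, lifting) abs_mult sum_abs sum.cong)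
    also have "\<dots> \<le> (\<Sum>b\<in>Basis. norm h * M b)"
      by (intro sum_mono mult_mono) (use M Basis_le_norm in auto)
    finally show "norm (?pdv z h) \<le> \<Lambda> * norm h" by (simp add: \<Lambda>_def sum_distrib_left mult.commute)
  qed
  then have "norm (f z - f w) \<le> \<Lambda> * norm (z - w)" for z w
    by (intro differentiable_bound[of UNIV f ?pdv]) (use d in auto)
  then show thesis by (intro that[of \<Lambda>]) (use M in \<open>auto simp: \<Lambda>_def intro!: sum_nonneg\<close>)
qed

definition dil :: "real \<Rightarrow> pt \<Rightarrow> pt" where "dil r y = (r\<^sup>2 * fst y, r *\<^sub>R snd y)"

lemma PhiT_dil: "T > 0 \<Longrightarrow> PhiT \<Phi> T z = \<Phi> (dil (1 / T) z) / T^5"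
  by (simp add: PhiT_def dil_def powr_minus_divide power_divide flip: powr_numeral)

lemma dil_dil [simp]: "dil r (dil s z) = dil (r * s) z"
  by (simp add: dil_def power_mult_distrib)

lemma dil_1 [simp]: "dil 1 z = z" by (simp add: dil_def)

lemma continuous_dil [continuous_intros]: "continuous_on S f \<Longrightarrow> continuous_on S (\<lambda>z. dil r (f z))"
  unfolding dil_def by (intro continuous_intros)

lemma dil_mem_supp_box: "r > 0 \<Longrightarrow> dil r z \<in> supp_box (r * s) \<longleftrightarrow> z \<in> supp_box s"
  by (simp add: mem_supp_box dil_def power_mult_distrib infnorm_mul zero_le_mult_iff)

lemma dil_diff: "dil r x - dil r y = dil r (x - y)"
  by (simp add: dil_def prod_eq_iff algebra_simps)

text \<open>The exponent 5 = 2 + 3 is the homogeneous dimension of parabolic space-time.\<close>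

lemma lborel_integral_dil:
  fixes f :: "pt \<Rightarrow> real"
  assumes "f \<in> borel_measurable borel" "r > 0"
  shows "(LINT y|lborel. f y) = r^5 * (LINT y|lborel. f (p + dil r y))"
  using lborel_integral_affine[of f "r\<^sup>2" r p] assms
  by (simp add: dil_def plus_prod_def power2_eq_square eval_nat_numeral)

lemma PhiT_bump: assumes "bump 1 \<Phi>" "T > 0" shows "bump T (PhiT \<Phi> T)"
proof -
  have c: "continuous_on UNIV \<Phi>" using assms by (simp add: bump_def)
  note [continuous_intros] = continuous_on_compose2[OF c]
  have eq: "PhiT \<Phi> T = (\<lambda>z. \<Phi> (dil (1 / T) z) / T^5)" using PhiT_dil assms by auto
  have 1: "z \<in> supp_box T" if "\<Phi> (dil (1 / T) z) \<noteq> 0" for z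
  proof -
    have "dil (1 / T) z \<in> supp_box (1 / T * T)" using that assms by (auto simp: bump_def)
    then show ?thesis using assms by (subst (asm) dil_mem_supp_box) auto
  qed
  have 2: "\<Phi> (dil (1 / T) (t, - x)) = \<Phi> (dil (1 / T) (t, x))" for t x
    using assms by (simp add: bump_def dil_def)
  have 3: "(LINT z|lborel. \<Phi> (dil (1 / T) z) / T^5) = 1"
  proof -
    have "(LINT z|lborel. \<Phi> (dil (1 / T) z) / T^5) = T^5 * (LINT z|lborel. \<Phi> (dil (1 / T) (0 + dil T z)) / T^5)"
      by (rule lborel_integral_dil) (use assms in \<open>auto intro!: borel_measurable_continuous_onI continuous_intros\<close>)
    also have "\<dots> = 1" using assms by (simp add: bump_def)
    finally show ?thesis .
  qed
  show ?thesis unfolding eq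
    using assms 1 2 3 by (auto simp: bump_def intro!: continuous_intros)
qed

lemma conv_comm:
  assumes "cont_csupp \<phi>" "cont_csupp \<psi>" shows "conv \<phi> \<psi> z = conv \<psi> \<phi> z"
  using conv_swap(2)[OF assms(1), of \<psi> z] conv_swap(3)[OF assms(2), of \<phi> z] assms
  by (simp add: cont_csupp_def mult.commute)

lemma conv_shift:
  assumes "cont_csupp \<phi>" "continuous_on UNIV g" shows "conv \<phi> g (z + h) = conv \<phi> (\<lambda>y. g (y + h)) z"
proof -
  have "continuous_on UNIV (\<lambda>y. g (y + h))" by (intro continuous_on_compose2[OF assms(2)] continuous_intros) auto
  then show ?thesis using assms by (simp add: conv_swap(2) algebra_simps)
qed

lemma conv_lipschitz:
  assumes b: "bump r \<phi>" and c: "continuous_on UNIV g" and L: "\<And>z w. \<bar>g z - g w\<bar> \<le> \<Lambda> * norm (z - w)"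
  shows "\<bar>conv \<phi> g z - conv \<phi> g w\<bar> \<le> \<Lambda> * norm (z - w)"
proof -
  have c': "continuous_on UNIV (\<lambda>y. g (y + (z - w)))" by (intro continuous_on_compose2[OF c] continuous_intros) auto
  have "conv \<phi> g z = conv \<phi> (\<lambda>y. g (y + (z - w))) w"
    using conv_shift[OF bump_cont_csupp[OF b] c, of w "z - w"] by simp
  then have "conv \<phi> g z - conv \<phi> g w = conv \<phi> (\<lambda>y. g (y + (z - w)) - g y) w"
    using conv_diff[OF bump_cont_csupp[OF b] c' c] by simp
  also have "\<bar>\<dots>\<bar> \<le> \<Lambda> * norm (z - w)"
  proof (rule conv_bound[OF b continuous_on_diff[OF c' c]])
    fix y show "\<bar>g (w - y + (z - w)) - g (w - y)\<bar> \<le> \<Lambda> * norm (z - w)"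
      using L[of "w - y + (z - w)" "w - y"] by simp
  qed
  finally show ?thesis .
qed

lemma norm_supp_box: assumes "y \<in> supp_box s" "0 \<le> s" shows "norm y \<le> s\<^sup>2 + 2 * s"
proof -
  have "norm y \<le> norm (fst y) + norm (snd y)" by (metis norm_Pair_le prod.collapse)
  moreover have "norm (snd y) \<le> sqrt 3 * infnorm (snd y)" using norm_le_infnorm[of "snd y"] by simp
  moreover have "sqrt 3 * infnorm (snd y) \<le> 2 * s"
    using assms by (intro mult_mono) (auto simp: mem_supp_box real_le_lsqrt infnorm_pos_le)
  ultimately show ?thesis using assms by (auto simp: mem_supp_box)
qed

text \<open>Unit mass turns the difference into an average of increments of \<open>g\<close> over
  the support, whose diameter is bounded by \<open>norm_supp_box\<close>.\<close>

lemma conv_close: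
  assumes b: "bump s \<phi>" and c: "continuous_on UNIV g" and L: "\<And>z w. \<bar>g z - g w\<bar> \<le> \<Lambda> * norm (z - w)" "0 \<le> \<Lambda>"
  shows "\<bar>conv \<phi> g z - g z\<bar> \<le> \<Lambda> * (s\<^sup>2 + 2 * s)"
proof -
  have "conv \<phi> g z - g z = conv \<phi> (\<lambda>y. g y - g z) z"
    using conv_diff[OF bump_cont_csupp[OF b] c, of "\<lambda>_. g z" z] conv_const[OF b, of "g z" z] by simp
  also have "\<bar>\<dots>\<bar> \<le> \<Lambda> * (s\<^sup>2 + 2 * s)"
  proof (rule conv_bound[OF b])
    fix y assume "y \<in> supp_box s"
    then have "norm y \<le> s\<^sup>2 + 2 * s" using b by (intro norm_supp_box) (auto simp: bump_def)
    then have "\<Lambda> * norm ((z - y) - z) \<le> \<Lambda> * (s\<^sup>2 + 2 * s)" using L(2) by (intro mult_left_mono) auto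
    with L(1)[of "z - y" z] show "\<bar>g (z - y) - g z\<bar> \<le> \<Lambda> * (s\<^sup>2 + 2 * s)" by linarith
  qed (auto intro!: continuous_on_diff c)
  finally show ?thesis .
qed

text \<open>The dilated displacement is kept inside the norm: for a purely spatial shift it gives
  the sharp factor 1/T, which an estimate by \<open>norm (z - w)\<close> would lose because time
  scales like T^2.\<close>

lemma PhiT_lipschitz_space:
  assumes "kernel \<Phi>"
  obtains \<Lambda> where "\<Lambda> \<ge> 0" "\<And>T z w. T > 0 \<Longrightarrow> \<bar>PhiT \<Phi> T z - PhiT \<Phi> T w\<bar> \<le> \<Lambda> * norm (dil (1 / T) (z - w)) / T ^ 5"
proof -
  have b: "bump 1 \<Phi>" using kernel_bump[OF assms] .
  from assms have "smooth \<Phi>" by (simp add: kernel_def)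
  then obtain \<Lambda> where L: "\<Lambda> \<ge> 0" "\<And>z w. \<bar>\<Phi> z - \<Phi> w\<bar> \<le> \<Lambda> * norm (z - w)"
    by (rule smooth_compact_lipschitz[of _ "supp_box 1"]) (use b in \<open>auto simp: bump_def supp_box_def\<close>)
  show thesis
  proof (rule that[OF L(1)])
    fix T :: real and z w :: pt assume T: "T > 0"
    have "\<bar>PhiT \<Phi> T z - PhiT \<Phi> T w\<bar> = \<bar>\<Phi> (dil (1/T) z) - \<Phi> (dil (1/T) w)\<bar> / T^5"
      using T by (simp add: PhiT_dil diff_divide_distrib[symmetric])
    also have "\<dots> \<le> \<Lambda> * norm (dil (1/T) z - dil (1/T) w) / T^5"
      using T by (intro divide_right_mono L) auto
    finally show "\<bar>PhiT \<Phi> T z - PhiT \<Phi> T w\<bar> \<le> \<Lambda> * norm (dil (1 / T) (z - w)) / T ^ 5" by (simp add: dil_diff)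
  qed
qed

lemma PhiT_lipschitz:
  assumes "kernel \<Phi>" "T > 0"
  obtains \<Lambda> where "\<Lambda> \<ge> 0" "\<And>z w. \<bar>PhiT \<Phi> T z - PhiT \<Phi> T w\<bar> \<le> \<Lambda> * norm (z - w)"
proof -
  obtain \<Lambda> where L: "\<Lambda> \<ge> 0" "\<And>T z w. T > 0 \<Longrightarrow> \<bar>PhiT \<Phi> T z - PhiT \<Phi> T w\<bar> \<le> \<Lambda> * norm (dil (1 / T) (z - w)) / T ^ 5"
    using PhiT_lipschitz_space[OF assms(1)] by blast
  define q where "q = 1 / T\<^sup>2 + 1 / T"
  have n: "norm (dil (1 / T) z) \<le> q * norm z" for z
  proof -
    have "norm (dil (1 / T) z) \<le> norm (fst (dil (1/T) z)) + norm (snd (dil (1/T) z))" by (metis norm_Pair_le prod.collapse)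
    also have "\<dots> = norm (fst z) / T\<^sup>2 + norm (snd z) / T" using assms by (simp add: dil_def power_divide abs_mult)
    also have "\<dots> \<le> norm z / T\<^sup>2 + norm z / T"
      using assms norm_fst_le[of "fst z" "snd z"] norm_snd_le[of "snd z" "fst z"]
      by (intro add_mono divide_right_mono) auto
    finally show ?thesis by (simp add: q_def algebra_simps)
  qed
  show thesis
  proof (rule that[of "\<Lambda> * q / T^5"])
    show "0 \<le> \<Lambda> * q / T ^ 5" using L assms by (auto simp: q_def)
    show "\<bar>PhiT \<Phi> T z - PhiT \<Phi> T w\<bar> \<le> \<Lambda> * q / T ^ 5 * norm (z - w)" for z w
    proof -
      have "\<Lambda> * norm (dil (1 / T) (z - w)) / T ^ 5 \<le> \<Lambda> * (q * norm (z - w)) / T^5"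
        using L assms by (intro divide_right_mono mult_left_mono n) auto
      with L(2)[OF assms(2), of z w] show ?thesis by simp
    qed
  qed
qed

lemma PsiTn_bump:
  assumes "bump 1 \<Phi>" "T > 0" shows "bump (T - T / 2 ^ (n + 1)) (PsiTn \<Phi> T n)"
proof (induction n)
  case 0 then show ?case using PhiT_bump[OF assms(1), of "T / 2"] assms by simp
next
  case (Suc n)
  have "bump (T - T / 2 ^ (n + 1) + T / 2 ^ (n + 2)) (conv (PsiTn \<Phi> T n) (PhiT \<Phi> (T / 2 ^ (n + 2))))"
    by (intro bump_conv Suc PhiT_bump assms) (use assms in auto)
  then show ?case by simp
qed

lemma PsiTn_bump': assumes "bump 1 \<Phi>" "T > 0" shows "bump T (PsiTn \<Phi> T n)"
  using bump_mono[OF PsiTn_bump[OF assms]] assms by simp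

text \<open>All \<open>PsiTn \<Phi> T n\<close> share the Lipschitz constant of their first factor,
  since averaging does not increase it. The next factor has radius \<open>T / 2 ^ (n + 2)\<close>
  and moves a Lipschitz function by the order of that radius, so the increments are
  summable.\<close>

lemma PsiTn_uniform:
  assumes k: "kernel \<Phi>" and T: "T > 0"
  shows "uniform_limit UNIV (PsiTn \<Phi> T) (PsiT \<Phi> T) sequentially"
proof -
  note b = kernel_bump[OF k]
  note bn = PsiTn_bump'[OF b T]
  have cn: "continuous_on UNIV (PsiTn \<Phi> T n)" for n using bn by (simp add: bump_def)
  obtain \<Lambda> where L: "\<Lambda> \<ge> 0" "\<And>z w. \<bar>PhiT \<Phi> (T/2) z - PhiT \<Phi> (T/2) w\<bar> \<le> \<Lambda> * norm (z - w)"
    using PhiT_lipschitz[OF k, of "T/2"] T by (metis half_gt_zero)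
  have bp: "bump (T / 2 ^ (n + 2)) (PhiT \<Phi> (T / 2 ^ (n + 2)))" for n by (rule PhiT_bump[OF b]) (use T in auto)
  have S: "PsiTn \<Phi> T (Suc n) z = conv (PhiT \<Phi> (T / 2 ^ (n + 2))) (PsiTn \<Phi> T n) z" for n z
    using conv_comm[OF bump_cont_csupp[OF bn] bump_cont_csupp[OF bp]] by simp
  have Ln: "\<bar>PsiTn \<Phi> T n z - PsiTn \<Phi> T n w\<bar> \<le> \<Lambda> * norm (z - w)" for n z w
  proof (induction n arbitrary: z w)
    case 0 then show ?case using L by simp
  next
    case (Suc n) show ?case unfolding S by (rule conv_lipschitz[OF bp cn Suc])
  qed
  define d where "d = (\<lambda>n z. PsiTn \<Phi> T (Suc n) z - PsiTn \<Phi> T n z)"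
  define M where "M = \<Lambda> * (T\<^sup>2 + 2 * T)"
  have d: "norm (d n z) \<le> M * (1 / 2) ^ n" for n z
  proof -
    let ?s = "T / 2 ^ (n + 2)"
    have "\<bar>d n z\<bar> \<le> \<Lambda> * (?s\<^sup>2 + 2 * ?s)" unfolding d_def S by (rule conv_close[OF bp cn Ln L(1)])
    also have "\<dots> \<le> \<Lambda> * (T\<^sup>2 * (1/2)^n + 2 * (T * (1/2)^n))"
    proof (intro mult_left_mono add_mono L)
      have s1: "?s \<le> T * (1/2)^n" using T by (simp add: field_simps)
      then show "?s \<le> T * (1/2)^n" .
      have "?s\<^sup>2 = ?s * ?s" by (simp add: power2_eq_square)
      also have "\<dots> \<le> T * (T * (1/2)^n)" 
      proof (intro mult_mono s1)
        have "T / 2 ^ (n + 2) \<le> T / 1" using T one_le_power[of "2::real" "n + 2"] by (intro divide_left_mono) auto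
        then show "T / 2 ^ (n + 2) \<le> T" by simp
      qed (use T in auto)
      finally show "?s\<^sup>2 \<le> T\<^sup>2 * (1/2)^n" by (simp add: power2_eq_square)
    qed auto
    finally show ?thesis by (simp add: M_def algebra_simps)
  qed
  have sM: "summable (\<lambda>n. M * (1 / 2 :: real) ^ n)" by (intro summable_mult summable_geometric) auto
  have "uniform_limit UNIV (\<lambda>n z. \<Sum>i<n. d i z) (\<lambda>z. suminf (\<lambda>i. d i z)) sequentially"
    by (rule Weierstrass_m_test[OF _ sM]) (use d in auto)
  then have "uniform_limit UNIV (\<lambda>n z. PsiTn \<Phi> T 0 z + (\<Sum>i<n. d i z)) (\<lambda>z. PsiTn \<Phi> T 0 z + suminf (\<lambda>i. d i z)) sequentially"
    by (intro uniform_limit_add uniform_limit_const)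
  moreover have "PsiTn \<Phi> T 0 z + (\<Sum>i<n. d i z) = PsiTn \<Phi> T n z" for n z
    unfolding d_def by (induction n) (simp_all del: PsiTn.simps)
  ultimately have u: "uniform_limit UNIV (PsiTn \<Phi> T) (\<lambda>z. PsiTn \<Phi> T 0 z + suminf (\<lambda>i. d i z)) sequentially" by (simp only:)
  have "PsiT \<Phi> T z = PsiTn \<Phi> T 0 z + suminf (\<lambda>i. d i z)" for z
    unfolding PsiT_def by (rule limI[OF tendsto_uniform_limitI[OF u]]) simp
  then have "PsiT \<Phi> T = (\<lambda>z. PsiTn \<Phi> T 0 z + suminf (\<lambda>i. d i z))" by (rule ext)
  then show ?thesis using u by (simp only:)
qed

lemma PsiTn_tendsto: "kernel \<Phi> \<Longrightarrow> T > 0 \<Longrightarrow> (\<lambda>n. PsiTn \<Phi> T n z) \<longlonglongrightarrow> PsiT \<Phi> T z"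
  using tendsto_uniform_limitI[OF PsiTn_uniform, of \<Phi> T z] by simp

lemma PsiT_bump:
  assumes k: "kernel \<Phi>" and T: "T > 0" shows "bump T (PsiT \<Phi> T)"
proof -
  note b = kernel_bump[OF k]
  note bn = PsiTn_bump'[OF b T]
  note l = PsiTn_tendsto[OF k T]
  note u = PsiTn_uniform[OF k T]
  have cn: "continuous_on UNIV (PsiTn \<Phi> T n)" for n using bn by (simp add: bump_def)
  have 1: "continuous_on UNIV (PsiT \<Phi> T)" by (rule uniform_limit_theorem[OF _ u]) (use cn in auto)
  have 2: "0 \<le> PsiT \<Phi> T z" for z by (rule LIMSEQ_le_const[OF l]) (use bn in \<open>auto simp: bump_def\<close>)
  have 3: "z \<in> supp_box T" if "PsiT \<Phi> T z \<noteq> 0" for z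
  proof (rule ccontr)
    assume "z \<notin> supp_box T"
    then have "PsiTn \<Phi> T n z = 0" for n using bn by (auto simp: bump_def)
    then have "(\<lambda>n. PsiTn \<Phi> T n z) \<longlonglongrightarrow> 0" by simp
    with l[of z] that show False using LIMSEQ_unique by blast
  qed
  have 4: "PsiT \<Phi> T (t, - x) = PsiT \<Phi> T (t, x)" for t x
    unfolding PsiT_def using bn by (auto simp: bump_def)
  have ci: "conv \<psi> (\<lambda>_. 1) 0 = integral (supp_box T) \<psi>" if "continuous_on UNIV \<psi>" "\<And>z. \<psi> z \<noteq> 0 \<Longrightarrow> z \<in> supp_box T" for \<psi>
  proof -
    have "cont_csupp \<psi>" using that unfolding cont_csupp_def by (metis supp_box_def compact_cbox)
    then have "conv \<psi> (\<lambda>_. 1) 0 = integral (supp_box T) (\<lambda>y. \<psi> y * 1)"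
      unfolding supp_box_def by (rule conv_cbox[OF _ continuous_on_const]) (use that(2) in \<open>unfold supp_box_def, blast\<close>)
    then show ?thesis by simp
  qed
  \<comment> \<open>The mass passes to the limit because convergence is uniform on the common
    compact support \<open>supp_box T\<close>.\<close>
  have 5: "(LINT z|lborel. PsiT \<Phi> T z) = 1"
  proof -
    have cc: "cont_csupp (PsiT \<Phi> T)" using 1 3 unfolding cont_csupp_def by (metis supp_box_def compact_cbox)
    obtain I J where I: "\<And>n. (PsiTn \<Phi> T n has_integral I n) (supp_box T)" "(PsiT \<Phi> T has_integral J) (supp_box T)" "I \<longlonglongrightarrow> J"
      unfolding supp_box_def
      by (rule uniform_limit_integral_cbox[OF uniform_limit_on_subset[OF u] continuous_on_subset[OF cn]]) auto
    have "I n = 1" for n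
    proof -
      have "I n = conv (PsiTn \<Phi> T n) (\<lambda>_. 1) 0" using ci[OF cn, of n] bn integral_unique[OF I(1)[of n]] by (auto simp: bump_def)
      then show ?thesis using conv_const[OF bn] by simp
    qed
    then have "I = (\<lambda>_. 1)" by auto
    then have "J = 1" using I(3) LIMSEQ_unique[of "\<lambda>_. 1::real" 1 J] by simp
    then have "conv (PsiT \<Phi> T) (\<lambda>_. 1) 0 = 1" using ci[OF 1 3] I(2) by auto
    then show ?thesis using conv_swap(2)[OF cc, of "\<lambda>_. 1" 0] by simp
  qed
  show ?thesis using 1 2 3 4 5 T by (auto simp: bump_def)
qed

text \<open>The recursion appends the finest factor on the right, while the analysis needs the
  coarsest one split off on the left. What remains is the same product started at scale
  \<open>T / 2\<close>; this is the source of the semigroup identity.\<close>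

lemma PsiTn_Suc_left:
  assumes k: "kernel \<Phi>" and T: "T > 0"
  shows "PsiTn \<Phi> T (Suc n) = conv (PhiT \<Phi> (T / 2)) (PsiTn \<Phi> (T / 2) n)"
proof (induction n)
  case 0 show ?case by simp
next
  case (Suc n)
  note b = kernel_bump[OF k]
  have bp: "bump s (PhiT \<Phi> s)" if "s > 0" for s by (rule PhiT_bump[OF b that])
  have "PsiTn \<Phi> T (Suc (Suc n)) = conv (conv (PhiT \<Phi> (T / 2)) (PsiTn \<Phi> (T / 2) n)) (PhiT \<Phi> (T / 2 ^ (n + 3)))"
    unfolding PsiTn.simps(2)[of \<Phi> T "Suc n"] Suc by (simp add: eval_nat_numeral)
  also have "\<dots> = conv (PhiT \<Phi> (T / 2)) (conv (PsiTn \<Phi> (T / 2) n) (PhiT \<Phi> (T / 2 ^ (n + 3))))"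
    by (intro ext conv_assoc bump_cont_csupp[OF bp] bump_cont_csupp[OF PsiTn_bump'[OF b]])
       (use T bp[of "T / 2 ^ (n + 3)"] in \<open>auto simp: bump_def\<close>)
  finally show ?case by (simp add: eval_nat_numeral)
qed

lemma PsiT_semigroup:
  assumes k: "kernel \<Phi>" and T: "T > 0"
  shows "PsiT \<Phi> T = conv (PhiT \<Phi> (T / 2)) (PsiT \<Phi> (T / 2))"
proof
  fix z
  note b = kernel_bump[OF k]
  have T2: "T / 2 > 0" using T by simp
  have bp: "bump (T/2) (PhiT \<Phi> (T/2))" by (rule PhiT_bump[OF b T2])
  have cn: "continuous_on UNIV (PsiTn \<Phi> (T/2) n)" for n using PsiTn_bump'[OF b T2] by (simp add: bump_def)
  have c: "continuous_on UNIV (PsiT \<Phi> (T/2))" using PsiT_bump[OF k T2] by (simp add: bump_def)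
  have "(\<lambda>n. conv (PhiT \<Phi> (T/2)) (PsiTn \<Phi> (T/2) n) z) \<longlonglongrightarrow> conv (PhiT \<Phi> (T/2)) (PsiT \<Phi> (T/2)) z"
  proof (rule LIMSEQ_I)
    fix e :: real assume e: "e > 0"
    from uniform_limitD[OF PsiTn_uniform[OF k T2], of "e/2"] e obtain N where
      N: "\<And>n x. n \<ge> N \<Longrightarrow> \<bar>PsiTn \<Phi> (T/2) n x - PsiT \<Phi> (T/2) x\<bar> < e/2"
      by (auto simp: eventually_sequentially dist_real_def)
    have "\<bar>conv (PhiT \<Phi> (T/2)) (PsiTn \<Phi> (T/2) n) z - conv (PhiT \<Phi> (T/2)) (PsiT \<Phi> (T/2)) z\<bar> \<le> e/2" if "n \<ge> N" for n
      unfolding conv_diff[OF bump_cont_csupp[OF bp] cn c, symmetric]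
      by (rule conv_bound[OF bp continuous_on_diff[OF cn c]]) (rule less_imp_le[OF N[OF that]])
    then show "\<exists>N. \<forall>n\<ge>N. norm (conv (PhiT \<Phi> (T/2)) (PsiTn \<Phi> (T/2) n) z - conv (PhiT \<Phi> (T/2)) (PsiT \<Phi> (T/2)) z) < e"
      using e by (intro exI[of _ N]) (smt (verit) field_sum_of_halves real_norm_def)
  qed
  moreover have "(\<lambda>n. PsiTn \<Phi> T (Suc n) z) \<longlonglongrightarrow> PsiT \<Phi> T z"
    using PsiTn_tendsto[OF k T] LIMSEQ_Suc by blast
  ultimately show "PsiT \<Phi> T z = conv (PhiT \<Phi> (T / 2)) (PsiT \<Phi> (T / 2)) z"
    unfolding PsiTn_Suc_left[OF k T] using LIMSEQ_unique by blast
qed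

lemma mollify_semigroup:
  assumes k: "kernel \<Phi>" and T: "T > 0" and f: "continuous_on UNIV f"
  shows "conv (PsiT \<Phi> T) f z = conv (PhiT \<Phi> (T / 2)) (conv (PsiT \<Phi> (T / 2)) f) z"
  unfolding PsiT_semigroup[OF k T]
  by (rule conv_assoc) (use T f k in \<open>auto intro!: bump_cont_csupp PhiT_bump kernel_bump PsiT_bump\<close>)

text \<open>Stated for a general pair \<open>f\<close>, \<open>f'\<close>, so that it serves both
  the induction over the finite products and the mollification of a rescaled function.\<close>

lemma conv_dil:
  assumes r: "r > 0" and f: "cont_csupp f" and g: "continuous_on UNIV g"
    and f': "\<And>y. f (dil r y) = f' y / r^5"
  shows "conv f g (p + dil r z) = (LINT y|lborel. f' (z - y) * g (p + dil r y))"
proof -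
  have cf: "continuous_on UNIV f" using f by (simp add: cont_csupp_def)
  note [continuous_intros] = continuous_on_compose2[OF cf] continuous_on_compose2[OF g]
  have "conv f g (p + dil r z) = (LINT y|lborel. f ((p + dil r z) - y) * g y)"
    by (rule conv_swap(3)[OF f g])
  also have "\<dots> = r^5 * (LINT y|lborel. f ((p + dil r z) - (p + dil r y)) * g (p + dil r y))"
    by (rule lborel_integral_dil[OF _ r]) (auto intro!: borel_measurable_continuous_onI continuous_intros)
  also have "\<dots> = (LINT y|lborel. f' (z - y) * g (p + dil r y))"
    using r by (simp add: dil_diff f')
  finally show ?thesis .
qed

lemma PhiT_scale: "r > 0 \<Longrightarrow> T > 0 \<Longrightarrow> PhiT \<Phi> (r * T) (dil r z) = PhiT \<Phi> T z / r^5"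
  by (simp add: PhiT_dil power_mult_distrib field_simps)

lemma PsiTn_scale:
  assumes b: "bump 1 \<Phi>" and r: "r > 0" and T: "T > 0"
  shows "PsiTn \<Phi> (r * T) n (dil r z) = PsiTn \<Phi> T n z / r^5"
proof (induction n arbitrary: z)
  case 0 then show ?case using PhiT_scale[of r "T/2"] assms by simp
next
  case (Suc n)
  have rT: "r * T > 0" using r T by simp
  have c: "cont_csupp (PsiTn \<Phi> (r * T) n)" "cont_csupp (PsiTn \<Phi> T n)" using PsiTn_bump'[OF b] rT T bump_cont_csupp by blast+
  have q: "r * T / 2 ^ (n + 2) > 0" "T / 2 ^ (n + 2) > 0" using rT T by auto
  have cq: "continuous_on UNIV (PhiT \<Phi> (r * T / 2 ^ (n + 2)))" "continuous_on UNIV (PhiT \<Phi> (T / 2 ^ (n + 2)))"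
    using PhiT_bump[OF b q(1)] PhiT_bump[OF b q(2)] by (auto simp: bump_def)
  have "PsiTn \<Phi> (r * T) (Suc n) (dil r z) = conv (PsiTn \<Phi> (r * T) n) (PhiT \<Phi> (r * T / 2 ^ (n + 2))) (0 + dil r z)" by simp
  also have "\<dots> = (LINT y|lborel. PsiTn \<Phi> T n (z - y) * PhiT \<Phi> (r * T / 2 ^ (n + 2)) (0 + dil r y))"
    by (rule conv_dil[OF r c(1) cq(1) Suc])
  also have "\<dots> = (LINT y|lborel. PsiTn \<Phi> T n (z - y) * PhiT \<Phi> (T / 2 ^ (n + 2)) y) / r^5"
    using PhiT_scale[OF r q(2), of \<Phi>] by simp
  also have "\<dots> = PsiTn \<Phi> T (Suc n) z / r^5"
    by (simp add: conv_swap(3)[OF c(2) cq(2), simplified])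
  finally show ?case .
qed

lemma PsiT_scale:
  assumes k: "kernel \<Phi>" and r: "r > 0" and T: "T > 0"
  shows "PsiT \<Phi> (r * T) (dil r z) = PsiT \<Phi> T z / r^5"
proof -
  have "(\<lambda>n. PsiTn \<Phi> (r * T) n (dil r z)) \<longlonglongrightarrow> PsiT \<Phi> (r * T) (dil r z)"
    by (rule PsiTn_tendsto[OF k]) (use r T in auto)
  moreover have "(\<lambda>n. PsiTn \<Phi> T n z / r^5) \<longlonglongrightarrow> PsiT \<Phi> T z / r^5"
    by (intro tendsto_divide tendsto_const PsiTn_tendsto[OF k T]) (use r in auto)
  ultimately show ?thesis unfolding PsiTn_scale[OF kernel_bump[OF k] r T] using LIMSEQ_unique by blast
qed

lemma mollify_scale:
  assumes k: "kernel \<Phi>" and r: "r > 0" and T: "T > 0" and f: "continuous_on UNIV f"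
  shows "conv (PsiT \<Phi> T) (\<lambda>y. f (p + dil r y)) z = conv (PsiT \<Phi> (r * T)) f (p + dil r z)"
proof -
  have rT: "r * T > 0" using r T by simp
  note [continuous_intros] = continuous_on_compose2[OF f]
  have "conv (PsiT \<Phi> T) (\<lambda>y. f (p + dil r y)) z = (LINT y|lborel. PsiT \<Phi> T (z - y) * f (p + dil r y))"
    by (rule conv_swap(3)[OF bump_cont_csupp[OF PsiT_bump[OF k T]]]) (auto intro!: continuous_intros)
  also have "\<dots> = conv (PsiT \<Phi> (r * T)) f (p + dil r z)"
    by (rule conv_dil[OF r bump_cont_csupp[OF PsiT_bump[OF k rT]] f PsiT_scale[OF k r T], symmetric])
  finally show ?thesis .
qed

text \<open>For kernels of changing sign, such as differences of translates, where unit mass and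
  positivity are lost. The volume of the box is \<open>R^2 * (2 * R)^3\<close>.\<close>

lemma conv_content_bound:
  assumes c: "cont_csupp \<psi>" and f: "continuous_on UNIV f" and R: "0 \<le> R"
    and s: "\<And>y. y \<notin> supp_box R \<Longrightarrow> \<psi> y = 0" and m: "\<And>y. \<bar>\<psi> y\<bar> \<le> m"
    and B: "\<And>y. y \<in> supp_box R \<Longrightarrow> \<bar>f (z - y)\<bar> \<le> B"
  shows "\<bar>conv \<psi> f z\<bar> \<le> m * B * (8 * R^5)"
proof -
  have cp: "continuous_on UNIV \<psi>" using c by (simp add: cont_csupp_def)
  note [continuous_intros] = continuous_on_compose2[OF f] continuous_on_compose2[OF cp]
  have cont: "measure lborel (supp_box R) = 8 * R^5"
  proof -
    have ne: "cbox (\<chi> i::3. - R) (\<chi> i. R) \<noteq> {}" using R by (auto simp: cbox_def interval_eq_empty_cart box_ne_empty inner_axis Basis_vec_def intro!: exI[of _ 0])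
    show ?thesis unfolding supp_box_def content_Pair using R
      by (simp add: content_cbox_cart[OF ne] power2_eq_square eval_nat_numeral)
  qed
  have "conv \<psi> f z = integral (supp_box R) (\<lambda>y. \<psi> y * f (z - y))"
    unfolding supp_box_def by (rule conv_cbox[OF c f]) (use s in \<open>auto simp: supp_box_def\<close>)
  also have "norm \<dots> \<le> integral (supp_box R) (\<lambda>y. m * B)"
  proof (rule Henstock_Kurzweil_Integration.integral_norm_bound_integral)
    fix y assume "y \<in> supp_box R"
    then have "\<bar>\<psi> y\<bar> * \<bar>f (z - y)\<bar> \<le> m * B" by (intro mult_mono B m) (use m[of y] in auto)
    then show "norm (\<psi> y * f (z - y)) \<le> m * B" by (simp add: abs_mult)
  qed (auto simp: supp_box_def intro!: integrable_continuous continuous_intros)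
  also have "\<dots> = m * B * (8 * R^5)" using cont by (simp add: supp_box_def)
  finally show ?thesis by simp
qed

definition ex_dir :: "3 \<Rightarrow> pt" where "ex_dir i = (0, axis i 1)"
definition et_dir :: pt where "et_dir = (1, 0)"

text \<open>By the semigroup identity the shift falls on the smooth factor of scale
  \<open>T / 2\<close>, so a sup bound at scale \<open>T / 2\<close> becomes a spatial Lipschitz
  bound at scale \<open>T\<close> with loss 1/T. The box of radius \<open>2 * T\<close> contains the
  support of the factor and of its translate.\<close>

lemma mollify_lipschitz:
  assumes k: "kernel \<Phi>"
  obtains \<Lambda> where "\<Lambda> \<ge> 0"
    "\<And>T f z s i B. \<lbrakk>T > 0; continuous_on UNIV f; \<bar>s\<bar> \<le> T;
      \<And>y. y \<in> supp_box (2 * T) \<Longrightarrow> \<bar>conv (PsiT \<Phi> (T / 2)) f (z - y)\<bar> \<le> B\<rbrakk>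
      \<Longrightarrow> \<bar>conv (PsiT \<Phi> T) f (z + s *\<^sub>R ex_dir i) - conv (PsiT \<Phi> T) f z\<bar> \<le> \<Lambda> * \<bar>s\<bar> * B / T"
proof -
  obtain \<Lambda> where L: "\<Lambda> \<ge> 0" "\<And>T z w. T > 0 \<Longrightarrow> \<bar>PhiT \<Phi> T z - PhiT \<Phi> T w\<bar> \<le> \<Lambda> * norm (dil (1 / T) (z - w)) / T ^ 5"
    using PhiT_lipschitz_space[OF k] by blast
  show thesis
  proof (rule that[of "2^14 * \<Lambda>"])
    fix T s B :: real and f z i
    assume T: "T > 0" and f: "continuous_on UNIV f" and s: "\<bar>s\<bar> \<le> T"
      and B: "\<And>y. y \<in> supp_box (2 * T) \<Longrightarrow> \<bar>conv (PsiT \<Phi> (T / 2)) f (z - y)\<bar> \<le> B"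
    have T2: "T / 2 > 0" using T by simp
    define \<phi> where "\<phi> = PhiT \<Phi> (T / 2)"
    define g where "g = conv (PsiT \<Phi> (T / 2)) f"
    define h where "h = s *\<^sub>R ex_dir i"
    have b: "bump (T / 2) \<phi>" unfolding \<phi>_def by (rule PhiT_bump[OF kernel_bump[OF k] T2])
    have c\<phi>: "continuous_on UNIV \<phi>" using b by (simp add: bump_def)
    have g: "continuous_on UNIV g" unfolding g_def by (rule continuous_conv[OF bump_cont_csupp[OF PsiT_bump[OF k T2]] f])
    have c1: "continuous_on UNIV (\<lambda>y. \<phi> (y + h))" by (intro continuous_on_compose2[OF c\<phi>] continuous_intros) auto
    have in1: "y \<in> supp_box (2 * T)" if "\<phi> (y + h) \<noteq> 0 \<or> \<phi> y \<noteq> 0" for y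
    proof -
      have "y \<in> supp_box (T/2) \<or> y + h \<in> supp_box (T/2)" using that b by (auto simp: bump_def)
      moreover have "infnorm (snd y) \<le> infnorm (snd (y + h)) + \<bar>s\<bar>"
      proof -
        have "infnorm (snd y) = infnorm (snd (y + h) + (- snd h))" by simp
        also have "\<dots> \<le> infnorm (snd (y + h)) + infnorm (- snd h)" by (rule infnorm_triangle)
        also have "infnorm (- snd h) \<le> \<bar>s\<bar>" using infnorm_le_norm[of "axis i (1::real) :: real^3"] mult_left_mono[of "infnorm (axis i (1::real) :: real^3)" 1 "\<bar>s\<bar>"]
          by (simp add: infnorm_neg h_def ex_dir_def infnorm_mul)
        finally show ?thesis by simp
      qed
      moreover have "T\<^sup>2 / 4 \<le> 4 * T\<^sup>2" by simp
      moreover have "fst (y + h) = fst y" by (simp add: h_def ex_dir_def)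
      ultimately show ?thesis using s T by (auto simp: mem_supp_box power2_eq_square)
    qed
    have cc: "cont_csupp (\<lambda>y. \<phi> (y + h) - \<phi> y)"
      unfolding cont_csupp_def
    proof (intro conjI exI[of _ "supp_box (2 * T)"])
      show "continuous_on UNIV (\<lambda>y. \<phi> (y + h) - \<phi> y)" by (intro continuous_on_diff c1 c\<phi>)
      show "compact (supp_box (2 * T))" by (simp add: supp_box_def)
      show "\<forall>z. z \<notin> supp_box (2 * T) \<longrightarrow> \<phi> (z + h) - \<phi> z = 0" using in1 by (metis diff_self)
    qed
    have cc1: "cont_csupp (\<lambda>y. \<phi> (y + h))"
      unfolding cont_csupp_def by (rule conjI[OF c1 exI[of _ "supp_box (2 * T)"]]) (use in1 in \<open>auto simp: supp_box_def\<close>)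
    have eq: "conv \<phi> g (z + h) - conv \<phi> g z = conv (\<lambda>y. \<phi> (y + h) - \<phi> y) g z"
    proof -
      have "conv \<phi> g (z + h) = conv (\<lambda>y. \<phi> (y + h)) g z"
        by (simp add: conv_swap(3)[OF bump_cont_csupp[OF b] g] conv_swap(3)[OF cc1 g] algebra_simps)
      then show ?thesis
        using conv_swap(3,4)[OF cc1 g, of z] conv_swap(3,4)[OF bump_cont_csupp[OF b] g, of z] conv_swap(3)[OF cc g, of z]
        by (simp add: left_diff_distrib)
    qed
    have nh: "norm (dil (1 / (T/2)) h) = 2 * \<bar>s\<bar> / T"
      using T by (simp add: dil_def h_def ex_dir_def norm_Pair)
    \<comment> \<open>Origin of 2^14: a factor 2 from dilating the shift, 2^5 from the normalisation
      \<open>(T/2)^5\<close>, and \<open>8 * 2^5\<close> from the content of the box.\<close>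
    have "\<bar>conv (\<lambda>y. \<phi> (y + h) - \<phi> y) g z\<bar> \<le> (\<Lambda> * (2 * \<bar>s\<bar> / T) / (T/2)^5) * B * (8 * (2 * T)^5)"
    proof (rule conv_content_bound[OF cc g])
      show "\<bar>\<phi> (y + h) - \<phi> y\<bar> \<le> \<Lambda> * (2 * \<bar>s\<bar> / T) / (T/2)^5" for y
        using L(2)[OF T2, of "y + h" y] nh by (simp add: \<phi>_def)
      show "\<phi> (y + h) - \<phi> y = 0" if "y \<notin> supp_box (2 * T)" for y using in1[of y] that by (metis diff_self)
    qed (use T B in \<open>simp_all add: g_def\<close>)
    also have "\<dots> = 2^14 * \<Lambda> * \<bar>s\<bar> * B / T" using T by (simp add: field_simps eval_nat_numeral)
    finally show "\<bar>conv (PsiT \<Phi> T) f (z + s *\<^sub>R ex_dir i) - conv (PsiT \<Phi> T) f z\<bar> \<le> 2^14 * \<Lambda> * \<bar>s\<bar> * B / T"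
      unfolding mollify_semigroup[OF k T f] using eq by (simp add: h_def g_def \<phi>_def)
  qed (use L in auto)
qed

section \<open>Interior estimates for the heat operator\<close>

definition has_pdv :: "pt \<Rightarrow> (pt \<Rightarrow> real) \<Rightarrow> (pt \<Rightarrow> real) \<Rightarrow> bool" where
  "has_pdv e f g \<longleftrightarrow> (\<forall>z. ((\<lambda>s. f (z + s *\<^sub>R e)) has_real_derivative g z) (at 0))"

definition pdv :: "pt \<Rightarrow> (pt \<Rightarrow> real) \<Rightarrow> pt \<Rightarrow> real" where
  "pdv e f z = deriv (\<lambda>s. f (z + s *\<^sub>R e)) 0"

text \<open>Continuous derivatives along coordinate directions are enough for the maximum principle,
  and the class is closed under the operations used below: affine combinations, parabolic rescaling
  and convolution with a continuous kernel.\<close>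

definition C12 :: "(pt \<Rightarrow> real) \<Rightarrow> bool" where
  "C12 f \<longleftrightarrow> continuous_on UNIV f \<and> has_pdv et_dir f (pdv et_dir f) \<and> continuous_on UNIV (pdv et_dir f)
    \<and> (\<forall>i. has_pdv (ex_dir i) f (pdv (ex_dir i) f) \<and> continuous_on UNIV (pdv (ex_dir i) f))
    \<and> (\<forall>i j. has_pdv (ex_dir j) (pdv (ex_dir i) f) (pdv (ex_dir j) (pdv (ex_dir i) f)) \<and> continuous_on UNIV (pdv (ex_dir j) (pdv (ex_dir i) f)))"

definition heat_op :: "(pt \<Rightarrow> real) \<Rightarrow> pt \<Rightarrow> real" where
  "heat_op f z = pdv et_dir f z - (\<Sum>i\<in>UNIV. pdv (ex_dir i) (pdv (ex_dir i) f) z)"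

lemma has_pdv_D: "has_pdv e f g \<Longrightarrow> pdv e f = g"
  unfolding has_pdv_def pdv_def by (intro ext DERIV_imp_deriv) auto

lemma has_pdv_at:
  assumes "has_pdv e f g" shows "((\<lambda>s. f (z + s *\<^sub>R e)) has_real_derivative g (z + s0 *\<^sub>R e)) (at s0)"
proof -
  have "((\<lambda>s. f ((z + s0 *\<^sub>R e) + s *\<^sub>R e)) has_real_derivative g (z + s0 *\<^sub>R e)) (at 0)"
    using assms by (simp add: has_pdv_def)
  moreover have "(\<lambda>s. f ((z + s0 *\<^sub>R e) + s *\<^sub>R e)) = (\<lambda>s. f (z + (s + s0) *\<^sub>R e))"
    by (simp add: algebra_simps)
  ultimately show ?thesis using DERIV_shift[of "\<lambda>s. f (z + s *\<^sub>R e)" "g (z + s0 *\<^sub>R e)" 0 s0] by simp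
qed

lemma C12I:
  assumes "continuous_on UNIV f" "has_pdv et_dir f ft" "continuous_on UNIV ft"
    "\<And>i. has_pdv (ex_dir i) f (f1 i)" "\<And>i. continuous_on UNIV (f1 i)"
    "\<And>i j. has_pdv (ex_dir j) (f1 i) (f2 i j)" "\<And>i j. continuous_on UNIV (f2 i j)"
  shows "C12 f" "pdv et_dir f = ft" "pdv (ex_dir i) f = f1 i" "pdv (ex_dir j) (pdv (ex_dir i) f) = f2 i j"
proof -
  show 1: "pdv et_dir f = ft" by (rule has_pdv_D) fact
  have 2: "pdv (ex_dir i) f = f1 i" for i by (rule has_pdv_D) fact
  have 3: "pdv (ex_dir j) (f1 i) = f2 i j" for i j by (rule has_pdv_D) fact
  show "C12 f" unfolding C12_def 1 2 3 using assms by blast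
  show "pdv (ex_dir i) f = f1 i" "pdv (ex_dir j) (pdv (ex_dir i) f) = f2 i j" by (simp_all add: 2 3)
qed

lemma C12D:
  assumes "C12 f"
  shows "continuous_on UNIV f" "has_pdv et_dir f (pdv et_dir f)" "continuous_on UNIV (pdv et_dir f)"
    "has_pdv (ex_dir i) f (pdv (ex_dir i) f)" "continuous_on UNIV (pdv (ex_dir i) f)"
    "has_pdv (ex_dir j) (pdv (ex_dir i) f) (pdv (ex_dir j) (pdv (ex_dir i) f))" "continuous_on UNIV (pdv (ex_dir j) (pdv (ex_dir i) f))"
  using assms unfolding C12_def by blast+

lemma C12_heat_op_cont: "C12 f \<Longrightarrow> continuous_on UNIV (heat_op f)"
  unfolding heat_op_def[abs_def] by (intro continuous_intros C12D)

lemma has_pdv_lin: "has_pdv e f f' \<Longrightarrow> has_pdv e g g' \<Longrightarrow> has_pdv e (\<lambda>z. a * f z + b * g z + c) (\<lambda>z. a * f' z + b * g' z)"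
  unfolding has_pdv_def by (auto intro!: derivative_eq_intros)

lemma C12_lin:
  assumes f: "C12 f" and g: "C12 g"
  shows "C12 (\<lambda>z. a * f z + b * g z + c)"
    "pdv et_dir (\<lambda>z. a * f z + b * g z + c) z = a * pdv et_dir f z + b * pdv et_dir g z"
    "pdv (ex_dir i) (\<lambda>z. a * f z + b * g z + c) z = a * pdv (ex_dir i) f z + b * pdv (ex_dir i) g z"
    "pdv (ex_dir j) (pdv (ex_dir i) (\<lambda>z. a * f z + b * g z + c)) z = a * pdv (ex_dir j) (pdv (ex_dir i) f) z + b * pdv (ex_dir j) (pdv (ex_dir i) g) z"
    "heat_op (\<lambda>z. a * f z + b * g z + c) z = a * heat_op f z + b * heat_op g z"
proof -
  have c: "continuous_on UNIV (\<lambda>z. a * f z + b * g z + c)"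
    if "continuous_on UNIV f" "continuous_on UNIV g" for f g :: "pt \<Rightarrow> real" and a b c using that by (intro continuous_intros)
  have p0: "has_pdv e (\<lambda>z. a * f z + b * g z) (\<lambda>z. a * f' z + b * g' z)" if "has_pdv e f f'" "has_pdv e g g'" for e f f' g g'
    using has_pdv_lin[OF that, of a b 0] by simp
  have c0: "continuous_on UNIV (\<lambda>z. a * f z + b * g z)"
    if "continuous_on UNIV f" "continuous_on UNIV g" for f g :: "pt \<Rightarrow> real" using that by (intro continuous_intros)
  note C = C12I[OF c[OF C12D(1)[OF f] C12D(1)[OF g]] has_pdv_lin[OF C12D(2)[OF f] C12D(2)[OF g]] c0[OF C12D(3)[OF f] C12D(3)[OF g]]
      has_pdv_lin[OF C12D(4)[OF f] C12D(4)[OF g]] c0[OF C12D(5)[OF f] C12D(5)[OF g]] p0[OF C12D(6)[OF f] C12D(6)[OF g]]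
      c0[OF C12D(7)[OF f] C12D(7)[OF g]]]
  show "C12 (\<lambda>z. a * f z + b * g z + c)" by (rule C(1))
  show 2: "pdv et_dir (\<lambda>z. a * f z + b * g z + c) z = a * pdv et_dir f z + b * pdv et_dir g z" by (simp only: C(2))
  show "pdv (ex_dir i) (\<lambda>z. a * f z + b * g z + c) z = a * pdv (ex_dir i) f z + b * pdv (ex_dir i) g z" by (simp only: C(3))
  show "pdv (ex_dir j) (pdv (ex_dir i) (\<lambda>z. a * f z + b * g z + c)) z = a * pdv (ex_dir j) (pdv (ex_dir i) f) z + b * pdv (ex_dir j) (pdv (ex_dir i) g) z"
    by (simp only: C(4))
  show "heat_op (\<lambda>z. a * f z + b * g z + c) z = a * heat_op f z + b * heat_op g z"
    unfolding heat_op_def 2 by (simp only: C(4)) (simp add: sum.distrib sum_distrib_left algebra_simps)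
qed

lemma dil_add: "dil r (x + y) = dil r x + dil r y"
  by (simp add: dil_def prod_eq_iff algebra_simps)

lemma dil_et: "dil r (s *\<^sub>R et_dir) = (r\<^sup>2 * s) *\<^sub>R et_dir" by (simp add: dil_def et_dir_def)
lemma dil_ex: "dil r (s *\<^sub>R ex_dir i) = (r * s) *\<^sub>R ex_dir i" by (simp add: dil_def ex_dir_def)

lemma has_pdv_scale:
  assumes p: "has_pdv e f f'" and d: "\<And>s. dil r (s *\<^sub>R e) = (q * s) *\<^sub>R e"
  shows "has_pdv e (\<lambda>z. c * f (p + dil r z)) (\<lambda>z. (c * q) * f' (p + dil r z))"
  unfolding has_pdv_def
proof
  fix z
  have "((\<lambda>s. f ((p + dil r z) + (q * s) *\<^sub>R e)) has_real_derivative f' (p + dil r z) * q) (at 0)"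
    by (rule DERIV_chain2[where g="\<lambda>s. q * s" and f="\<lambda>s. f ((p + dil r z) + s *\<^sub>R e)"])
      (use p in \<open>auto simp: has_pdv_def intro!: derivative_eq_intros\<close>)
  from DERIV_cmult[OF this, of c]
  show "((\<lambda>s. c * f (p + dil r (z + s *\<^sub>R e))) has_real_derivative (c * q) * f' (p + dil r z)) (at 0)"
    by (simp add: dil_add d add.assoc mult_ac)
qed

lemma C12_scale:
  assumes f: "C12 f"
  shows "C12 (\<lambda>z. c * f (p + dil r z))"
    "pdv et_dir (\<lambda>z. c * f (p + dil r z)) z = c * r\<^sup>2 * pdv et_dir f (p + dil r z)"
    "pdv (ex_dir i) (\<lambda>z. c * f (p + dil r z)) z = c * r * pdv (ex_dir i) f (p + dil r z)"
    "heat_op (\<lambda>z. c * f (p + dil r z)) z = c * r\<^sup>2 * heat_op f (p + dil r z)"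
proof -
  have cc: "continuous_on UNIV (\<lambda>z. c * g (p + dil r z))" if "continuous_on UNIV g" for g :: "pt \<Rightarrow> real" and c
    by (intro continuous_intros continuous_on_compose2[OF that]) auto
  note C = C12I[OF cc[OF C12D(1)[OF f]] has_pdv_scale[OF C12D(2)[OF f] dil_et] cc[OF C12D(3)[OF f]]
      has_pdv_scale[OF C12D(4)[OF f] dil_ex] cc[OF C12D(5)[OF f]] has_pdv_scale[OF C12D(6)[OF f] dil_ex] cc[OF C12D(7)[OF f]]]
  show "C12 (\<lambda>z. c * f (p + dil r z))" by (rule C(1))
  show 2: "pdv et_dir (\<lambda>z. c * f (p + dil r z)) z = c * r\<^sup>2 * pdv et_dir f (p + dil r z)" by (simp only: C(2))
  show "pdv (ex_dir i) (\<lambda>z. c * f (p + dil r z)) z = c * r * pdv (ex_dir i) f (p + dil r z)" by (simp only: C(3))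
  show "heat_op (\<lambda>z. c * f (p + dil r z)) z = c * r\<^sup>2 * heat_op f (p + dil r z)"
    unfolding heat_op_def 2 by (simp only: C(4)) (simp add: algebra_simps power2_eq_square sum_distrib_left)
qed

text \<open>The derivative is put on \<open>f\<close>, so a continuous kernel suffices and no
  differentiability of the limit kernel \<open>PsiT\<close> has to be established.\<close>

lemma has_pdv_conv:
  assumes \<psi>: "cont_csupp \<psi>" and p: "has_pdv e f g" and f: "continuous_on UNIV f" and g: "continuous_on UNIV g"
  shows "has_pdv e (conv \<psi> f) (conv \<psi> g)"
  unfolding has_pdv_def
proof
  fix z
  from cont_csupp_cbox[OF \<psi>] obtain a b where ab: "\<And>y. y \<notin> cbox a b \<Longrightarrow> \<psi> y = 0" by blast
  have c: "continuous_on UNIV \<psi>" using \<psi> by (simp add: cont_csupp_def)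
  note [continuous_intros] = continuous_on_compose2[OF c] continuous_on_compose2[OF f] continuous_on_compose2[OF g]
  have "((\<lambda>s. integral (cbox a b) (\<lambda>y. \<psi> y * f (z + s *\<^sub>R e - y))) has_field_derivative
      integral (cbox a b) (\<lambda>y. \<psi> y * g (z + 0 *\<^sub>R e - y))) (at 0 within UNIV)"
  proof (rule leibniz_rule_field_derivative[where fx="\<lambda>s y. \<psi> y * g (z + s *\<^sub>R e - y)"])
    fix s :: real and y
    have "((\<lambda>s. f ((z - y) + s *\<^sub>R e)) has_real_derivative g ((z - y) + s *\<^sub>R e)) (at s)" by (rule has_pdv_at[OF p])
    from DERIV_cmult[OF this, of "\<psi> y"]
    show "((\<lambda>s. \<psi> y * f (z + s *\<^sub>R e - y)) has_real_derivative \<psi> y * g (z + s *\<^sub>R e - y)) (at s within UNIV)"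
      by (simp add: algebra_simps)
  qed (auto intro!: integrable_continuous continuous_intros simp: split_beta)
  then show "((\<lambda>s. conv \<psi> f (z + s *\<^sub>R e)) has_real_derivative conv \<psi> g z) (at 0)"
    by (simp add: conv_cbox[OF \<psi> f ab] conv_cbox[OF \<psi> g ab])
qed

lemma C12_conv:
  assumes \<psi>: "cont_csupp \<psi>" and f: "C12 f"
  shows "C12 (conv \<psi> f)" "heat_op (conv \<psi> f) z = conv \<psi> (heat_op f) z"
proof -
  note C = C12I[OF continuous_conv[OF \<psi> C12D(1)[OF f]] has_pdv_conv[OF \<psi> C12D(2)[OF f] C12D(1,3)[OF f]] continuous_conv[OF \<psi> C12D(3)[OF f]]
      has_pdv_conv[OF \<psi> C12D(4)[OF f] C12D(1,5)[OF f]] continuous_conv[OF \<psi> C12D(5)[OF f]]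
      has_pdv_conv[OF \<psi> C12D(6)[OF f] C12D(5,7)[OF f]] continuous_conv[OF \<psi> C12D(7)[OF f]]]
  show "C12 (conv \<psi> f)" by (rule C(1))
  have cs: "continuous_on UNIV (\<lambda>y. \<Sum>i\<in>UNIV. pdv (ex_dir i) (pdv (ex_dir i) f) y)" by (intro continuous_intros C12D f)
  have "conv \<psi> (\<lambda>y. \<Sum>i\<in>UNIV. pdv (ex_dir i) (pdv (ex_dir i) f) y) z = (\<Sum>i\<in>UNIV. conv \<psi> (pdv (ex_dir i) (pdv (ex_dir i) f)) z)"
    unfolding conv_swap(2)[OF \<psi> cs] conv_swap(2)[OF \<psi> C12D(7)[OF f]] sum_distrib_left
    by (rule Bochner_Integration.integral_sum) (rule conv_swap(1)[OF \<psi> C12D(7)[OF f]])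
  then show "heat_op (conv \<psi> f) z = conv \<psi> (heat_op f) z"
    unfolding heat_op_def[abs_def] using conv_diff[OF \<psi> C12D(3)[OF f] cs, of z] by (simp only: C(2,4))
qed

lemma smooth_pd:
  assumes "smooth f" shows "has_pdv e f (\<lambda>z. frechet_derivative f (at z) e)"
  unfolding has_pdv_def
proof
  fix z
  have "(f has_derivative frechet_derivative f (at z)) (at (z + 0 *\<^sub>R e))"
    using smooth_imp(1)[OF assms] by (simp add: frechet_derivative_works)
  then have "((\<lambda>s. f (z + s *\<^sub>R e)) has_derivative (\<lambda>s. frechet_derivative f (at z) (s *\<^sub>R e))) (at 0)"
    by (rule has_derivative_compose[rotated]) (auto intro!: derivative_eq_intros)
  moreover have "linear (frechet_derivative f (at z))"
    using smooth_imp(1)[OF assms] by (simp add: linear_frechet_derivative)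
  ultimately show "((\<lambda>s. f (z + s *\<^sub>R e)) has_real_derivative frechet_derivative f (at z) e) (at 0)"
    by (simp add: has_field_derivative_def linear_cmul mult_commute_abs)
qed

lemma et_Basis: "et_dir \<in> Basis" and ex_Basis: "ex_dir i \<in> Basis"
  by (auto simp: et_dir_def ex_dir_def Basis_prod_def axis_in_Basis_iff)

lemma smooth_C12:
  assumes f: "smooth f"
  shows "C12 f" "heat_op f z = heat f z"
proof -
  have s: "smooth (\<lambda>z. frechet_derivative f (at z) e)" if "e \<in> Basis" "smooth f" for e f
    by (rule smooth_imp(2)[OF that(2,1)])
  note s1 = s[OF ex_Basis f]
  note C = C12I[OF smooth_continuous[OF f] smooth_pd[OF f] smooth_continuous[OF s[OF et_Basis f]]
     smooth_pd[OF f] smooth_continuous[OF s1] smooth_pd[OF s1] smooth_continuous[OF s[OF ex_Basis s1]]]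
  show "C12 f" by (rule C(1))
  show "heat_op f z = heat f z" unfolding heat_op_def heat_def lap_def dt_def dx_def by (simp only: C(2,4)) (simp add: et_dir_def ex_dir_def)
qed

text \<open>A maximum over a past cylinder may sit at its final time, where only earlier times can
  be compared. This one-sided test still determines the sign of the time derivative.\<close>

lemma deriv_nonneg_left_max:
  fixes g :: "real \<Rightarrow> real"
  assumes "(g has_real_derivative d) (at 0)" "\<eta> > 0" "\<And>s. -\<eta> \<le> s \<Longrightarrow> s \<le> 0 \<Longrightarrow> g s \<le> g 0"
  shows "d \<ge> 0"
proof (rule ccontr)
  assume "\<not> d \<ge> 0"
  then obtain \<delta> where \<delta>: "\<delta> > 0" "\<And>h. h > 0 \<Longrightarrow> h < \<delta> \<Longrightarrow> g 0 < g (0 - h)"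
    using DERIV_neg_dec_left[OF assms(1)] by (metis linorder_not_le)
  have "g 0 < g (0 - min (\<delta>/2) \<eta>)" using \<delta> assms(2) by (intro \<delta>(2)) auto
  moreover have "g (0 - min (\<delta>/2) \<eta>) \<le> g 0" using \<delta> assms(2) by (intro assms(3)) auto
  ultimately show False by simp
qed

lemma deriv2_nonpos_max:
  fixes g :: "real \<Rightarrow> real"
  assumes g: "\<And>s. (g has_real_derivative g' s) (at s)" and g2: "(g' has_real_derivative d) (at 0)"
    and "\<eta> > 0" and m: "\<And>s. \<bar>s\<bar> < \<eta> \<Longrightarrow> g s \<le> g 0"
  shows "d \<le> 0"
proof (rule ccontr)
  assume "\<not> d \<le> 0"
  have "g' 0 = 0" by (rule DERIV_local_max[OF g \<open>\<eta> > 0\<close>]) (use m in auto)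
  with \<open>\<not> d \<le> 0\<close> obtain \<delta> where \<delta>: "\<delta> > 0" "\<And>h. h > 0 \<Longrightarrow> h < \<delta> \<Longrightarrow> 0 < g' (0 + h)"
    using DERIV_pos_inc_right[OF g2] by (metis linorder_not_le)
  define h where "h = min (\<delta>/2) (\<eta>/2)"
  have h: "h > 0" "h < \<delta>" "h < \<eta>" using \<delta> assms(3) by (auto simp: h_def min_def)
  obtain \<xi> where "0 < \<xi>" "\<xi> < h" "g h - g 0 = (h - 0) * g' \<xi>"
    using MVT2[of 0 h g g'] h g by blast
  moreover from this have "h * g' \<xi> > 0" using \<delta>(2)[of \<xi>] h by (intro mult_pos_pos) auto
  ultimately have "g h > g 0" by simp
  with m[of h] h show False by simp
qed

text \<open>The set \<open>z - supp_box r\<close>, that is, what a kernel of radius \<open>r\<close>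
  sees at \<open>z\<close>. It is closed and contains its top, so continuous functions attain their
  maxima on it.\<close>

definition past_cyl :: "pt \<Rightarrow> real \<Rightarrow> pt set" where
  "past_cyl z r = {y. fst z - r\<^sup>2 \<le> fst y \<and> fst y \<le> fst z \<and> infnorm (snd y - snd z) \<le> r}"

lemma past_cyl_mono: "0 \<le> r \<Longrightarrow> r \<le> s \<Longrightarrow> past_cyl z r \<subseteq> past_cyl z s"
  using power_mono[of r s 2] unfolding past_cyl_def by (smt (verit) Collect_mono)

lemma past_cyl_center: "0 \<le> r \<Longrightarrow> z \<in> past_cyl z r"
  by (simp add: past_cyl_def infnorm_0)

lemma past_cyl_trans:
  assumes "x \<in> past_cyl y r" "y \<in> past_cyl z s" "0 \<le> r" "0 \<le> s" shows "x \<in> past_cyl z (r + s)"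
proof -
  have "infnorm (snd x - snd z) \<le> infnorm (snd x - snd y) + infnorm (snd y - snd z)"
    using infnorm_triangle[of "snd x - snd y" "snd y - snd z"] by simp
  moreover have "r\<^sup>2 + s\<^sup>2 \<le> (r + s)\<^sup>2" using assms by (simp add: power2_sum)
  ultimately show ?thesis using assms unfolding past_cyl_def by (auto simp del: power2_sum) 
qed

lemma past_cyl_compact: "compact (past_cyl z r)"
proof -
  have "past_cyl z r = cbox (fst z - r\<^sup>2, snd z - (\<chi> i. r)) (fst z, snd z + (\<chi> i. r))"
    by (auto simp: past_cyl_def cbox_Pair_eq mem_box_cart infnorm_le_iff abs_le_iff algebra_simps)
  then show ?thesis by simp
qed

lemma infnorm_axis_le: "infnorm (s *\<^sub>R (axis i 1 :: real^3)) \<le> \<bar>s\<bar>"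
  using infnorm_le_norm[of "axis i (1::real) :: real^3"] mult_left_mono[of "infnorm (axis i (1::real) :: real^3)" 1 "\<bar>s\<bar>"]
  by (simp add: infnorm_mul)

lemma past_cyl_ex:
  assumes "y \<in> past_cyl z r" shows "y + s *\<^sub>R ex_dir i \<in> past_cyl z (r + \<bar>s\<bar>)"
proof -
  have "infnorm (snd (y + s *\<^sub>R ex_dir i) - snd z) \<le> infnorm (snd y - snd z) + infnorm (s *\<^sub>R (axis i 1 :: real^3))"
    using infnorm_triangle[of "snd y - snd z" "s *\<^sub>R axis i 1"] by (simp add: ex_dir_def algebra_simps)
  moreover have "0 \<le> r" using assms infnorm_pos_le[of "snd y - snd z"] by (auto simp: past_cyl_def)
  moreover then have r2: "r\<^sup>2 \<le> (r + \<bar>s\<bar>)\<^sup>2" by (intro power_mono) auto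
  moreover have "fst z - r\<^sup>2 \<le> fst y" using assms by (simp add: past_cyl_def)
  then have "fst z - (r + \<bar>s\<bar>)\<^sup>2 \<le> fst y" using r2 by linarith
  ultimately show ?thesis using assms infnorm_axis_le[of s i] by (auto simp: past_cyl_def ex_dir_def)
qed

text \<open>Brandt's doubling of variables: as a function of the time, of the spatial variables other
than the $i$-th one and of $s$, the odd difference $(h(x + s e_i) - h(x - s e_i))/2$ satisfies a heat equation again, vanishes
at $s = 0$, and is compared with a barrier that is linear in $s$ near $0$.\<close>

lemma gradient_bound_upper:
  assumes h: "C12 h" and L: "L > 0" and A: "A > 0"
    and hA: "\<And>y. y \<in> past_cyl z0 L \<Longrightarrow> \<bar>h y\<bar> \<le> A" and hB: "\<And>y. y \<in> past_cyl z0 L \<Longrightarrow> \<bar>heat_op h y\<bar> \<le> B"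
  shows "pdv (ex_dir i) h z0 \<le> 11 * A / L + B * L"
proof -
  \<comment> \<open>The multiple \<open>\<alpha>\<close> of the paraboloid reaches \<open>A\<close>
    on the bottom and on the sides of the half cylinder. The choice of \<open>\<kappa>\<close> lifts
    \<open>s * (L - s)\<close> to at least \<open>A\<close> at \<open>s = L/2\<close> and makes
    \<open>2 * \<kappa> - 5 * \<alpha>\<close> exceed \<open>B\<close>; the 5 consists of 1 from the
    time derivative and 2 from each of the two transversal directions.\<close>
  define \<alpha> where "\<alpha> = 4 * A / L\<^sup>2"
  define \<kappa> where "\<kappa> = B + 11 * A / L\<^sup>2"
  have B: "0 \<le> B" using hB[OF past_cyl_center] L by (smt (verit))
  have \<alpha>: "\<alpha> > 0" "\<alpha> * L\<^sup>2 / 4 = A" using A L by (auto simp: \<alpha>_def)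
  have \<kappa>: "2 * \<kappa> - 5 * \<alpha> > B" "\<kappa> * L\<^sup>2 / 4 \<ge> A" "\<kappa> > 0"
  proof -
    have "A / L\<^sup>2 > 0" using A L by simp
    then show "2 * \<kappa> - 5 * \<alpha> > B" "\<kappa> > 0" using B by (auto simp: \<alpha>_def \<kappa>_def)
    have "\<alpha> * L\<^sup>2 \<le> \<kappa> * L\<^sup>2" using B \<open>A / L\<^sup>2 > 0\<close> by (intro mult_right_mono) (auto simp: \<alpha>_def \<kappa>_def)
    with \<alpha>(2) show "\<kappa> * L\<^sup>2 / 4 \<ge> A" by linarith
  qed
  define sq where "sq = (\<lambda>z::pt. (snd z - snd z0) \<bullet> (snd z - snd z0))"
  define m where "m = (\<lambda>z s. (h (z + s *\<^sub>R ex_dir i) - h (z - s *\<^sub>R ex_dir i)) / 2 - \<alpha> * (sq z + (fst z0 - fst z)) - \<kappa> * (s * (L - s)))"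
  define K where "K = past_cyl z0 (L/2) \<times> {0..L/2}"
  have in_L: "z + s *\<^sub>R ex_dir i \<in> past_cyl z0 L" "z - s *\<^sub>R ex_dir i \<in> past_cyl z0 L" if "z \<in> past_cyl z0 (L/2)" "0 \<le> s" "s \<le> L/2" for z s
  proof -
    have "past_cyl z0 (L/2 + s) \<subseteq> past_cyl z0 L" using that L by (intro past_cyl_mono) auto
    then show "z + s *\<^sub>R ex_dir i \<in> past_cyl z0 L" "z - s *\<^sub>R ex_dir i \<in> past_cyl z0 L"
      using past_cyl_ex[OF that(1), of s i] past_cyl_ex[OF that(1), of "-s" i] that by auto
  qed
  define F where "F = (\<lambda>(z, s). m z s)"
  have 1: "compact K" unfolding K_def by (intro compact_Times past_cyl_compact) auto
  have 2: "K \<noteq> {}" using past_cyl_center[of "L/2" z0] L by (auto simp: K_def)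
  have 3: "continuous_on K F"
  proof -
    note [continuous_intros] = continuous_on_compose2[OF C12D(1)[OF h]]
    show ?thesis unfolding F_def m_def sq_def split_beta by (intro continuous_intros) auto
  qed
  from continuous_attains_sup[OF 1 2 3] obtain zs where zs: "zs \<in> K" "\<And>y. y \<in> K \<Longrightarrow> F y \<le> F zs"
    by metis
  obtain z s where zs_eq: "zs = (z, s)" by (cases zs)
  have K: "z \<in> past_cyl z0 (L/2)" "0 \<le> s" "s \<le> L/2" and mx: "\<And>y q. y \<in> past_cyl z0 (L/2) \<Longrightarrow> 0 \<le> q \<Longrightarrow> q \<le> L/2 \<Longrightarrow> m y q \<le> m z s"
    using zs by (auto simp: K_def zs_eq F_def)
  \<comment> \<open>A positive maximum cannot lie at \<open>s = 0\<close>, where the odd difference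
    vanishes, nor on the bottom, the sides or \<open>s = L/2\<close>, where the barrier dominates.
    At any other point the first and second order conditions contradict the size of
    \<open>\<kappa>\<close>.\<close>
  have "m z s \<le> 0"
  proof (rule ccontr)
    assume pos: "\<not> m z s \<le> 0"
    have sq0: "sq z \<ge> 0" "fst z0 - fst z \<ge> 0" using K by (auto simp: sq_def past_cyl_def)
    then have p0: "\<alpha> * (sq z + (fst z0 - fst z)) \<ge> 0" using \<alpha> by auto
    have p1: "\<kappa> * (s * (L - s)) \<ge> 0" using \<kappa> K L by auto
    have \<phi>: "(h (z + s *\<^sub>R ex_dir i) - h (z - s *\<^sub>R ex_dir i)) / 2 \<le> A"
      using hA[OF in_L(1)[OF K]] hA[OF in_L(2)[OF K]] unfolding abs_le_iff by (simp add: field_simps)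
    have s0: "s > 0" using pos K p0 by (cases "s = 0") (auto simp: m_def)
    have sL: "s < L/2"
    proof (rule ccontr)
      assume "\<not> s < L/2" then have "s = L/2" using K by simp
      then have "s * (L - s) = L\<^sup>2 / 4" by (simp only:) (simp add: power2_eq_square field_simps)
      then have "\<kappa> * (s * (L - s)) \<ge> A" using \<kappa>(2) by (simp only: times_divide_eq_right)
      then show False using \<phi> p0 pos unfolding m_def by linarith
    qed
    have tL: "fst z > fst z0 - (L/2)\<^sup>2"
    proof (rule ccontr)
      assume "\<not> fst z > fst z0 - (L/2)\<^sup>2"
      then have "sq z + (fst z0 - fst z) \<ge> L\<^sup>2 / 4" using sq0 by (simp add: power_divide)
      then have "\<alpha> * (sq z + (fst z0 - fst z)) \<ge> \<alpha> * (L\<^sup>2/4)" using \<alpha> by (intro mult_left_mono) auto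
      then show False using \<phi> p1 pos \<alpha>(2) unfolding m_def by linarith
    qed
    have xL: "infnorm (snd z - snd z0) < L/2"
    proof (rule ccontr)
      assume "\<not> infnorm (snd z - snd z0) < L/2"
      then have "norm (snd z - snd z0) \<ge> L/2" using infnorm_le_norm[of "snd z - snd z0"] by linarith
      then have "(norm (snd z - snd z0))\<^sup>2 \<ge> (L/2)\<^sup>2" using L by (intro power_mono) auto
      then have "sq z + (fst z0 - fst z) \<ge> L\<^sup>2 / 4" using sq0 by (simp add: power_divide sq_def power2_norm_eq_inner)
      then have "\<alpha> * (sq z + (fst z0 - fst z)) \<ge> \<alpha> * (L\<^sup>2/4)" using \<alpha> by (intro mult_left_mono) auto
      then show False using \<phi> p1 pos \<alpha>(2) unfolding m_def by linarith
    qed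
    let ?p = "z + s *\<^sub>R ex_dir i" and ?n = "z - s *\<^sub>R ex_dir i"
    have T: "(pdv et_dir h ?p - pdv et_dir h ?n) / 2 + \<alpha> \<ge> 0"
    proof (rule deriv_nonneg_left_max)
      have "((\<lambda>\<sigma>. (h (?p + \<sigma> *\<^sub>R et_dir) - h (?n + \<sigma> *\<^sub>R et_dir)) / 2 - \<alpha> * (sq z + (fst z0 - (fst z + \<sigma>))) - \<kappa> * (s * (L - s)))
        has_real_derivative (pdv et_dir h ?p - pdv et_dir h ?n) / 2 + \<alpha>) (at 0)"
        using C12D(2)[OF h] unfolding has_pdv_def by (auto intro!: derivative_eq_intros)
      then show "((\<lambda>\<sigma>. m (z + \<sigma> *\<^sub>R et_dir) s) has_real_derivative (pdv et_dir h ?p - pdv et_dir h ?n) / 2 + \<alpha>) (at 0)"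
        by (simp add: m_def sq_def et_dir_def algebra_simps)
      show "fst z - (fst z0 - (L/2)\<^sup>2) > 0" using tL by simp
      show "m (z + \<sigma> *\<^sub>R et_dir) s \<le> m (z + 0 *\<^sub>R et_dir) s" if "- (fst z - (fst z0 - (L/2)\<^sup>2)) \<le> \<sigma>" "\<sigma> \<le> 0" for \<sigma>
      proof -
        have "z + \<sigma> *\<^sub>R et_dir \<in> past_cyl z0 (L/2)" using that K by (auto simp: past_cyl_def et_dir_def)
        from mx[OF this K(2,3)] show ?thesis by simp
      qed
    qed
    have J: "(pdv (ex_dir j) (pdv (ex_dir j) h) ?p - pdv (ex_dir j) (pdv (ex_dir j) h) ?n) / 2 - 2 * \<alpha> \<le> 0" for j
    proof (rule deriv2_nonpos_max)
      let ?w = "snd z - snd z0"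
      let ?c = "2 * (?w \<bullet> axis j 1)"
      have sqe: "sq (z + \<sigma> *\<^sub>R ex_dir j) = sq z + ?c * \<sigma> + \<sigma>\<^sup>2" for \<sigma>
      proof -
        have "sq (z + \<sigma> *\<^sub>R ex_dir j) = (?w + \<sigma> *\<^sub>R axis j 1) \<bullet> (?w + \<sigma> *\<^sub>R axis j 1)"
          by (simp add: sq_def ex_dir_def algebra_simps)
        also have "\<dots> = ?w \<bullet> ?w + ?c * \<sigma> + \<sigma>\<^sup>2"
          by (simp only: inner_add inner_scaleR_left inner_scaleR_right) 
             (simp add: inner_axis_axis power2_eq_square inner_commute distrib_left)
        finally show ?thesis by (simp add: sq_def)
      qed
      have d1: "((\<lambda>\<sigma>. h (?p + \<sigma> *\<^sub>R ex_dir j)) has_real_derivative pdv (ex_dir j) h (?p + \<sigma> *\<^sub>R ex_dir j)) (at \<sigma>)"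
         "((\<lambda>\<sigma>. h (?n + \<sigma> *\<^sub>R ex_dir j)) has_real_derivative pdv (ex_dir j) h (?n + \<sigma> *\<^sub>R ex_dir j)) (at \<sigma>)" for \<sigma>
        by (intro has_pdv_at C12D(4)[OF h])+
      have "((\<lambda>\<sigma>. (h (?p + \<sigma> *\<^sub>R ex_dir j) - h (?n + \<sigma> *\<^sub>R ex_dir j)) / 2 - \<alpha> * (sq z + ?c * \<sigma> + \<sigma>\<^sup>2 + (fst z0 - fst z)) - \<kappa> * (s * (L - s)))
        has_real_derivative (pdv (ex_dir j) h (?p + \<sigma> *\<^sub>R ex_dir j) - pdv (ex_dir j) h (?n + \<sigma> *\<^sub>R ex_dir j)) / 2 - \<alpha> * (?c + 2 * \<sigma>)) (at \<sigma>)" for \<sigma>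
        by (auto intro!: derivative_eq_intros d1)
      moreover have "m (z + \<sigma> *\<^sub>R ex_dir j) s = (h (?p + \<sigma> *\<^sub>R ex_dir j) - h (?n + \<sigma> *\<^sub>R ex_dir j)) / 2 - \<alpha> * (sq z + ?c * \<sigma> + \<sigma>\<^sup>2 + (fst z0 - fst z)) - \<kappa> * (s * (L - s))" for \<sigma>
        unfolding m_def sqe by (simp add: ex_dir_def algebra_simps)
      ultimately show "((\<lambda>\<sigma>. m (z + \<sigma> *\<^sub>R ex_dir j) s) has_real_derivative
         (pdv (ex_dir j) h (?p + \<sigma> *\<^sub>R ex_dir j) - pdv (ex_dir j) h (?n + \<sigma> *\<^sub>R ex_dir j)) / 2 - \<alpha> * (?c + 2 * \<sigma>)) (at \<sigma>)" for \<sigma> by simp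
      show "((\<lambda>\<sigma>. (pdv (ex_dir j) h (?p + \<sigma> *\<^sub>R ex_dir j) - pdv (ex_dir j) h (?n + \<sigma> *\<^sub>R ex_dir j)) / 2 - \<alpha> * (?c + 2 * \<sigma>))
         has_real_derivative (pdv (ex_dir j) (pdv (ex_dir j) h) ?p - pdv (ex_dir j) (pdv (ex_dir j) h) ?n) / 2 - 2 * \<alpha>) (at 0)"
        using C12D(6)[OF h, of j j] unfolding has_pdv_def by (auto intro!: derivative_eq_intros)
      show "L/2 - infnorm (snd z - snd z0) > 0" using xL by simp
      show "m (z + \<sigma> *\<^sub>R ex_dir j) s \<le> m (z + 0 *\<^sub>R ex_dir j) s" if "\<bar>\<sigma>\<bar> < L/2 - infnorm (snd z - snd z0)" for \<sigma>
      proof -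
        have "infnorm (snd (z + \<sigma> *\<^sub>R ex_dir j) - snd z0) \<le> infnorm (snd z - snd z0) + infnorm (\<sigma> *\<^sub>R (axis j 1 :: real^3))"
          using infnorm_triangle[of "snd z - snd z0" "\<sigma> *\<^sub>R axis j 1"] by (simp add: ex_dir_def algebra_simps)
        then have "infnorm (snd (z + \<sigma> *\<^sub>R ex_dir j) - snd z0) \<le> L/2" using infnorm_axis_le[of \<sigma> j] that by linarith
        then have "z + \<sigma> *\<^sub>R ex_dir j \<in> past_cyl z0 (L/2)" using K by (auto simp: past_cyl_def ex_dir_def)
        then show ?thesis using mx[of _ s] K by simp
      qed
    qed
    have S: "(pdv (ex_dir i) (pdv (ex_dir i) h) ?p - pdv (ex_dir i) (pdv (ex_dir i) h) ?n) / 2 + 2 * \<kappa> \<le> 0"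
    proof (rule deriv2_nonpos_max)
      have d1: "((\<lambda>\<sigma>. h (z + (s + \<sigma>) *\<^sub>R ex_dir i)) has_real_derivative pdv (ex_dir i) h (z + (s + \<sigma>) *\<^sub>R ex_dir i)) (at \<sigma>)"
        and d3: "((\<lambda>\<sigma>. pdv (ex_dir i) h (z + (s + \<sigma>) *\<^sub>R ex_dir i)) has_real_derivative pdv (ex_dir i) (pdv (ex_dir i) h) (z + (s + \<sigma>) *\<^sub>R ex_dir i)) (at \<sigma>)" for \<sigma>
        using has_pdv_at[OF C12D(4)[OF h, of i], of ?p \<sigma>] has_pdv_at[OF C12D(6)[OF h, of i i], of ?p \<sigma>]
        by (simp_all add: scaleR_left_distrib add.assoc)
      have d2: "((\<lambda>\<sigma>. h (z - (s + \<sigma>) *\<^sub>R ex_dir i)) has_real_derivative - pdv (ex_dir i) h (z - (s + \<sigma>) *\<^sub>R ex_dir i)) (at \<sigma>)"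
        and d4: "((\<lambda>\<sigma>. pdv (ex_dir i) h (z - (s + \<sigma>) *\<^sub>R ex_dir i)) has_real_derivative - pdv (ex_dir i) (pdv (ex_dir i) h) (z - (s + \<sigma>) *\<^sub>R ex_dir i)) (at \<sigma>)" for \<sigma>
      proof -
        have "((\<lambda>\<sigma>. f (z - (s + \<sigma>) *\<^sub>R ex_dir i)) has_real_derivative - f' (z - (s + \<sigma>) *\<^sub>R ex_dir i)) (at \<sigma>)" if "has_pdv (ex_dir i) f f'" for f f'
        proof -
          have "((\<lambda>\<sigma>. f (z + (- (s + \<sigma>)) *\<^sub>R ex_dir i)) has_real_derivative f' (z + (- (s + \<sigma>)) *\<^sub>R ex_dir i) * -1) (at \<sigma>)"
            by (rule DERIV_chain2[where g="\<lambda>\<sigma>. - (s + \<sigma>)" and f="\<lambda>q. f (z + q *\<^sub>R ex_dir i)", OF has_pdv_at[OF that]])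
              (auto intro!: derivative_eq_intros)
          moreover have "z + (- (s + q)) *\<^sub>R ex_dir i = z - (s + q) *\<^sub>R ex_dir i" for q
            by (simp only: scaleR_minus_left add_uminus_conv_diff)
          ultimately show ?thesis by (simp only: mult_minus1_right)
        qed
        from this[OF C12D(4)[OF h]] this[OF C12D(6)[OF h]]
        show "((\<lambda>\<sigma>. h (z - (s + \<sigma>) *\<^sub>R ex_dir i)) has_real_derivative - pdv (ex_dir i) h (z - (s + \<sigma>) *\<^sub>R ex_dir i)) (at \<sigma>)"
          "((\<lambda>\<sigma>. pdv (ex_dir i) h (z - (s + \<sigma>) *\<^sub>R ex_dir i)) has_real_derivative - pdv (ex_dir i) (pdv (ex_dir i) h) (z - (s + \<sigma>) *\<^sub>R ex_dir i)) (at \<sigma>)" by auto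
      qed
      show "((\<lambda>\<sigma>. m z (s + \<sigma>)) has_real_derivative
          (pdv (ex_dir i) h (z + (s + \<sigma>) *\<^sub>R ex_dir i) + pdv (ex_dir i) h (z - (s + \<sigma>) *\<^sub>R ex_dir i)) / 2 - \<kappa> * (L - 2 * (s + \<sigma>))) (at \<sigma>)" for \<sigma>
        unfolding m_def by (rule derivative_eq_intros d1 d2 refl | simp)+ (simp add: algebra_simps)
      show "((\<lambda>\<sigma>. (pdv (ex_dir i) h (z + (s + \<sigma>) *\<^sub>R ex_dir i) + pdv (ex_dir i) h (z - (s + \<sigma>) *\<^sub>R ex_dir i)) / 2 - \<kappa> * (L - 2 * (s + \<sigma>)))
         has_real_derivative (pdv (ex_dir i) (pdv (ex_dir i) h) ?p - pdv (ex_dir i) (pdv (ex_dir i) h) ?n) / 2 + 2 * \<kappa>) (at 0)"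
        using d3[of 0] d4[of 0] by (auto intro!: derivative_eq_intros)
      show "min s (L/2 - s) > 0" using s0 sL by simp
      show "m z (s + \<sigma>) \<le> m z (s + 0)" if "\<bar>\<sigma>\<bar> < min s (L/2 - s)" for \<sigma>
        using mx[OF K(1), of "s + \<sigma>"] that by auto
    qed
    \<comment> \<open>In the direction \<open>i\<close> the second derivative in \<open>s\<close>
      takes the place of the one in the \<open>i\<close>-th space variable, which is why this
      summand is split off.\<close>
    have sumeq: "(\<Sum>j\<in>UNIV. pdv (ex_dir j) (pdv (ex_dir j) h) y) = pdv (ex_dir i) (pdv (ex_dir i) h) y + (\<Sum>j\<in>UNIV - {i}. pdv (ex_dir j) (pdv (ex_dir j) h) y)" for y
      by (simp add: sum.remove[of UNIV i])
    have "(\<Sum>j\<in>UNIV - {i}. (pdv (ex_dir j) (pdv (ex_dir j) h) ?p - pdv (ex_dir j) (pdv (ex_dir j) h) ?n) / 2 - 2 * \<alpha>) \<le> 0"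
      by (intro sum_nonpos J)
    then have "((\<Sum>j\<in>UNIV - {i}. pdv (ex_dir j) (pdv (ex_dir j) h) ?p) - (\<Sum>j\<in>UNIV - {i}. pdv (ex_dir j) (pdv (ex_dir j) h) ?n)) / 2 - 4 * \<alpha> \<le> 0"
      by (simp add: sum_subtractf card_Diff_singleton flip: sum_divide_distrib)
    with T S have "(heat_op h ?p - heat_op h ?n) / 2 + 5 * \<alpha> - 2 * \<kappa> \<ge> 0"
      unfolding heat_op_def sumeq by (simp add: field_simps)
    moreover have "(heat_op h ?p - heat_op h ?n) / 2 \<le> B" using hB[OF in_L(1)[OF K]] hB[OF in_L(2)[OF K]] unfolding abs_le_iff by (simp add: field_simps)
    ultimately show False using \<kappa>(1) by linarith
  qed
  \<comment> \<open>At the centre the paraboloid vanishes, so the barrier alone bounds the symmetric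
    difference; dividing by \<open>q\<close> and letting it tend to 0 gives the derivative.\<close>
  then have le: "(h (z0 + q *\<^sub>R ex_dir i) - h (z0 - q *\<^sub>R ex_dir i)) / 2 \<le> \<kappa> * L * q" if "0 < q" "q \<le> L/2" for q
  proof -
    have "m z0 q \<le> 0" using mx[OF past_cyl_center, of q] that \<open>m z s \<le> 0\<close> L by auto
    then have "(h (z0 + q *\<^sub>R ex_dir i) - h (z0 - q *\<^sub>R ex_dir i)) / 2 \<le> \<kappa> * (q * (L - q))" by (simp add: m_def sq_def)
    also have "\<dots> \<le> \<kappa> * (q * L)" using \<kappa> that by (intro mult_left_mono) auto
    finally show ?thesis by (simp add: algebra_simps)
  qed
  have "pdv (ex_dir i) h z0 \<le> \<kappa> * L"
  proof (rule ccontr)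
    assume "\<not> pdv (ex_dir i) h z0 \<le> \<kappa> * L"
    have d1: "((\<lambda>s. h (z0 + s *\<^sub>R ex_dir i)) has_real_derivative pdv (ex_dir i) h z0) (at (0::real))"
      using C12D(4)[OF h, of i] by (simp add: has_pdv_def)
    have "((\<lambda>s. h (z0 + (- s) *\<^sub>R ex_dir i)) has_real_derivative pdv (ex_dir i) h z0 * - 1) (at (0::real))"
      by (rule DERIV_chain2[where g="uminus" and f="\<lambda>q. h (z0 + q *\<^sub>R ex_dir i)"])
         (use d1 in \<open>auto intro!: derivative_eq_intros\<close>)
    then have d2: "((\<lambda>s. h (z0 - s *\<^sub>R ex_dir i)) has_real_derivative - pdv (ex_dir i) h z0) (at (0::real))" by simp
    have "((\<lambda>q. (h (z0 + q *\<^sub>R ex_dir i) - h (z0 - q *\<^sub>R ex_dir i)) / 2 - \<kappa> * L * q) has_real_derivative pdv (ex_dir i) h z0 - \<kappa> * L) (at 0)"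
      by (rule derivative_eq_intros d1 d2 refl | simp)+
    from DERIV_pos_inc_right[OF this] \<open>\<not> pdv (ex_dir i) h z0 \<le> \<kappa> * L\<close> obtain d where
      d: "d > 0" "\<And>q. q > 0 \<Longrightarrow> q < d \<Longrightarrow> 0 < (h (z0 + q *\<^sub>R ex_dir i) - h (z0 - q *\<^sub>R ex_dir i)) / 2 - \<kappa> * L * q" by auto
    define q where "q = min (d/2) (L/2)"
    have "0 < q" "q < d" "q \<le> L/2" using d(1) L by (auto simp: q_def min_def)
    with d(2)[of q] le[of q] show False by auto
  qed
  also have "\<kappa> * L = 11 * A / L + B * L" using L by (simp add: \<kappa>_def field_simps power2_eq_square)
  finally show ?thesis .
qed

lemma C12_const: "C12 (\<lambda>_. c)"
proof -
  have p: "has_pdv e (\<lambda>_. c) (\<lambda>_. 0)" for e c by (simp add: has_pdv_def)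
  show ?thesis by (rule C12I(1)[OF _ p _ p _ p]) auto
qed

lemma gradient_bound:
  assumes h: "C12 h" and L: "L > 0" and A: "A > 0"
    and hA: "\<And>y. y \<in> past_cyl z0 L \<Longrightarrow> \<bar>h y\<bar> \<le> A" and hB: "\<And>y. y \<in> past_cyl z0 L \<Longrightarrow> \<bar>heat_op h y\<bar> \<le> B"
  shows "\<bar>pdv (ex_dir i) h z0\<bar> \<le> 11 * A / L + B * L"
proof -
  note C = C12_lin[OF h C12_const[of 0], where a="-1" and b=0 and c=0]
  have "pdv (ex_dir i) (\<lambda>z. -1 * h z + 0 * 0 + 0) z0 \<le> 11 * A / L + B * L"
    by (rule gradient_bound_upper[OF C(1) L A]) (use hA hB in \<open>simp_all add: C(5)[simplified]\<close>)
  then have "- pdv (ex_dir i) h z0 \<le> 11 * A / L + B * L" using C(3)[of i z0] by simp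
  moreover have "pdv (ex_dir i) h z0 \<le> 11 * A / L + B * L"
    by (rule gradient_bound_upper[OF h L A]) (use hA hB in auto)
  ultimately show ?thesis by linarith
qed

text \<open>The sign condition keeps the intermediate point between 0 and \<open>s\<close>. This
  matters in the time direction, where the segment has to remain in the past cylinder.\<close>

lemma mvt_dir:
  assumes p: "has_pdv e f g" and M: "\<And>\<sigma>. \<bar>\<sigma>\<bar> \<le> \<bar>s\<bar> \<Longrightarrow> \<sigma> * s \<ge> 0 \<Longrightarrow> \<bar>g (z + \<sigma> *\<^sub>R e) - c\<bar> \<le> M"
  shows "\<bar>f (z + s *\<^sub>R e) - f z - c * s\<bar> \<le> M * \<bar>s\<bar>"
proof -
  have d: "((\<lambda>s. f (z + s *\<^sub>R e) - c * s) has_real_derivative g (z + q *\<^sub>R e) - c) (at q)" for q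
    by (rule derivative_eq_intros has_pdv_at[OF p] refl | simp)+
  consider "s = 0" | "s > 0" | "s < 0" by linarith
  then show ?thesis
  proof cases
    case 2
    from MVT2[OF this d] obtain \<xi> where "0 < \<xi>" "\<xi> < s"
      "(f (z + s *\<^sub>R e) - c * s) - (f (z + 0 *\<^sub>R e) - c * 0) = (s - 0) * (g (z + \<xi> *\<^sub>R e) - c)" by blast
    moreover from this have "\<bar>g (z + \<xi> *\<^sub>R e) - c\<bar> \<le> M" using 2 by (intro M) auto
    then have "\<bar>s * (g (z + \<xi> *\<^sub>R e) - c)\<bar> \<le> M * \<bar>s\<bar>"
      unfolding abs_mult by (subst mult.commute) (rule mult_right_mono, auto)
    ultimately show ?thesis by (simp add: algebra_simps)
  next
    case 3
    from MVT2[OF this d] obtain \<xi> where "s < \<xi>" "\<xi> < 0"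
      "(f (z + 0 *\<^sub>R e) - c * 0) - (f (z + s *\<^sub>R e) - c * s) = (0 - s) * (g (z + \<xi> *\<^sub>R e) - c)" by blast
    moreover from this have "\<bar>g (z + \<xi> *\<^sub>R e) - c\<bar> \<le> M" using 3 by (intro M) (auto simp: mult_nonpos_nonpos)
    then have "\<bar>s * (g (z + \<xi> *\<^sub>R e) - c)\<bar> \<le> M * \<bar>s\<bar>"
      unfolding abs_mult by (subst mult.commute) (rule mult_right_mono, auto)
    ultimately show ?thesis by (simp add: algebra_simps)
  qed simp
qed

text \<open>The point is reached by three axis-parallel steps followed by one step back in time, all
  inside the cylinder. The gradient at the centre is used in every step, and its drift costs at most
  1, 2 and 3 times \<open>H * r^2\<close>; the total 6 is rounded up to 9.\<close>

lemma taylor_par: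
  assumes f: "C12 f" and r: "0 \<le> r" and y: "y \<in> past_cyl z0 r"
    and a: "\<And>y. y \<in> past_cyl z0 r \<Longrightarrow> \<bar>pdv et_dir f y\<bar> \<le> a"
    and H: "\<And>y i j. y \<in> past_cyl z0 r \<Longrightarrow> \<bar>pdv (ex_dir j) (pdv (ex_dir i) f) y\<bar> \<le> H"
  shows "\<bar>f y - f z0 - (\<Sum>i\<in>UNIV. pdv (ex_dir i) f z0 * (snd y - snd z0) $ i)\<bar> \<le> (a + 9 * H) * r\<^sup>2"
proof -
  define w where "w = snd y - snd z0"
  have w: "\<bar>w $ i\<bar> \<le> r" for i using y by (auto simp: past_cyl_def w_def infnorm_le_iff)
  define q where "q = (\<lambda>a b c. z0 + a *\<^sub>R ex_dir 1 + b *\<^sub>R ex_dir 2 + c *\<^sub>R ex_dir 3)"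
  have qin: "q a b c \<in> past_cyl z0 r" if "\<bar>a\<bar> \<le> r" "\<bar>b\<bar> \<le> r" "\<bar>c\<bar> \<le> r" for a b c
    using that r by (auto simp: q_def past_cyl_def ex_dir_def infnorm_le_iff forall_3 axis_def)
  have H0: "0 \<le> H" using H[OF past_cyl_center[OF r], of 1 1] by linarith
  have step: "\<bar>f (z + s *\<^sub>R ex_dir i) - f z - pdv (ex_dir i) f z0 * s\<bar> \<le> M * H * r\<^sup>2"
    if "\<bar>s\<bar> \<le> r" "\<And>\<sigma>. \<bar>\<sigma>\<bar> \<le> \<bar>s\<bar> \<Longrightarrow> \<bar>pdv (ex_dir i) f (z + \<sigma> *\<^sub>R ex_dir i) - pdv (ex_dir i) f z0\<bar> \<le> M * H * r" for z s i M
  proof -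
    have "\<bar>f (z + s *\<^sub>R ex_dir i) - f z - pdv (ex_dir i) f z0 * s\<bar> \<le> M * H * r * \<bar>s\<bar>"
      by (rule mvt_dir[OF C12D(4)[OF f]]) (use that in auto)
    also have "\<dots> \<le> M * H * r * r" using that(1) order_trans[OF abs_ge_zero that(2)[of 0]] by (intro mult_left_mono) auto
    finally show ?thesis by (simp add: power2_eq_square)
  qed
  have lip: "\<bar>pdv (ex_dir i) f (z + s *\<^sub>R ex_dir j) - pdv (ex_dir i) f z\<bar> \<le> H * r"
    if "\<bar>s\<bar> \<le> r" "\<And>\<sigma>. \<bar>\<sigma>\<bar> \<le> r \<Longrightarrow> z + \<sigma> *\<^sub>R ex_dir j \<in> past_cyl z0 r" for z s i j
  proof -
    have "\<bar>pdv (ex_dir i) f (z + s *\<^sub>R ex_dir j) - pdv (ex_dir i) f z - 0 * s\<bar> \<le> H * \<bar>s\<bar>"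
      by (rule mvt_dir[OF C12D(6)[OF f]]) (use that in \<open>auto intro!: H\<close>)
    also have "\<dots> \<le> H * r" using that H0 by (intro mult_left_mono) auto
    finally show ?thesis by simp
  qed
  have q1: "q a 0 0 = z0 + a *\<^sub>R ex_dir 1" "q a b 0 = q a 0 0 + b *\<^sub>R ex_dir 2" "q a b c = q a b 0 + c *\<^sub>R ex_dir 3" "q 0 0 0 = z0" for a b c
    by (auto simp: q_def)
  have l1: "\<bar>pdv (ex_dir i) f (q a 0 0) - pdv (ex_dir i) f z0\<bar> \<le> H * r" if "\<bar>a\<bar> \<le> r" for a i
    unfolding q1(1) by (rule lip[OF that]) (use qin[of _ 0 0] r in \<open>auto simp: q_def\<close>)
  have l2: "\<bar>pdv (ex_dir i) f (q a b 0) - pdv (ex_dir i) f (q a 0 0)\<bar> \<le> H * r" if "\<bar>a\<bar> \<le> r" "\<bar>b\<bar> \<le> r" for a b i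
    unfolding q1(2)[of a b] by (rule lip[OF that(2)]) (use qin[of a _ 0] that r in \<open>auto simp: q_def\<close>)
  have l3: "\<bar>pdv (ex_dir i) f (q a b c) - pdv (ex_dir i) f (q a b 0)\<bar> \<le> H * r" if "\<bar>a\<bar> \<le> r" "\<bar>b\<bar> \<le> r" "\<bar>c\<bar> \<le> r" for a b c i
    unfolding q1(3)[of a b c] by (rule lip[OF that(3)]) (use qin[of a b] that r in \<open>auto simp: q_def\<close>)
  have s1: "\<bar>f (q (w$1) 0 0) - f z0 - pdv (ex_dir 1) f z0 * w$1\<bar> \<le> 1 * H * r\<^sup>2"
    unfolding q1(1) 
  proof (rule step)
    fix \<sigma> assume "\<bar>\<sigma>\<bar> \<le> \<bar>w $ 1\<bar>"
    then have "\<bar>\<sigma>\<bar> \<le> r" using w[of 1] by linarith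
    from l1[OF this, of 1] show "\<bar>pdv (ex_dir 1) f (z0 + \<sigma> *\<^sub>R ex_dir 1) - pdv (ex_dir 1) f z0\<bar> \<le> 1 * H * r" by (simp flip: q1(1))
  qed (rule w)
  have s2: "\<bar>f (q (w$1) (w$2) 0) - f (q (w$1) 0 0) - pdv (ex_dir 2) f z0 * w$2\<bar> \<le> 2 * H * r\<^sup>2"
    unfolding q1(2)[of "w$1" "w$2"]
  proof (rule step)
    fix \<sigma> assume "\<bar>\<sigma>\<bar> \<le> \<bar>w $ 2\<bar>"
    then have "\<bar>\<sigma>\<bar> \<le> r" using w[of 2] by linarith
    with l2[of "w$1" \<sigma> 2] l1[of "w$1" 2] w
    have "\<bar>pdv (ex_dir 2) f (q (w$1) \<sigma> 0) - pdv (ex_dir 2) f z0\<bar> \<le> 2 * (H * r)" by fastforce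
    then show "\<bar>pdv (ex_dir 2) f (q (w $ 1) 0 0 + \<sigma> *\<^sub>R ex_dir 2) - pdv (ex_dir 2) f z0\<bar> \<le> 2 * H * r" by (simp flip: q1(2))
  qed (rule w)
  have s3: "\<bar>f (q (w$1) (w$2) (w$3)) - f (q (w$1) (w$2) 0) - pdv (ex_dir 3) f z0 * w$3\<bar> \<le> 3 * H * r\<^sup>2"
    unfolding q1(3)[of _ _ "w$3"]
  proof (rule step)
    fix \<sigma> assume "\<bar>\<sigma>\<bar> \<le> \<bar>w $ 3\<bar>"
    then have "\<bar>\<sigma>\<bar> \<le> r" using w[of 3] by linarith
    with l3[of "w$1" "w$2" \<sigma> 3] l2[of "w$1" "w$2" 3] l1[of "w$1" 3] w
    have "\<bar>pdv (ex_dir 3) f (q (w$1) (w$2) \<sigma>) - pdv (ex_dir 3) f z0\<bar> \<le> 3 * (H * r)" by fastforce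
    then show "\<bar>pdv (ex_dir 3) f (q (w $ 1) (w $ 2) 0 + \<sigma> *\<^sub>R ex_dir 3) - pdv (ex_dir 3) f z0\<bar> \<le> 3 * H * r" by (simp flip: q1(3))
  qed (rule w)
  have qw: "q (w$1) (w$2) (w$3) = (fst z0, snd y)"
    by (auto simp: q_def w_def ex_dir_def prod_eq_iff vec_eq_iff forall_3 axis_def)
  define \<tau> where "\<tau> = fst y - fst z0"
  have \<tau>: "\<tau> \<le> 0" "\<bar>\<tau>\<bar> \<le> r\<^sup>2" using y by (auto simp: past_cyl_def \<tau>_def)
  have yq: "y = (fst z0, snd y) + \<tau> *\<^sub>R et_dir" by (simp add: \<tau>_def et_dir_def prod_eq_iff)
  have "\<bar>f ((fst z0, snd y) + \<tau> *\<^sub>R et_dir) - f (fst z0, snd y) - 0 * \<tau>\<bar> \<le> a * \<bar>\<tau>\<bar>"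
  proof (rule mvt_dir[OF C12D(2)[OF f]])
    fix \<sigma> assume "\<bar>\<sigma>\<bar> \<le> \<bar>\<tau>\<bar>" "0 \<le> \<sigma> * \<tau>"
    then have "(fst z0, snd y) + \<sigma> *\<^sub>R et_dir \<in> past_cyl z0 r"
      using \<tau> y by (cases "\<tau> = 0") (auto simp: past_cyl_def et_dir_def zero_le_mult_iff)
    then show "\<bar>pdv et_dir f ((fst z0, snd y) + \<sigma> *\<^sub>R et_dir) - 0\<bar> \<le> a" using a by simp
  qed
  also have "a * \<bar>\<tau>\<bar> \<le> a * r\<^sup>2" using \<tau> order_trans[OF abs_ge_zero a[OF y]] by (intro mult_left_mono) auto
  finally have s4: "\<bar>f y - f (fst z0, snd y)\<bar> \<le> a * r\<^sup>2" using yq by simp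
  have "0 \<le> H * r\<^sup>2" using H0 by simp
  have tri: "\<bar>fy - f0 - (A1 + A2 + A3)\<bar> \<le> (a + 9 * H) * r\<^sup>2"
    if "\<bar>F1 - f0 - A1\<bar> \<le> 1 * H * r\<^sup>2" "\<bar>F2 - F1 - A2\<bar> \<le> 2 * H * r\<^sup>2" "\<bar>F3 - F2 - A3\<bar> \<le> 3 * H * r\<^sup>2"
      "\<bar>fy - F3\<bar> \<le> a * r\<^sup>2" for fy f0 A1 A2 A3 F1 F2 F3
  proof -
    have "\<bar>fy - f0 - (A1 + A2 + A3)\<bar> \<le> \<bar>F1 - f0 - A1\<bar> + \<bar>F2 - F1 - A2\<bar> + \<bar>F3 - F2 - A3\<bar> + \<bar>fy - F3\<bar>" by linarith
    also have "\<dots> \<le> 1 * H * r\<^sup>2 + 2 * H * r\<^sup>2 + 3 * H * r\<^sup>2 + a * r\<^sup>2" by (intro add_mono that)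
    also have "\<dots> \<le> (a + 9 * H) * r\<^sup>2" using \<open>0 \<le> H * r\<^sup>2\<close> by (simp add: algebra_simps)
    finally show ?thesis .
  qed
  show ?thesis using tri[OF s1 s2 s3[unfolded qw] s4] by (simp add: sum_3 w_def)
qed

lemma past_cyl_sub: "x \<in> past_cyl z s \<Longrightarrow> 0 \<le> r \<Longrightarrow> 0 \<le> s \<Longrightarrow> r + s \<le> L \<Longrightarrow> past_cyl x r \<subseteq> past_cyl z L"
  using past_cyl_trans[of _ x r z s] past_cyl_mono[of "r + s" L z] by (meson add_nonneg_nonneg subset_iff)

text \<open>The gradient bound is used twice: for \<open>h\<close>, then for spatial difference
  quotients of \<open>h\<close>, because \<open>C12\<close> offers no third derivatives to
  differentiate the equation. The time derivative is read off from the equation. Shifts are limited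
  by \<open>q\<close> in \<open>hB'\<close> because a mollified right-hand side is Lipschitz with
  good constant only up to the mollification scale.\<close>

lemma interior_taylor:
  assumes h: "C12 h" and L: "L > 0" and A: "A > 0"
    and hA: "\<And>y. y \<in> past_cyl z0 L \<Longrightarrow> \<bar>h y\<bar> \<le> A" and hB: "\<And>y. y \<in> past_cyl z0 L \<Longrightarrow> \<bar>heat_op h y\<bar> \<le> B"
    and hB': "\<And>y s j. y \<in> past_cyl z0 L \<Longrightarrow> y + s *\<^sub>R ex_dir j \<in> past_cyl z0 L \<Longrightarrow> \<bar>s\<bar> \<le> q \<Longrightarrow> \<bar>heat_op h (y + s *\<^sub>R ex_dir j) - heat_op h y\<bar> \<le> B' * \<bar>s\<bar>"
    and q: "0 < q" and r: "0 \<le> r" "r \<le> L / 4" and y: "y \<in> past_cyl z0 r"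
  shows "\<bar>h y - h z0 - (\<Sum>i\<in>UNIV. pdv (ex_dir i) h z0 * (snd y - snd z0) $ i)\<bar> \<le> 24000 * (A / L\<^sup>2 + B + B' * L) * r\<^sup>2"
proof -
  have B: "0 \<le> B" using order_trans[OF abs_ge_zero hB[OF past_cyl_center]] L by auto
  define q' where "q' = min q (L / 8)"
  have q': "0 < q'" "q' \<le> q" "q' \<le> L/8" using q L by (auto simp: q'_def)
  have B'0: "0 \<le> B'"
  proof -
    have "past_cyl z0 (0 + \<bar>q'\<bar>) \<subseteq> past_cyl z0 L" using q' L by (intro past_cyl_mono) auto
    then have "z0 + q' *\<^sub>R ex_dir 1 \<in> past_cyl z0 L" using past_cyl_ex[OF past_cyl_center[of 0 z0], of q' 1] by auto
    from hB'[OF past_cyl_center this] q' L have "0 \<le> B' * \<bar>q'\<bar>" by (smt (verit))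
    with q' show ?thesis by (simp add: zero_le_mult_iff)
  qed
  define G where "G = 22 * A / L + B * L / 2"
  have G: "G > 0" using A B L by (auto simp: G_def intro!: add_pos_nonneg)
  have g1: "\<bar>pdv (ex_dir i) h z\<bar> \<le> G" if "z \<in> past_cyl z0 (L/2)" for z i
  proof -
    have s: "past_cyl z (L/2) \<subseteq> past_cyl z0 L" by (rule past_cyl_sub[OF that]) (use L in auto)
    have "\<bar>pdv (ex_dir i) h z\<bar> \<le> 11 * A / (L/2) + B * (L/2)"
      by (rule gradient_bound[OF h _ A]) (use L s hA hB in auto)
    then show ?thesis by (simp add: G_def)
  qed
  define H where "H = 88 * G / L + B' * L / 8"
  have H2: "\<bar>pdv (ex_dir j) (pdv (ex_dir i) h) z\<bar> \<le> H" if z: "z \<in> past_cyl z0 (L/4)" for z i j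
  proof -
    have dq: "\<bar>(pdv (ex_dir i) h (z + s *\<^sub>R ex_dir j) - pdv (ex_dir i) h z) / s\<bar> \<le> H" if s: "s \<noteq> 0" "\<bar>s\<bar> \<le> q'" for s
    proof -
      \<comment> \<open>The translate is written with \<open>dil 1\<close> so that it becomes an
        instance of \<open>C12_scale\<close>.\<close>
      define k where "k = (\<lambda>y. (1/s) * (1 * h (s *\<^sub>R ex_dir j + dil 1 y)) + (-1/s) * h y + 0)"
      note C = C12_lin[OF C12_scale(1)[OF h, where c=1 and p="s *\<^sub>R ex_dir j" and r=1] h, where a="1/s" and b="-1/s" and c=0, folded k_def]
      have C3: "pdv (ex_dir i) k y = (pdv (ex_dir i) h (y + s *\<^sub>R ex_dir j) - pdv (ex_dir i) h y) / s" for y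
        unfolding C(3) C12_scale(3)[OF h] by (simp add: add.commute diff_divide_distrib)
      have C5: "heat_op k y = (heat_op h (y + s *\<^sub>R ex_dir j) - heat_op h y) / s" for y
        unfolding C(5) C12_scale(4)[OF h] by (simp add: add.commute diff_divide_distrib)
      have ke: "k y = (h (y + s *\<^sub>R ex_dir j) - h y) / s" for y
        by (simp add: k_def add.commute diff_divide_distrib)
      have in38: "y \<in> past_cyl z0 (3*L/8)" if "y \<in> past_cyl z (L/8)" for y
        using past_cyl_sub[OF z, of "L/8" "3*L/8"] that L by auto
      have ins: "y + \<sigma> *\<^sub>R ex_dir j \<in> past_cyl z0 (L/2)" if "y \<in> past_cyl z (L/8)" "\<bar>\<sigma>\<bar> \<le> L/8" for y \<sigma>
        using past_cyl_ex[OF in38[OF that(1)], of \<sigma> j] past_cyl_mono[of "3*L/8 + \<bar>\<sigma>\<bar>" "L/2" z0] that(2) L by auto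
      have sub: "past_cyl z0 (L/2) \<subseteq> past_cyl z0 L" using L by (intro past_cyl_mono) auto
      have "\<bar>pdv (ex_dir i) k z\<bar> \<le> 11 * G / (L/8) + B' * (L/8)"
      proof (rule gradient_bound[OF C(1) _ G])
        fix y assume y: "y \<in> past_cyl z (L/8)"
        have "\<bar>h (y + s *\<^sub>R ex_dir j) - h y - 0 * s\<bar> \<le> G * \<bar>s\<bar>"
        proof (rule mvt_dir[OF C12D(4)[OF h]])
          fix \<sigma> assume "\<bar>\<sigma>\<bar> \<le> \<bar>s\<bar>"
          then have "\<bar>\<sigma>\<bar> \<le> L/8" using s q' by linarith
          from g1[OF ins[OF y this], of j] show "\<bar>pdv (ex_dir j) h (y + \<sigma> *\<^sub>R ex_dir j) - 0\<bar> \<le> G" by simp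
        qed
        then show "\<bar>k y\<bar> \<le> G" using s unfolding ke by (simp add: abs_divide divide_le_eq)
        have "\<bar>heat_op h (y + s *\<^sub>R ex_dir j) - heat_op h y\<bar> \<le> B' * \<bar>s\<bar>"
          using ins[OF y, of 0] ins[OF y, of s] s q' sub L by (intro hB') auto
        then show "\<bar>heat_op k y\<bar> \<le> B'" using s unfolding C5 by (simp add: abs_divide divide_le_eq)
      qed (use L in auto)
      then show ?thesis unfolding C3 by (simp add: H_def)
    qed
    \<comment> \<open>The bound on the difference quotients is uniform in the step, so it passes to
      the second derivative.\<close>
    have "((\<lambda>s. (pdv (ex_dir i) h (z + s *\<^sub>R ex_dir j) - pdv (ex_dir i) h (z + 0 *\<^sub>R ex_dir j)) / (s - 0)) \<longlongrightarrow> pdv (ex_dir j) (pdv (ex_dir i) h) z) (at 0)"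
      using C12D(6)[OF h, of j i] unfolding has_pdv_def has_field_derivative_iff by (auto simp: add.commute)
    then have "((\<lambda>s. \<bar>(pdv (ex_dir i) h (z + s *\<^sub>R ex_dir j) - pdv (ex_dir i) h z) / s\<bar>) \<longlongrightarrow> \<bar>pdv (ex_dir j) (pdv (ex_dir i) h) z\<bar>) (at 0)"
      by (intro tendsto_rabs) simp
    moreover have "eventually (\<lambda>s. \<bar>(pdv (ex_dir i) h (z + s *\<^sub>R ex_dir j) - pdv (ex_dir i) h z) / s\<bar> \<le> H) (at 0)"
      unfolding eventually_at using q' dq by (intro exI[of _ q']) (auto simp: dist_real_def)
    ultimately show ?thesis by (rule tendsto_upperbound) simp
  qed
  have H0: "0 \<le> H" using order_trans[OF abs_ge_zero H2[OF past_cyl_center]] L by auto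
  have sub: "past_cyl z0 r \<subseteq> past_cyl z0 (L/4)" "past_cyl z0 r \<subseteq> past_cyl z0 L" by (rule past_cyl_mono; use r L in simp)+
  have "\<bar>h y - h z0 - (\<Sum>i\<in>UNIV. pdv (ex_dir i) h z0 * (snd y - snd z0) $ i)\<bar> \<le> (B + 3 * H + 9 * H) * r\<^sup>2"
  proof (rule taylor_par[OF h r(1) y])
    fix z assume z: "z \<in> past_cyl z0 r"
    show H': "\<bar>pdv (ex_dir j) (pdv (ex_dir i) h) z\<bar> \<le> H" for i j using z sub by (intro H2) auto
    have "\<bar>\<Sum>i\<in>UNIV. pdv (ex_dir i) (pdv (ex_dir i) h) z\<bar> \<le> (\<Sum>i\<in>(UNIV::3 set). H)"
      by (rule order_trans[OF sum_abs sum_mono]) (rule H')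
    then have "\<bar>\<Sum>i\<in>UNIV. pdv (ex_dir i) (pdv (ex_dir i) h) z\<bar> \<le> 3 * H" by simp
    moreover have "\<bar>heat_op h z\<bar> \<le> B" using z sub by (intro hB) auto
    ultimately show "\<bar>pdv et_dir h z\<bar> \<le> B + 3 * H" unfolding heat_op_def by linarith
  qed
  \<comment> \<open>Expanding \<open>B + 12 * H\<close> gives the coefficients 12 * 88 * 22 = 23232
    for \<open>A / L^2\<close>, 529 for \<open>B\<close> and 3/2 for \<open>B' * L\<close>.\<close>
  also have "\<dots> \<le> 24000 * (A / L\<^sup>2 + B + B' * L) * r\<^sup>2"
  proof (rule mult_right_mono)
    have "G / L = 22 * (A / L\<^sup>2) + B / 2" using L by (simp add: G_def field_simps power2_eq_square)
    then have "H = 88 * (22 * (A / L\<^sup>2) + B / 2) + (B' * L) / 8" by (simp add: H_def)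
    moreover have "0 \<le> A / L\<^sup>2" "0 \<le> B' * L" using A L B'0 by auto
    ultimately show "B + 3 * H + 9 * H \<le> 24000 * (A / L\<^sup>2 + B + B' * L)" using B by simp
  qed simp
  finally show ?thesis .
qed

section \<open>Rescaling\<close>

lemma pdist_nonneg [simp]: "0 \<le> pdist y z"
  by (simp add: pdist_def infnorm_pos_le le_max_iff_disj)

lemma pdist_self [simp]: "pdist z z = 0"
  by (simp add: pdist_def infnorm_0)

lemma pdist_pos: "y \<noteq> z \<Longrightarrow> 0 < pdist y z"
  by (auto simp: pdist_def prod_eq_iff less_max_iff_disj infnorm_pos_lt)

lemma pdist_le_iff: "0 \<le> r \<Longrightarrow> pdist y z \<le> r \<longleftrightarrow> \<bar>fst y - fst z\<bar> \<le> r\<^sup>2 \<and> infnorm (snd y - snd z) \<le> r"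
  by (auto simp: pdist_def sqrt_le_D real_le_lsqrt)

lemma past_cyl_iff: "0 \<le> r \<Longrightarrow> y \<in> past_cyl z r \<longleftrightarrow> fst y \<le> fst z \<and> pdist y z \<le> r"
  by (auto simp: pdist_le_iff past_cyl_def)

lemma pdist_comp: "\<bar>snd (y - z) $ i\<bar> \<le> pdist y z"
  using component_le_infnorm_cart[of "snd (y - z)" i] by (auto simp: pdist_def le_max_iff_disj)

lemma pdist_ex: "pdist (z + s *\<^sub>R ex_dir i) z = \<bar>s\<bar>"
proof -
  have "infnorm (axis i 1 :: real^3) = 1"
    using component_le_infnorm_cart[of "axis i 1 :: real^3" i] infnorm_le_norm[of "axis i 1 :: real^3"] by simp
  then show ?thesis by (simp add: pdist_def ex_dir_def infnorm_mul)
qed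

lemma ex_in_Qc: "z + s *\<^sub>R ex_dir i \<in> past_cyl z \<bar>s\<bar>"
  by (subst past_cyl_iff) (auto simp: pdist_ex, simp add: ex_dir_def)

lemma supp_box_Qc: "y \<in> supp_box r \<longleftrightarrow> z - y \<in> past_cyl z r"
  by (auto simp: mem_supp_box past_cyl_def infnorm_neg)

lemma sum_comp_bound:
  fixes a b :: "3 \<Rightarrow> real"
  assumes "\<And>i. \<bar>a i\<bar> \<le> M" "\<And>i. \<bar>b i\<bar> \<le> d"
  shows "\<bar>\<Sum>i\<in>(UNIV::3 set). a i * b i\<bar> \<le> 3 * (M * d)"
proof -
  have "\<bar>\<Sum>i\<in>(UNIV::3 set). a i * b i\<bar> \<le> (\<Sum>i\<in>(UNIV::3 set). \<bar>a i * b i\<bar>)" by (rule sum_abs)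
  also have "\<dots> \<le> (\<Sum>i\<in>(UNIV::3 set). M * d)"
  proof (rule sum_mono)
    fix i show "\<bar>a i * b i\<bar> \<le> M * d" unfolding abs_mult
      by (intro mult_mono assms) (use order_trans[OF abs_ge_zero assms(1)] in auto)
  qed
  finally show ?thesis by simp
qed

lemma powr_le_powr: "0 \<le> x \<Longrightarrow> x \<le> 1 \<Longrightarrow> b \<le> a \<Longrightarrow> x powr a \<le> x powr (b::real)"
  by (cases "x = 0") (auto simp: powr_mono')

text \<open>The spatial gradient at \<open>y = z\<close> of \<open>vinc v Y2 Y3 y z\<close> as a
  function of \<open>y\<close>. It is classical because the data are regular, but only bounds for
  the combination are uniform in the noise; its three terms are never estimated separately in the
  uniform estimates.\<close>

definition vgrad :: "(pt \<Rightarrow> real) \<Rightarrow> (pt \<Rightarrow> real) \<Rightarrow> (pt \<Rightarrow> real) \<Rightarrow> 3 \<Rightarrow> pt \<Rightarrow> real" where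
  "vgrad v Y2 Y3 i z = pdv (ex_dir i) v z + pdv (ex_dir i) Y3 z + 3 * v z * pdv (ex_dir i) Y2 z"

definition vinc :: "(pt \<Rightarrow> real) \<Rightarrow> (pt \<Rightarrow> real) \<Rightarrow> (pt \<Rightarrow> real) \<Rightarrow> pt \<Rightarrow> pt \<Rightarrow> real" where
  "vinc v Y2 Y3 y z = v y - v z + (Y3 y - Y3 z) + 3 * v z * (Y2 y - Y2 z)"

text \<open>The first order Taylor remainder of \<open>vinc\<close>. For fixed regular data it is of
  second order in the parabolic distance, but uniformly in the noise only the order 5/4 is
  claimed.\<close>

definition vrem :: "(pt \<Rightarrow> real) \<Rightarrow> (pt \<Rightarrow> real) \<Rightarrow> (pt \<Rightarrow> real) \<Rightarrow> pt \<Rightarrow> pt \<Rightarrow> real" where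
  "vrem v Y2 Y3 y z = vinc v Y2 Y3 y z - (\<Sum>i\<in>UNIV. vgrad v Y2 Y3 i z * snd (y - z) $ i)"

text \<open>For $\<epsilon> \<le> 1/100$ and $T < 1$ these exponents weaken those of the theorem, and they make all
constants below independent of $\<epsilon>$. They stay subcritical, so the hypotheses survive parabolic rescaling by
$r \<le> 1$.\<close>

locale pde =
  fixes \<Phi> :: "pt \<Rightarrow> real" and \<delta> R :: real and v Y2 Y3 \<tau>1 \<tau>2 \<tau>3 :: "pt \<Rightarrow> real" and C :: real
  assumes ker: "kernel \<Phi>" and del: "0 < \<delta>" "\<delta> \<le> 1"
    and reg: "C12 v" "C12 Y2" "C12 Y3" "continuous_on UNIV \<tau>1" "continuous_on UNIV \<tau>2" "continuous_on UNIV \<tau>3"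
    and eqv: "\<And>z. z \<in> past_cyl 0 R \<Longrightarrow> heat_op v z = - ((v z)^3) - 3 * (v z)\<^sup>2 * \<tau>1 z - 3 * v z * \<tau>2 z - \<tau>3 z - 9 * C * (v z + \<tau>1 z)"
    and eq2: "\<And>z. z \<in> past_cyl 0 R \<Longrightarrow> heat_op Y2 z = \<tau>2 z"
    and eq3: "\<And>z. z \<in> past_cyl 0 R \<Longrightarrow> heat_op Y3 z = \<tau>3 z"
    and vb: "\<And>z. z \<in> past_cyl 0 R \<Longrightarrow> \<bar>v z\<bar> \<le> 2"
    and Y2h: "\<And>y z. pdist y z \<le> 1 \<Longrightarrow> \<bar>Y2 y - Y2 z\<bar> \<le> \<delta> * pdist y z powr (19/20)"
    and Y3h: "\<And>y z. pdist y z \<le> 1 \<Longrightarrow> \<bar>Y3 y - Y3 z\<bar> \<le> \<delta> * pdist y z powr (9/20)"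
    and n1: "\<And>z T. z \<in> past_cyl 0 R \<Longrightarrow> 0 < T \<Longrightarrow> T < 1 \<Longrightarrow> \<bar>conv (PsiT \<Phi> T) \<tau>1 z\<bar> \<le> \<delta> * T powr (-11/20)"
    and n2: "\<And>z T. z \<in> past_cyl 0 R \<Longrightarrow> 0 < T \<Longrightarrow> T < 1 \<Longrightarrow> \<bar>conv (PsiT \<Phi> T) \<tau>2 z\<bar> \<le> \<delta> * T powr (-21/20)"
    and n3: "\<And>z T. z \<in> past_cyl 0 R \<Longrightarrow> 0 < T \<Longrightarrow> T < 1 \<Longrightarrow> \<bar>conv (PsiT \<Phi> T) \<tau>3 z\<bar> \<le> \<delta> * T powr (-31/20)"
    and n6: "\<And>z T i. z \<in> past_cyl 0 R \<Longrightarrow> 0 < T \<Longrightarrow> T < 1 \<Longrightarrow>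
        \<bar>conv (PsiT \<Phi> T) (\<lambda>y. snd (y - z) $ i * \<tau>2 y) z\<bar> \<le> \<delta> * T powr (-1/20)"
    and n7: "\<And>z T. z \<in> past_cyl 0 R \<Longrightarrow> 0 < T \<Longrightarrow> T < 1 \<Longrightarrow>
        \<bar>conv (PsiT \<Phi> T) (\<lambda>y. (Y2 y - Y2 z) * \<tau>2 y - C) z\<bar> \<le> \<delta> * T powr (-1/20)"
    and n8: "\<And>z T. z \<in> past_cyl 0 R \<Longrightarrow> 0 < T \<Longrightarrow> T < 1 \<Longrightarrow>
        \<bar>conv (PsiT \<Phi> T) (\<lambda>y. (Y3 y - Y3 z) * \<tau>1 y) z\<bar> \<le> \<delta> * T powr (-1/20)"
    and n9: "\<And>z T. z \<in> past_cyl 0 R \<Longrightarrow> 0 < T \<Longrightarrow> T < 1 \<Longrightarrow>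
        \<bar>conv (PsiT \<Phi> T) (\<lambda>y. (Y3 y - Y3 z) * \<tau>2 y - 3 * C * \<tau>1 y) z\<bar> \<le> \<delta> * T powr (-11/20)"

lemma pdist_scale: "0 < r \<Longrightarrow> pdist (p + dil r y) (p + dil r z) = r * pdist y z"
proof -
  assume r: "0 < r"
  have 1: "sqrt \<bar>r\<^sup>2 * fst y - r\<^sup>2 * fst z\<bar> = r * sqrt \<bar>fst y - fst z\<bar>"
    using r by (simp add: abs_mult real_sqrt_mult flip: right_diff_distrib)
  have 2: "infnorm (r *\<^sub>R snd y - r *\<^sub>R snd z) = r * infnorm (snd y - snd z)"
    using r by (simp add: infnorm_mul flip: scaleR_right_diff_distrib)
  show ?thesis using r by (simp add: pdist_def dil_def 1 2 max_mult_distrib_left)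
qed

lemma dil_in_Qc: "0 < r \<Longrightarrow> 0 \<le> s \<Longrightarrow> p + dil r y \<in> past_cyl (p + dil r z) (r * s) \<longleftrightarrow> y \<in> past_cyl z s"
  by (subst (1 2) past_cyl_iff) (auto simp: pdist_scale, auto simp: dil_def)

text \<open>This is where subcriticality enters: the positive power \<open>k\<close> produced by the
  rescaling outweighs a negative exponent \<open>a\<close>.\<close>

lemma scale_powr:
  assumes "0 < r" "r \<le> 1" "0 \<le> d" "0 \<le> real k + a"
  shows "r ^ k * (r * d) powr a \<le> d powr a"
proof -
  have "r ^ k * (r * d) powr a = r powr (real k + a) * d powr a"
    using assms by (simp add: powr_mult powr_add powr_realpow)
  also have "\<dots> \<le> 1 * d powr a" using assms by (intro mult_right_mono powr_le1) auto
  finally show ?thesis by simp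
qed

lemma vrem_scale:
  assumes "C12 v" "C12 Y2" "C12 Y3"
  shows "vrem (\<lambda>z. r * v (p + dil r z)) (\<lambda>z. Y2 (p + dil r z)) (\<lambda>z. r * Y3 (p + dil r z)) y z
    = r * vrem v Y2 Y3 (p + dil r y) (p + dil r z)"
proof -
  have d2: "pdv (ex_dir i) (\<lambda>z. Y2 (p + dil r z)) z = r * pdv (ex_dir i) Y2 (p + dil r z)" for i z
    using C12_scale(3)[OF assms(2), of i 1 p r z] by simp
  have n: "vgrad (\<lambda>z. r * v (p + dil r z)) (\<lambda>z. Y2 (p + dil r z)) (\<lambda>z. r * Y3 (p + dil r z)) i z = r * (r * vgrad v Y2 Y3 i (p + dil r z))" for i
    unfolding vgrad_def C12_scale(3)[OF assms(1)] C12_scale(3)[OF assms(3)] d2 by (simp add: algebra_simps)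
  have s: "snd (p + dil r y - (p + dil r z)) $ i = r * snd (y - z) $ i" for i
    by (simp add: dil_def algebra_simps)
  show ?thesis unfolding vrem_def vinc_def n s by (simp add: algebra_simps sum_distrib_left)
qed

text \<open>The weights keep the three equations invariant: \<open>Y2\<close> gets none,
  \<open>v\<close>, \<open>Y3\<close> and \<open>\<tau>1\<close> get one power of \<open>r\<close>,
  \<open>\<tau>2\<close> and the constant get two, \<open>\<tau>3\<close> gets three. In
  \<open>moll\<close> the number \<open>k\<close> counts the powers that are left after undoing the
  substitution; with the first moment of \<open>\<tau>2\<close> one of the two powers is used up by
  the space coordinate, hence \<open>k=1\<close> there.\<close>

lemma (in pde) rescale:
  assumes r: "0 < r" "r \<le> 1" and R': "0 \<le> R'" and sub: "past_cyl p (r * R') \<subseteq> past_cyl 0 R"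
  shows "pde \<Phi> \<delta> R' (\<lambda>z. r * v (p + dil r z)) (\<lambda>z. Y2 (p + dil r z)) (\<lambda>z. r * Y3 (p + dil r z))
    (\<lambda>z. r * \<tau>1 (p + dil r z)) (\<lambda>z. r\<^sup>2 * \<tau>2 (p + dil r z)) (\<lambda>z. r^3 * \<tau>3 (p + dil r z)) (r\<^sup>2 * C)"
proof -
  have inQ: "p + dil r z \<in> past_cyl 0 R" if "z \<in> past_cyl 0 R'" for z
  proof -
    have "p + dil r z \<in> past_cyl (p + dil r 0) (r * R')" using that r R' by (subst dil_in_Qc) auto
    also have "p + dil r 0 = p" by (simp add: dil_def zero_prod_def[symmetric])
    finally show ?thesis using sub by blast
  qed
  have cS: "continuous_on UNIV (\<lambda>z. f (p + dil r z))" if "continuous_on UNIV f" for f :: "pt \<Rightarrow> real"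
    by (intro continuous_on_compose2[OF that] continuous_intros) auto
  have rT: "0 < r * T" "r * T < 1" if "0 < T" "T < 1" for T using that r by (auto simp: mult_less_cancel_left2 mult_le_one intro: le_less_trans[of _ T] mult_left_le_one_le)
  have c: "continuous_on UNIV v" "continuous_on UNIV Y2" "continuous_on UNIV Y3" using reg C12D(1) by blast+
  have moll: "\<bar>conv (PsiT \<Phi> T) g z\<bar> \<le> \<delta> * T powr a"
    if z: "z \<in> past_cyl 0 R'" and T: "0 < T" "T < 1" and g: "\<And>y. g y = r ^ k * F (p + dil r y)" and F: "continuous_on UNIV F"
      and b: "\<bar>conv (PsiT \<Phi> (r * T)) F (p + dil r z)\<bar> \<le> \<delta> * (r * T) powr a" and ka: "0 \<le> real k + a" for g F T z a k
  proof -
    have "g = (\<lambda>y. r ^ k * F (p + dil r y))" using g by (rule ext)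
    then have "conv (PsiT \<Phi> T) g z = r ^ k * conv (PsiT \<Phi> (r * T)) F (p + dil r z)"
      using conv_cmult[OF bump_cont_csupp[OF PsiT_bump[OF ker T(1)]] cS[OF F], of "r ^ k" z] mollify_scale[OF ker r(1) T(1) F, of p z] by simp
    then have "\<bar>conv (PsiT \<Phi> T) g z\<bar> \<le> r ^ k * (\<delta> * (r * T) powr a)"
      using r b by (simp add: abs_mult mult_left_mono)
    also have "\<dots> = \<delta> * (r ^ k * (r * T) powr a)" by simp
    also have "\<dots> \<le> \<delta> * T powr a" using del T r ka by (intro mult_left_mono scale_powr) auto
    finally show ?thesis .
  qed
  note ct = continuous_on_add continuous_on_mult continuous_on_diff continuous_on_const reg c
  show ?thesis
  proof
    show "C12 (\<lambda>z. r * v (p + dil r z))" "C12 (\<lambda>z. r * Y3 (p + dil r z))" using C12_scale(1) reg by blast+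
    show "C12 (\<lambda>z. Y2 (p + dil r z))" using C12_scale(1)[OF reg(2), of 1 p r] by simp
    show "continuous_on UNIV (\<lambda>z. r * \<tau>1 (p + dil r z))" "continuous_on UNIV (\<lambda>z. r\<^sup>2 * \<tau>2 (p + dil r z))" "continuous_on UNIV (\<lambda>z. r^3 * \<tau>3 (p + dil r z))"
      by (intro continuous_intros cS reg)+
    fix z assume z: "z \<in> past_cyl 0 R'"
    note zQ = inQ[OF z]
    show "heat_op (\<lambda>z. r * v (p + dil r z)) z = - ((r * v (p + dil r z)) ^ 3) - 3 * (r * v (p + dil r z))\<^sup>2 * (r * \<tau>1 (p + dil r z)) -
         3 * (r * v (p + dil r z)) * (r\<^sup>2 * \<tau>2 (p + dil r z)) - r ^ 3 * \<tau>3 (p + dil r z) -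
         9 * (r\<^sup>2 * C) * (r * v (p + dil r z) + r * \<tau>1 (p + dil r z))"
      unfolding C12_scale(4)[OF reg(1)] eqv[OF zQ] by (simp add: algebra_simps power2_eq_square power3_eq_cube)
    show "heat_op (\<lambda>z. Y2 (p + dil r z)) z = r\<^sup>2 * \<tau>2 (p + dil r z)"
      using C12_scale(4)[OF reg(2), of 1 p r z] eq2[OF zQ] by simp
    show "heat_op (\<lambda>z. r * Y3 (p + dil r z)) z = r ^ 3 * \<tau>3 (p + dil r z)"
      unfolding C12_scale(4)[OF reg(3)] eq3[OF zQ] by (simp add: power2_eq_square power3_eq_cube)
    have "r * \<bar>v (p + dil r z)\<bar> \<le> 1 * 2" using r vb[OF zQ] by (intro mult_mono) auto
    then show "\<bar>r * v (p + dil r z)\<bar> \<le> 2" using r by (simp add: abs_mult)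
  next
    fix y z :: pt assume d: "pdist y z \<le> 1"
    have d': "pdist (p + dil r y) (p + dil r z) = r * pdist y z" by (rule pdist_scale[OF r(1)])
    have "r * pdist y z \<le> 1 * 1" using r d by (intro mult_mono) auto
    then have le: "pdist (p + dil r y) (p + dil r z) \<le> 1" unfolding d' by simp
    have "\<delta> * (r ^ 0 * (r * pdist y z) powr (19/20)) \<le> \<delta> * pdist y z powr (19/20)"
      using del r by (intro mult_left_mono scale_powr) auto
    then show "\<bar>Y2 (p + dil r y) - Y2 (p + dil r z)\<bar> \<le> \<delta> * pdist y z powr (19/20)" using Y2h[OF le] d' by simp
    have "\<delta> * (r ^ 1 * (r * pdist y z) powr (9/20)) \<le> \<delta> * pdist y z powr (9/20)"
      using del r by (intro mult_left_mono scale_powr) auto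
    moreover have "\<bar>r * Y3 (p + dil r y) - r * Y3 (p + dil r z)\<bar> = r * \<bar>Y3 (p + dil r y) - Y3 (p + dil r z)\<bar>"
      using r by (simp add: abs_mult flip: right_diff_distrib)
    moreover have "\<dots> \<le> r * (\<delta> * (r * pdist y z) powr (9/20))" using Y3h[OF le] r d' by (intro mult_left_mono) auto
    ultimately show "\<bar>r * Y3 (p + dil r y) - r * Y3 (p + dil r z)\<bar> \<le> \<delta> * pdist y z powr (9/20)" by (simp add: mult_ac)
  next
    fix z :: pt and T :: real assume z: "z \<in> past_cyl 0 R'" and T: "0 < T" "T < 1"
    let ?S = "\<lambda>y. p + dil r y"
    have sc: "snd (?S y - ?S z) $ i = r * snd (y - z) $ i" for y i by (simp add: dil_def algebra_simps)
    show "\<bar>conv (PsiT \<Phi> T) (\<lambda>z. r * \<tau>1 (?S z)) z\<bar> \<le> \<delta> * T powr (- 11 / 20)"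
      by (rule moll[OF z T, where k=1 and F=\<tau>1]) (use n1[OF inQ[OF z] rT[OF T]] reg in auto)
    show "\<bar>conv (PsiT \<Phi> T) (\<lambda>z. r\<^sup>2 * \<tau>2 (?S z)) z\<bar> \<le> \<delta> * T powr (- 21 / 20)"
      by (rule moll[OF z T, where k=2 and F=\<tau>2]) (use n2[OF inQ[OF z] rT[OF T]] reg in auto)
    show "\<bar>conv (PsiT \<Phi> T) (\<lambda>z. r^3 * \<tau>3 (?S z)) z\<bar> \<le> \<delta> * T powr (- 31 / 20)"
      by (rule moll[OF z T, where k=3 and F=\<tau>3]) (use n3[OF inQ[OF z] rT[OF T]] reg in auto)
    show "\<bar>conv (PsiT \<Phi> T) (\<lambda>y. snd (y - z) $ i * (r\<^sup>2 * \<tau>2 (?S y))) z\<bar> \<le> \<delta> * T powr (- 1 / 20)" for i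
    proof (rule moll[OF z T, where k=1 and F="\<lambda>w. snd (w - ?S z) $ i * \<tau>2 w"])
      show "snd (y - z) $ i * (r\<^sup>2 * \<tau>2 (?S y)) = r ^ 1 * (snd (?S y - ?S z) $ i * \<tau>2 (?S y))" for y
        unfolding sc by (simp add: power2_eq_square)
      show "continuous_on UNIV (\<lambda>w. snd (w - ?S z) $ i * \<tau>2 w)" by (intro continuous_intros reg)
    qed (use n6[OF inQ[OF z] rT[OF T]] in auto)
    show "\<bar>conv (PsiT \<Phi> T) (\<lambda>y. (Y2 (?S y) - Y2 (?S z)) * (r\<^sup>2 * \<tau>2 (?S y)) - r\<^sup>2 * C) z\<bar> \<le> \<delta> * T powr (- 1 / 20)"
      by (rule moll[OF z T, where k=2 and F="\<lambda>w. (Y2 w - Y2 (?S z)) * \<tau>2 w - C"])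
         (use n7[OF inQ[OF z] rT[OF T]] in \<open>auto intro!: ct simp: algebra_simps\<close>)
    show "\<bar>conv (PsiT \<Phi> T) (\<lambda>y. (r * Y3 (?S y) - r * Y3 (?S z)) * (r * \<tau>1 (?S y))) z\<bar> \<le> \<delta> * T powr (- 1 / 20)"
      by (rule moll[OF z T, where k=2 and F="\<lambda>w. (Y3 w - Y3 (?S z)) * \<tau>1 w"])
         (use n8[OF inQ[OF z] rT[OF T]] in \<open>auto intro!: ct simp: algebra_simps power2_eq_square\<close>)
    show "\<bar>conv (PsiT \<Phi> T) (\<lambda>y. (r * Y3 (?S y) - r * Y3 (?S z)) * (r\<^sup>2 * \<tau>2 (?S y)) - 3 * (r\<^sup>2 * C) * (r * \<tau>1 (?S y))) z\<bar> \<le> \<delta> * T powr (- 11 / 20)"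
      by (rule moll[OF z T, where k=3 and F="\<lambda>w. (Y3 w - Y3 (?S z)) * \<tau>2 w - 3 * C * \<tau>1 w"])
         (use n9[OF inQ[OF z] rT[OF T]] in \<open>auto intro!: ct simp: algebra_simps power2_eq_square power3_eq_cube\<close>)
  qed (use ker del in auto)
qed

section \<open>Reconstruction and the local expansion\<close>

text \<open>Since $\<Psi>_{2S} = \<Phi>_S * \<Psi>_S$, passing from scale $S$ to scale $2S$ only costs the
change of base point in the germ; these errors form a geometric series.\<close>

lemma reconstruction:
  assumes k: "kernel \<Phi>" and T: "0 < T" and M: "0 \<le> M" and cF: "continuous_on UNIV (\<lambda>(z, y). F z y)" and F0: "\<And>z. F z z = 0"
    and H: "\<And>S z w. 0 < S \<Longrightarrow> S \<le> T / 2 \<Longrightarrow> z \<in> past_cyl z0 (T - 2 * S) \<Longrightarrow> w \<in> past_cyl z S \<Longrightarrow>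
      \<bar>conv (PsiT \<Phi> S) (\<lambda>y. F z y - F w y) w\<bar> \<le> M * S powr (1/5)"
  shows "\<bar>conv (PsiT \<Phi> T) (F z0) z0\<bar> \<le> 7 * M * T powr (1/5)"
proof -
  have c: "continuous_on UNIV (F z)" for z
  proof -
    have "continuous_on UNIV (\<lambda>y. (z, y))" by (intro continuous_on_Pair continuous_on_const continuous_on_id)
    from continuous_on_compose2[OF cF this] show ?thesis by simp
  qed
  define J where "J = (\<lambda>S z. conv (PsiT \<Phi> S) (F z) z)"
  \<comment> \<open>It suffices that (7/8)^5 >= 1/2. The constant 7 solves c = (1 + c) * 7/8, so
    that the error at one scale plus the accumulated error at half the scale reproduces the same
    bound.\<close>
  have q: "(S/2) powr (1/5) \<le> 7/8 * S powr (1/5)" if "0 < S" for S :: real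
  proof -
    have "((1/2::real) powr (1/5))^5 = 1/2" by (simp add: powr_power)
    then have "((1/2::real) powr (1/5))^5 \<le> (7/8)^5" by (simp add: eval_nat_numeral)
    then have "(1/2::real) powr (1/5) \<le> 7/8" using power_le_imp_le_base[of _ 4 "7/8::real"] by simp
    then have "(1/2::real) powr (1/5) * S powr (1/5) \<le> 7/8 * S powr (1/5)" by (intro mult_right_mono) auto
    moreover have "(S/2) powr (1/5) = (1/2::real) powr (1/5) * S powr (1/5)" using powr_mult[of "1/2" S "1/5"] that by simp
    ultimately show ?thesis by simp
  qed
  \<comment> \<open>The index \<open>j\<close> counts the halvings down to the finest scale. Base
    points may wander, but at scale \<open>S\<close> they stay in
    \<open>past_cyl z0 (T - S)\<close>, so all of them together remain in
    \<open>past_cyl z0 T\<close>.\<close>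
  have ind: "\<bar>J S z\<bar> \<le> B + 7 * M * S powr (1/5)"
    if "0 < S" "S \<le> T" "z \<in> past_cyl z0 (T - S)" "\<And>w. w \<in> past_cyl z0 T \<Longrightarrow> \<bar>J (S / 2^j) w\<bar> \<le> B" for j S z B
    using that
  proof (induction j arbitrary: S z)
    case 0
    have "z \<in> past_cyl z0 T" using past_cyl_mono[of "T - S" T z0] 0 by auto
    then show ?case using 0(4)[of z] M by (simp add: add_increasing2)
  next
    case (Suc j)
    have S2: "0 < S / 2" using Suc by simp
    have "J S z = conv (PhiT \<Phi> (S / 2)) (conv (PsiT \<Phi> (S / 2)) (F z)) z"
      unfolding J_def by (rule mollify_semigroup[OF k Suc(2) c])
    also have "\<bar>\<dots>\<bar> \<le> M * (S/2) powr (1/5) + (B + 7 * M * (S/2) powr (1/5))"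
    proof (rule conv_bound[OF PhiT_bump[OF kernel_bump[OF k] S2]])
      show "continuous_on UNIV (conv (PsiT \<Phi> (S / 2)) (F z))"
        by (rule continuous_conv[OF bump_cont_csupp[OF PsiT_bump[OF k S2]] c])
      fix y assume "y \<in> supp_box (S / 2)"
      then have w: "z - y \<in> past_cyl z (S / 2)" by (simp add: supp_box_Qc[of y _ z])
      define w where "w = z - y"
      have "w \<in> past_cyl z0 (S / 2 + (T - S))" using past_cyl_trans[OF w Suc(4)] Suc(2,3) by (auto simp: w_def)
      then have wQ: "w \<in> past_cyl z0 (T - S / 2)" by (simp add: algebra_simps)
      have "\<bar>J (S / 2) w\<bar> \<le> B + 7 * M * (S/2) powr (1/5)"
        by (rule Suc.IH[OF S2 _ wQ]) (use Suc in auto)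
      moreover have "\<bar>conv (PsiT \<Phi> (S/2)) (\<lambda>y. F z y - F w y) w\<bar> \<le> M * (S/2) powr (1/5)"
        by (rule H[OF S2]) (use Suc w in \<open>auto simp: w_def\<close>)
      moreover have "conv (PsiT \<Phi> (S/2)) (\<lambda>y. F z y - F w y) w = conv (PsiT \<Phi> (S/2)) (F z) w - J (S/2) w"
        unfolding J_def by (rule conv_diff[OF bump_cont_csupp[OF PsiT_bump[OF k S2]] c c])
      ultimately show "\<bar>conv (PsiT \<Phi> (S/2)) (F z) (z - y)\<bar> \<le> M * (S/2) powr (1/5) + (B + 7 * M * (S/2) powr (1/5))"
        by (simp add: w_def)
    qed
    also have "\<dots> = B + M * (8 * (S/2) powr (1/5))" by (simp add: algebra_simps)
    also have "\<dots> \<le> B + M * (7 * S powr (1/5))" using q[OF Suc(2)] M by (intro add_left_mono mult_left_mono) auto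
    finally show ?case by simp
  qed
  \<comment> \<open>At a fine scale the germ is tested next to its own base point, where it vanishes
    by \<open>F0\<close>; uniform continuity on a compact set makes this initial term
    \<open>B\<close> at most \<open>e\<close>.\<close>
  show ?thesis
  proof (rule field_le_epsilon)
    fix e :: real assume e: "0 < e"
    define G where "G = (\<lambda>(w, y). F w (w - y))"
    have "continuous_on UNIV G" unfolding G_def split_beta
    proof -
      have "continuous_on UNIV (\<lambda>p::pt \<times> pt. (fst p, fst p - snd p))" by (intro continuous_intros)
      from continuous_on_compose2[OF cF this] show "continuous_on UNIV (\<lambda>p. F (fst p) (fst p - snd p))" by simp
    qed
    then have "uniformly_continuous_on (past_cyl z0 T \<times> supp_box T) G"
      by (intro compact_uniformly_continuous compact_Times past_cyl_compact) (auto intro: continuous_on_subset simp: supp_box_def)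
    then obtain d where d: "d > 0" "\<And>x x'. x \<in> past_cyl z0 T \<times> supp_box T \<Longrightarrow> x' \<in> past_cyl z0 T \<times> supp_box T \<Longrightarrow> dist x' x < d \<Longrightarrow> dist (G x') (G x) < e"
      unfolding uniformly_continuous_on_def using e by blast
    obtain j where j: "(1/2::real)^j < min 1 (d/3) / T"
      using real_arch_pow_inv[of "min 1 (d/3) / T" "1/2"] d T by auto
    define S where "S = T / 2^j"
    have S: "0 < S" "S \<le> T" "S < 1" "S < d/3"
      using T j one_le_power[of "2::real" j] by (auto simp: S_def field_simps)
    have "\<bar>J S w\<bar> \<le> e" if w: "w \<in> past_cyl z0 T" for w
      unfolding J_def
    proof (rule conv_bound[OF PsiT_bump[OF k S(1)] c])
      fix y assume y: "y \<in> supp_box S"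
      have "S\<^sup>2 \<le> T\<^sup>2" using S by (intro power_mono) auto
      with y S have yT: "y \<in> supp_box T" unfolding mem_supp_box by linarith
      have "norm y \<le> S\<^sup>2 + 2 * S" using norm_supp_box[OF y] S by simp
      also have "\<dots> \<le> S + 2 * S" using S by (simp add: power2_eq_square mult_left_le)
      finally have "dist (w, y) (w, 0) < d" using S by (simp add: dist_Pair_Pair dist_norm)
      moreover have "0 \<in> supp_box T" using T by (simp add: mem_supp_box infnorm_0)
      ultimately have "dist (G (w, y)) (G (w, 0)) < e" using w yT by (intro d(2)) auto
      then show "\<bar>F w (w - y)\<bar> \<le> e" by (simp add: G_def F0 dist_real_def)
    qed
    then have "\<bar>J T z0\<bar> \<le> e + 7 * M * T powr (1/5)"
      by (intro ind[where j=j]) (use T past_cyl_center[of 0 z0] in \<open>auto simp: S_def\<close>)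
    then show "\<bar>conv (PsiT \<Phi> T) (F z0) z0\<bar> \<le> 7 * M * T powr (1/5) + e" by (simp add: J_def)
  qed
qed

lemma mult_powr_bound:
  fixes A B :: real
  assumes "\<bar>A\<bar> \<le> a * S powr p" "\<bar>B\<bar> \<le> b * S powr q" "c \<le> p + q" "0 < S" "S \<le> 1" "0 \<le> a" "0 \<le> b"
  shows "\<bar>A * B\<bar> \<le> a * b * S powr c"
proof -
  have "\<bar>A * B\<bar> \<le> (a * S powr p) * (b * S powr q)"
    unfolding abs_mult by (intro mult_mono assms) (use assms in auto)
  also have "\<dots> = a * b * S powr (p + q)" by (simp add: powr_add)
  also have "\<dots> \<le> a * b * S powr c" using assms by (intro mult_left_mono powr_le_powr) auto
  finally show ?thesis .
qed

lemma sum_axis: "(\<Sum>j\<in>UNIV. a j * snd (s *\<^sub>R ex_dir i) $ j) = a i * s"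
  by (simp add: ex_dir_def axis_def if_distrib cong: if_cong)

text \<open>Change of base point from \<open>z\<close> to \<open>w\<close>. The two expansions
  differ by a constant, a multiple of the increment of \<open>Y2\<close> and a linear term, whose
  coefficients are themselves increments between \<open>z\<close> and \<open>w\<close>. Both the
  continuity of the gradient and the first reconstruction rest on this identity.\<close>

lemma vrem_three:
  "vrem v Y2 Y3 y z - vrem v Y2 Y3 y w = vrem v Y2 Y3 w z + 3 * (v z - v w) * (Y2 y - Y2 w)
     - (\<Sum>i\<in>UNIV. (vgrad v Y2 Y3 i z - vgrad v Y2 Y3 i w) * snd (y - w) $ i)"
proof -
  have "(\<Sum>i\<in>UNIV. vgrad v Y2 Y3 i z * snd (y - z) $ i) = (\<Sum>i\<in>UNIV. vgrad v Y2 Y3 i z * snd (y - w) $ i) + (\<Sum>i\<in>UNIV. vgrad v Y2 Y3 i z * snd (w - z) $ i)"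
    by (simp add: sum.distrib[symmetric] algebra_simps)
  then show ?thesis unfolding vrem_def vinc_def by (simp add: algebra_simps sum_subtractf sum.distrib)
qed

lemma vrem_self: "vrem v Y2 Y3 z z = 0" by (simp add: vrem_def vinc_def)

text \<open>The unit-size situation with the remainder bound assumed. Base points in the half
  cylinder and increments up to 1/4 leave room for all kernels below; \<open>N1\<close> lets
  absolute constants be absorbed into multiples of \<open>N\<close>.\<close>

locale local_pde = pde \<Phi> \<delta> 1 v Y2 Y3 \<tau>1 \<tau>2 \<tau>3 C for \<Phi> \<delta> v Y2 Y3 \<tau>1 \<tau>2 \<tau>3 C +
  fixes N :: real
  assumes N1: "1 \<le> N"
    and HN: "\<And>z y. z \<in> past_cyl 0 (1/2) \<Longrightarrow> y \<in> past_cyl z (1/4) \<Longrightarrow> \<bar>vrem v Y2 Y3 y z\<bar> \<le> N * pdist y z powr (5/4)"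
begin

abbreviation "uh \<equiv> vrem v Y2 Y3"
abbreviation "n \<equiv> vgrad v Y2 Y3"

text \<open>Here 11 = 2 + 2 + 1 + 6, from the two values of \<open>v\<close>, from \<open>Y3\<close>
  and from the \<open>Y2\<close> term. The bound does not involve \<open>N\<close>, which makes the
  interpolation in \<open>nu_sigma\<close> worthwhile.\<close>

lemma U_bd: assumes "y \<in> past_cyl 0 1" "z \<in> past_cyl 0 1" "pdist y z \<le> 1" shows "\<bar>vinc v Y2 Y3 y z\<bar> \<le> 11"
proof -
  have p1: "\<delta> * pdist y z powr a \<le> 1" if "0 \<le> a" for a
    using mult_mono[of \<delta> 1 "pdist y z powr a" 1] del assms(3) that by (simp add: powr_le1)
  have "\<bar>Y3 y - Y3 z\<bar> \<le> 1" "\<bar>Y2 y - Y2 z\<bar> \<le> 1"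
    using Y3h[OF assms(3)] Y2h[OF assms(3)] p1[of "9/20"] p1[of "19/20"] by auto
  moreover have "\<bar>3 * v z * (Y2 y - Y2 z)\<bar> \<le> 6 * 1"
    unfolding abs_mult by (rule mult_mono) (use vb[OF assms(2)] calculation in auto)
  ultimately show ?thesis using vb[OF assms(1)] vb[OF assms(2)] unfolding vinc_def by linarith
qed

text \<open>Along one axis step the linear term is the increment minus the remainder. After division
  by \<open>\<sigma>\<close> this interpolates: a small step makes the part proportional to
  \<open>N\<close> small, at the price of \<open>11 / \<sigma>\<close>.\<close>

lemma nu_sigma:
  assumes z: "z \<in> past_cyl 0 (1/2)" and s: "0 < \<sigma>" "\<sigma> \<le> 1/4"
  shows "\<bar>n i z\<bar> * \<sigma> \<le> N * \<sigma> powr (5/4) + 11"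
proof -
  let ?y = "z + \<sigma> *\<^sub>R ex_dir i"
  have d: "pdist ?y z = \<sigma>" using s by (simp add: pdist_ex)
  have yz: "?y \<in> past_cyl z (1/4)" using ex_in_Qc[of z \<sigma> i] past_cyl_mono[of "\<bar>\<sigma>\<bar>" "1/4" z] s by auto
  have "?y \<in> past_cyl 0 1" "z \<in> past_cyl 0 1"
    using past_cyl_sub[OF z, of "1/4" 1] yz past_cyl_mono[of "1/2" 1 0] z by auto
  then have "\<bar>vinc v Y2 Y3 ?y z\<bar> \<le> 11" using d s by (intro U_bd) auto
  moreover have "uh ?y z = vinc v Y2 Y3 ?y z - n i z * \<sigma>" unfolding vrem_def using sum_axis[of "\<lambda>j. n j z" \<sigma> i] by simp
  ultimately have "\<bar>n i z * \<sigma>\<bar> \<le> N * \<sigma> powr (5/4) + 11" using HN[OF z yz] d by simp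
  then show ?thesis using s by (simp add: abs_mult)
qed

lemma nu_bound: assumes z: "z \<in> past_cyl 0 (1/2)" shows "\<bar>n i z\<bar> \<le> 48 * N"
proof -
  have "\<bar>n i z\<bar> * (1/4) \<le> N * (1/4) powr (5/4) + 11" by (rule nu_sigma[OF z]) auto
  moreover have "N * (1/4) powr (5/4) \<le> N * 1" using N1 by (intro mult_left_mono powr_le1) auto
  ultimately show ?thesis using N1 by linarith
qed

lemma nu_sum_bound:
  assumes z: "z \<in> past_cyl 0 (1/2)" shows "\<bar>\<Sum>i\<in>UNIV. n i z * snd (y - z) $ i\<bar> \<le> 144 * N * pdist y z"
  using sum_comp_bound[of "\<lambda>i. n i z" "48 * N" "\<lambda>i. snd (y - z) $ i" "pdist y z", OF nu_bound[OF z] pdist_comp] by simp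

text \<open>The roughness of \<open>v\<close> is that of \<open>- Y3\<close>: adding
  \<open>Y3\<close> raises the order from 9/20 to 19/20. The number 145 is 1 for the remainder plus
  144 for the linear term.\<close>

lemma dv_Y3:
  assumes z: "z \<in> past_cyl 0 (1/2)" and y: "y \<in> past_cyl z (1/4)"
  shows "\<bar>v y - v z + (Y3 y - Y3 z)\<bar> \<le> 145 * N * pdist y z + 6 * \<delta> * pdist y z powr (19/20)"
proof -
  have d: "pdist y z \<le> 1/4" using y by (simp add: past_cyl_iff)
  have "N * pdist y z powr (5/4) \<le> N * pdist y z powr 1" using d N1 by (intro mult_left_mono powr_le_powr) auto
  then have "\<bar>uh y z\<bar> \<le> N * pdist y z" using HN[OF z y] by simp
  moreover have "z \<in> past_cyl 0 1" using z past_cyl_mono[of "1/2" 1 0] by auto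
  then have "\<bar>v z\<bar> \<le> 2" by (rule vb)
  then have "\<bar>3 * v z * (Y2 y - Y2 z)\<bar> \<le> 6 * (\<delta> * pdist y z powr (19/20))"
    unfolding abs_mult by (intro mult_mono Y2h) (use d in auto)
  moreover have "v y - v z + (Y3 y - Y3 z) = uh y z + (\<Sum>i\<in>UNIV. n i z * snd (y - z) $ i) - 3 * v z * (Y2 y - Y2 z)"
    by (simp add: vrem_def vinc_def)
  ultimately show ?thesis using nu_sum_bound[OF z, of y] by linarith
qed

text \<open>The rough part with factor \<open>\<delta>\<close> and the Lipschitz part with factor
  \<open>N\<close> are kept apart, because this bound is going to be squared and the two parts are
  then treated differently.\<close>

lemma dv1:
  assumes z: "z \<in> past_cyl 0 (1/2)" and y: "y \<in> past_cyl z (1/4)"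
  shows "\<bar>v y - v z\<bar> \<le> 7 * \<delta> * pdist y z powr (9/20) + 145 * N * pdist y z"
proof -
  have d: "pdist y z \<le> 1/4" using y by (simp add: past_cyl_iff)
  have "\<delta> * pdist y z powr (19/20) \<le> \<delta> * pdist y z powr (9/20)" using d del by (intro mult_left_mono powr_le_powr) auto
  then show ?thesis using dv_Y3[OF assms] Y3h[of y z] d by simp
qed

lemma dv2:
  assumes z: "z \<in> past_cyl 0 (1/2)" and y: "y \<in> past_cyl z (1/4)"
  shows "\<bar>v y - v z\<bar> \<le> 152 * N * pdist y z powr (9/20)"
proof -
  have d: "pdist y z \<le> 1/4" using y by (simp add: past_cyl_iff)
  have "145 * N * pdist y z powr 1 \<le> 145 * N * pdist y z powr (9/20)" using d N1 by (intro mult_left_mono powr_le_powr) auto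
  moreover have "7 * \<delta> * pdist y z powr (9/20) \<le> 7 * N * pdist y z powr (9/20)" using del N1 by (intro mult_right_mono) auto
  ultimately show ?thesis using dv1[OF assms] by simp
qed

text \<open>With \<open>d\<close> the distance of \<open>w\<close> and \<open>z\<close>, the
  identity \<open>vrem_three\<close> is read at a point one axis step of length \<open>d\<close>
  away from \<open>w\<close>. All other terms are of order \<open>d powr (5/4)\<close>, and division
  by \<open>d\<close> leaves the exponent 1/4. The constant is 1 + 1 + 3 + 456, where the 3 accounts
  for the doubled distance from \<open>y\<close> to \<open>z\<close>.\<close>

lemma dnu:
  assumes z: "z \<in> past_cyl 0 (3/8)" and w: "w \<in> past_cyl z (1/8)"
  shows "\<bar>n i z - n i w\<bar> \<le> 461 * N * pdist w z powr (1/4)"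
proof (cases "w = z")
  case False
  define d where "d = pdist w z"
  have d: "0 < d" "d \<le> 1/8" using False w by (auto simp: d_def pdist_pos past_cyl_iff)
  have z': "z \<in> past_cyl 0 (1/2)" using z past_cyl_mono[of "3/8" "1/2" 0] by auto
  have w': "w \<in> past_cyl 0 (1/2)" using past_cyl_sub[OF z, of "1/8" "1/2"] w by auto
  have w4: "w \<in> past_cyl z (1/4)" using w past_cyl_mono[of "1/8" "1/4" z] by auto
  define y where "y = w + d *\<^sub>R ex_dir i"
  have yw: "pdist y w = d" using d by (simp add: y_def pdist_ex)
  have y1: "y \<in> past_cyl w d" using ex_in_Qc[of w d i] d by (simp add: y_def)
  have "w \<in> past_cyl z d" using w by (simp add: d_def past_cyl_iff)
  from past_cyl_trans[OF y1 this] d have yz: "y \<in> past_cyl z (2 * d)" by simp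
  have yz4: "y \<in> past_cyl z (1/4)" using yz past_cyl_mono[of "2*d" "1/4" z] d by auto
  have yw4: "y \<in> past_cyl w (1/4)" using y1 past_cyl_mono[of d "1/4" w] d by auto
  have b1: "\<bar>uh w z\<bar> \<le> N * d powr (5/4)" using HN[OF z' w4] by (simp add: d_def)
  have b2: "\<bar>uh y w\<bar> \<le> N * d powr (5/4)" using HN[OF w' yw4] yw by simp
  have b3: "\<bar>uh y z\<bar> \<le> 3 * N * d powr (5/4)"
  proof -
    have "pdist y z \<le> 2 * d" using yz d by (simp add: past_cyl_iff)
    then have "pdist y z powr (5/4) \<le> (2 * d) powr (5/4)" by (intro powr_mono2) auto
    also have "\<dots> = 2 powr (5/4) * d powr (5/4)" using d by (simp add: powr_mult)
    also have "\<dots> \<le> 3 * d powr (5/4)"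
    proof (rule mult_right_mono)
      have "((2::real) powr (5/4))^4 = 2^5" by (simp add: powr_power)
      then have "((2::real) powr (5/4))^4 \<le> 3^4" by simp
      then show "(2::real) powr (5/4) \<le> 3" using power_le_imp_le_base[of _ 3 "3::real"] by simp
    qed simp
    finally have "N * pdist y z powr (5/4) \<le> N * (3 * d powr (5/4))" using N1 by (intro mult_left_mono) auto
    with HN[OF z' yz4] show ?thesis by simp
  qed
  have b4: "\<bar>3 * (v z - v w) * (Y2 y - Y2 w)\<bar> \<le> 456 * N * 1 * d powr (5/4)"
  proof (rule mult_powr_bound)
    show "\<bar>3 * (v z - v w)\<bar> \<le> 456 * N * d powr (9/20)"
      using dv2[OF z' w4] by (simp add: d_def abs_mult abs_minus_commute)
    have "\<delta> * d powr (19/20) \<le> 1 * d powr (19/20)" using del by (intro mult_right_mono) auto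
    then show "\<bar>Y2 y - Y2 w\<bar> \<le> 1 * d powr (19/20)" using Y2h[of y w] d unfolding yw by linarith
  qed (use d N1 in auto)
  have "(\<Sum>j\<in>UNIV. (n j z - n j w) * snd (y - w) $ j) = (n i z - n i w) * d"
    using sum_axis[of "\<lambda>j. n j z - n j w" d i] by (simp add: y_def)
  with vrem_three[of v Y2 Y3 y z w] b1 b2 b3 b4 have "\<bar>(n i z - n i w) * d\<bar> \<le> 461 * N * d powr (5/4)" by linarith
  also have "d powr (5/4) = d powr (1/4) * d" using d powr_add[of d "1/4" 1] by simp
  finally show ?thesis using d by (simp add: abs_mult d_def[symmetric])
qed simp

end

lemma pdist_powr_mono:
  assumes "\<bar>A\<bar> \<le> k * pdist w z powr a" "pdist w z \<le> S" "0 \<le> k" "0 \<le> a"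
  shows "\<bar>A\<bar> \<le> k * S powr a"
proof -
  have "k * pdist w z powr a \<le> k * S powr a" using assms by (intro mult_left_mono powr_mono2) auto
  with assms(1) show ?thesis by linarith
qed

lemma abs_triangle7:
  fixes a b c d e f g :: real
  assumes "\<bar>a\<bar> \<le> A" "\<bar>b\<bar> \<le> B" "\<bar>c\<bar> \<le> C" "\<bar>d\<bar> \<le> pdv'" "\<bar>e\<bar> \<le> E" "\<bar>f\<bar> \<le> F" "\<bar>g\<bar> \<le> G"
  shows "\<bar>a + b - c + d + e - f - g\<bar> \<le> A + B + C + pdv' + E + F + G"
  using assms by linarith

text \<open>Relational form of \<open>conv\<close>, bundling the side conditions of linearity, so
  that the convolution of a long linear combination can be assembled by
  \<open>intro\<close>.\<close>

definition has_conv :: "(pt \<Rightarrow> real) \<Rightarrow> pt \<Rightarrow> (pt \<Rightarrow> real) \<Rightarrow> real \<Rightarrow> bool" where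
  "has_conv \<psi> z f I \<longleftrightarrow> cont_csupp \<psi> \<and> continuous_on UNIV f \<and> conv \<psi> f z = I"

lemma has_conv_add: "has_conv \<psi> z f I \<Longrightarrow> has_conv \<psi> z g J \<Longrightarrow> has_conv \<psi> z (\<lambda>y. f y + g y) (I + J)"
  by (simp add: has_conv_def conv_add continuous_on_add)
lemma has_conv_diff: "has_conv \<psi> z f I \<Longrightarrow> has_conv \<psi> z g J \<Longrightarrow> has_conv \<psi> z (\<lambda>y. f y - g y) (I - J)"
  by (simp add: has_conv_def conv_diff continuous_on_diff)
lemma has_conv_cmult: "has_conv \<psi> z f I \<Longrightarrow> has_conv \<psi> z (\<lambda>y. c * f y) (c * I)"
  by (simp add: has_conv_def conv_cmult continuous_on_mult)
lemma has_conv_sum: "(\<And>i. has_conv \<psi> z (f i) (I i)) \<Longrightarrow> has_conv \<psi> z (\<lambda>y. \<Sum>i\<in>(UNIV::3 set). f i y) (\<Sum>i\<in>UNIV. I i)"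
  unfolding sum_3 by (intro has_conv_add) auto
lemma has_convI: "cont_csupp \<psi> \<Longrightarrow> continuous_on UNIV f \<Longrightarrow> has_conv \<psi> z f (conv \<psi> f z)"
  by (simp add: has_conv_def)
lemma has_convD: "has_conv \<psi> z f I \<Longrightarrow> conv \<psi> f z = I" by (simp add: has_conv_def)

lemma affine_C12:
  shows "C12 (\<lambda>y. \<Sum>i\<in>UNIV. a i * snd (y - p) $ i)" (is "C12 ?f")
    and "heat_op (\<lambda>y. \<Sum>i\<in>UNIV. a i * snd (y - p) $ i) z = 0"
proof -
  have 1: "has_pdv et_dir ?f (\<lambda>_. 0)" by (simp add: has_pdv_def et_dir_def)
  have 2: "has_pdv (ex_dir j) ?f (\<lambda>_. a j)" for j
    unfolding has_pdv_def
  proof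
    fix z
    have "(\<Sum>i\<in>UNIV. a i * snd (z + s *\<^sub>R ex_dir j - p) $ i) = (\<Sum>i\<in>UNIV. a i * snd (z - p) $ i) + a j * s" for s
    proof -
      have "(\<Sum>i\<in>UNIV. a i * snd (z + s *\<^sub>R ex_dir j - p) $ i) = (\<Sum>i\<in>UNIV. a i * snd (z - p) $ i) + (\<Sum>i\<in>UNIV. a i * snd (s *\<^sub>R ex_dir j) $ i)"
        by (simp add: algebra_simps sum.distrib sum_subtractf)
      then show ?thesis by (simp only: sum_axis)
    qed
    then show "((\<lambda>s. \<Sum>i\<in>UNIV. a i * snd (z + s *\<^sub>R ex_dir j - p) $ i) has_real_derivative a j) (at 0)"
      by (auto intro!: derivative_eq_intros)
  qed
  have 3: "has_pdv (ex_dir j) (\<lambda>_. a i) (\<lambda>_. 0)" for i j by (simp add: has_pdv_def)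
  have c: "continuous_on UNIV ?f" by (intro continuous_intros)
  note C = C12I[OF c 1 continuous_on_const 2 continuous_on_const 3 continuous_on_const]
  show "C12 ?f" by (rule C(1))
  show "heat_op ?f z = 0" unfolding heat_op_def by (simp only: C(2,4)) simp
qed

context local_pde begin

lemma cont [continuous_intros]:
  "continuous_on S f \<Longrightarrow> continuous_on S (\<lambda>x. v (f x))" "continuous_on S f \<Longrightarrow> continuous_on S (\<lambda>x. Y2 (f x))"
  "continuous_on S f \<Longrightarrow> continuous_on S (\<lambda>x. Y3 (f x))" "continuous_on S f \<Longrightarrow> continuous_on S (\<lambda>x. \<tau>1 (f x))"
  "continuous_on S f \<Longrightarrow> continuous_on S (\<lambda>x. \<tau>2 (f x))" "continuous_on S f \<Longrightarrow> continuous_on S (\<lambda>x. \<tau>3 (f x))"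
  "continuous_on S f \<Longrightarrow> continuous_on S (\<lambda>x. n i (f x))"
proof -
  have nc: "continuous_on UNIV (n i)"
    unfolding vgrad_def[abs_def] using reg by (intro continuous_intros C12D) auto
  assume f: "continuous_on S f"
  show "continuous_on S (\<lambda>x. v (f x))" "continuous_on S (\<lambda>x. Y2 (f x))" "continuous_on S (\<lambda>x. Y3 (f x))" "continuous_on S (\<lambda>x. \<tau>1 (f x))"
    "continuous_on S (\<lambda>x. \<tau>2 (f x))" "continuous_on S (\<lambda>x. \<tau>3 (f x))" "continuous_on S (\<lambda>x. n i (f x))"
    by (rule continuous_on_compose2[OF _ f subset_UNIV]; use reg C12D(1) nc in blast)+
qed

lemma cont_uh [continuous_intros]:
  "continuous_on S f \<Longrightarrow> continuous_on S g \<Longrightarrow> continuous_on S (\<lambda>x. uh (f x) (g x))"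
  unfolding vrem_def vinc_def by (intro continuous_intros)

lemma psi_cont_csupp: "0 < T \<Longrightarrow> cont_csupp (PsiT \<Phi> T)"
  using bump_cont_csupp PsiT_bump[OF ker] by blast

text \<open>Moving the base point of the remainder produces
  \<open>(Y2 y - Y2 w) * \<tau>2 y\<close>, which is controlled only after subtraction of
  \<open>C\<close>; the increment \<open>3 * C * (v y - v z0)\<close> in the germ supplies exactly
  this counterterm. The orders are 5/4 - 21/20, 9/20 - 1/20 and 1/4 - 1/20, none below 1/5, and 1840
  = 1 + 456 + 3 * 461.\<close>

lemma germ1:
  assumes z0: "z0 \<in> past_cyl 0 (1/4)" and T: "0 < T" "T \<le> 1/8"
  shows "\<bar>conv (PsiT \<Phi> T) (\<lambda>y. uh y z0 * \<tau>2 y + 3 * C * (v y - v z0)) z0\<bar> \<le> 7 * (1840 * N * \<delta>) * T powr (1/5)"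
proof (rule reconstruction[OF ker T(1), where F="\<lambda>z y. uh y z * \<tau>2 y + 3 * C * (v y - v z)"])
  show "0 \<le> 1840 * N * \<delta>" using N1 del by simp
  show "continuous_on UNIV (\<lambda>(z, y). uh y z * \<tau>2 y + 3 * C * (v y - v z))"
    unfolding split_beta by (intro continuous_intros)
  show "uh z z * \<tau>2 z + 3 * C * (v z - v z) = 0" for z by (simp add: vrem_self)
  fix S z w assume S: "0 < S" "S \<le> T / 2" and z: "z \<in> past_cyl z0 (T - 2 * S)" and w: "w \<in> past_cyl z S"
  have z38: "z \<in> past_cyl 0 (3/8)" using past_cyl_sub[OF z0, of "T - 2 * S" "3/8"] z S T by auto
  then have z12: "z \<in> past_cyl 0 (1/2)" using past_cyl_mono[of "3/8" "1/2" 0] by auto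
  have w8: "w \<in> past_cyl z (1/8)" "w \<in> past_cyl z (1/4)" using w past_cyl_mono[of S "1/8" z] past_cyl_mono[of S "1/4" z] S T by auto
  have w1: "w \<in> past_cyl 0 1" using past_cyl_sub[OF z38, of "1/8" 1] w8 by auto
  have S1: "S < 1" using S T by simp
  have d: "pdist w z \<le> S" using w S by (simp add: past_cyl_iff)
  let ?I7 = "conv (PsiT \<Phi> S) (\<lambda>y. (Y2 y - Y2 w) * \<tau>2 y - C) w"
  let ?I2 = "conv (PsiT \<Phi> S) \<tau>2 w"
  let ?I6 = "\<lambda>i. conv (PsiT \<Phi> S) (\<lambda>y. snd (y - w) $ i * \<tau>2 y) w"
  have eq: "uh y z * \<tau>2 y + 3 * C * (v y - v z) - (uh y w * \<tau>2 y + 3 * C * (v y - v w)) =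
      uh w z * \<tau>2 y + (3 * (v z - v w)) * ((Y2 y - Y2 w) * \<tau>2 y - C) - (\<Sum>i\<in>UNIV. (n i z - n i w) * (snd (y - w) $ i * \<tau>2 y))" for y
  proof -
    have "uh y z * \<tau>2 y + 3 * C * (v y - v z) - (uh y w * \<tau>2 y + 3 * C * (v y - v w)) = (uh y z - uh y w) * \<tau>2 y - 3 * C * (v z - v w)"
      by (simp add: algebra_simps)
    also have "\<dots> = uh w z * \<tau>2 y + (3 * (v z - v w)) * ((Y2 y - Y2 w) * \<tau>2 y - C) - (\<Sum>i\<in>UNIV. (n i z - n i w) * snd (y - w) $ i) * \<tau>2 y"
      unfolding vrem_three[of v Y2 Y3 y z w] by (simp add: algebra_simps)
    finally show ?thesis by (simp add: sum_distrib_right mult.assoc)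
  qed
  have "has_conv (PsiT \<Phi> S) w (\<lambda>y. uh w z * \<tau>2 y + (3 * (v z - v w)) * ((Y2 y - Y2 w) * \<tau>2 y - C) - (\<Sum>i\<in>UNIV. (n i z - n i w) * (snd (y - w) $ i * \<tau>2 y)))
     (uh w z * ?I2 + (3 * (v z - v w)) * ?I7 - (\<Sum>i\<in>UNIV. (n i z - n i w) * ?I6 i))"
    by (intro has_conv_diff has_conv_add has_conv_sum has_conv_cmult has_convI psi_cont_csupp S continuous_intros)
  then have "conv (PsiT \<Phi> S) (\<lambda>y. uh y z * \<tau>2 y + 3 * C * (v y - v z) - (uh y w * \<tau>2 y + 3 * C * (v y - v w))) w
      = uh w z * ?I2 + (3 * (v z - v w)) * ?I7 - (\<Sum>i\<in>UNIV. (n i z - n i w) * ?I6 i)"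
    unfolding eq by (rule has_convD)
  moreover have "\<bar>uh w z * ?I2\<bar> \<le> N * \<delta> * S powr (1/5)"
  proof (rule mult_powr_bound)
    show "\<bar>uh w z\<bar> \<le> N * S powr (5/4)"
      by (rule pdist_powr_mono[OF HN[OF z12 w8(2)] d]) (use N1 in auto)
    show "\<bar>?I2\<bar> \<le> \<delta> * S powr (-21/20)" by (rule n2[OF w1 S(1) S1])
  qed (use S S1 N1 del in auto)
  moreover have "\<bar>(3 * (v z - v w)) * ?I7\<bar> \<le> (456 * N) * \<delta> * S powr (1/5)"
  proof (rule mult_powr_bound)
    show "\<bar>3 * (v z - v w)\<bar> \<le> 456 * N * S powr (9/20)"
      using pdist_powr_mono[OF dv2[OF z12 w8(2)] d] N1 by (simp add: abs_mult abs_minus_commute)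
    show "\<bar>?I7\<bar> \<le> \<delta> * S powr (-1/20)" by (rule n7[OF w1 S(1) S1])
  qed (use S S1 N1 del in auto)
  moreover have "\<bar>\<Sum>i\<in>UNIV. (n i z - n i w) * ?I6 i\<bar> \<le> 3 * (461 * N * \<delta> * S powr (1/5))"
  proof -
    have "\<bar>(n i z - n i w) * ?I6 i\<bar> \<le> (461 * N) * \<delta> * S powr (1/5)" for i
    proof (rule mult_powr_bound)
      show "\<bar>n i z - n i w\<bar> \<le> 461 * N * S powr (1/4)"
        by (rule pdist_powr_mono[OF dnu[OF z38 w8(1)] d]) (use N1 in auto)
      show "\<bar>?I6 i\<bar> \<le> \<delta> * S powr (-1/20)" by (rule n6[OF w1 S(1) S1])
    qed (use S S1 N1 del in auto)
    from sum_comp_bound[where b="\<lambda>_. 1" and d=1, OF this] show ?thesis by simp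
  qed
  ultimately show "\<bar>conv (PsiT \<Phi> S) (\<lambda>y. uh y z * \<tau>2 y + 3 * C * (v y - v z) - (uh y w * \<tau>2 y + 3 * C * (v y - v w))) w\<bar>
      \<le> 1840 * N * \<delta> * S powr (1/5)" by linarith
qed

text \<open>With \<open>x\<close> the increment of \<open>v\<close> and \<open>y\<close> the
  smoother increment of \<open>v + Y3\<close>, the expression equals
  \<open>x^2 + 2 * v z * y\<close>, so its order 9/10 is twice that of \<open>v\<close>.\<close>

lemma W_bd:
  assumes z: "z \<in> past_cyl 0 (1/2)" and w: "w \<in> past_cyl z (1/4)"
  shows "\<bar>(v w)\<^sup>2 - (v z)\<^sup>2 + 2 * v z * (Y3 w - Y3 z)\<bar> \<le> 2300 * N * pdist w z powr (9/10)"
proof -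
  define d where "d = pdist w z"
  have d: "0 \<le> d" "d \<le> 1/4" using w by (auto simp: past_cyl_iff d_def)
  define x where "x = v w - v z"
  define y where "y = x + (Y3 w - Y3 z)"
  have "z \<in> past_cyl 0 1" "w \<in> past_cyl 0 1" using past_cyl_sub[OF z, of "1/4" 1] w past_cyl_mono[of "1/2" 1 0] z by auto
  then have v2: "\<bar>v z\<bar> \<le> 2" "\<bar>v w\<bar> \<le> 2" using vb by auto
  define P where "P = d powr (9/10)"
  have P0: "0 \<le> P" by (simp add: P_def)
  have dP: "d \<le> P" "d powr (19/20) \<le> P" "(d powr (9/20))\<^sup>2 = P" "d powr (9/20) \<le> 1"
    using powr_le_powr[of d "9/10" 1] powr_le_powr[of d "9/10" "19/20"] d powr_le1[of "9/20" d]
    by (auto simp: P_def power2_eq_square simp flip: powr_add)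
  have NP: "P \<le> N * P" "N * d \<le> N * P" "\<delta> * d powr (19/20) \<le> N * P"
    using mult_right_mono[OF N1 P0] mult_left_mono[OF dP(1), of N] N1 mult_mono[of \<delta> N "d powr (19/20)" P] dP del by auto
  have yb: "\<bar>y\<bar> \<le> 151 * (N * P)" using dv_Y3[OF assms] NP unfolding y_def x_def d_def[symmetric] by linarith
  define a where "a = 7 * \<delta> * d powr (9/20)"
  define b where "b = 145 * N * d"
  have a: "0 \<le> a" "a \<le> 7" "a\<^sup>2 \<le> 49 * P"
  proof -
    show "0 \<le> a" using del by (simp add: a_def)
    have "\<delta> * d powr (9/20) \<le> 1 * 1" using del dP by (intro mult_mono) auto
    then show "a \<le> 7" by (simp add: a_def)
    have "a\<^sup>2 = 49 * (\<delta>\<^sup>2 * P)" unfolding a_def by (simp add: power_mult_distrib dP(3))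
    moreover have "\<delta>\<^sup>2 * P \<le> 1 * P" using del P0 by (intro mult_right_mono) (auto simp: power_le_one)
    ultimately show "a\<^sup>2 \<le> 49 * P" by simp
  qed
  have b0: "0 \<le> b" using N1 d by (simp add: b_def)
  have x: "\<bar>x\<bar> \<le> a + b" "\<bar>x\<bar> \<le> 4" using dv1[OF assms] v2 by (auto simp: x_def a_def b_def d_def)
  have "x\<^sup>2 = \<bar>x\<bar> * \<bar>x\<bar>" by (simp add: power2_eq_square)
  also have "\<dots> \<le> \<bar>x\<bar> * a + \<bar>x\<bar> * b" using mult_left_mono[OF x(1), of "\<bar>x\<bar>"] by (simp add: distrib_left)
  \<comment> \<open>On the part proportional to \<open>N\<close> the other factor is bounded by 4,
    using |v| <= 2. Squaring \<open>b\<close> instead would give a term quadratic in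
    \<open>N\<close>.\<close>
  also have "\<dots> \<le> (a + b) * a + 4 * b" by (intro add_mono mult_right_mono x a b0)
  also have "\<dots> = a\<^sup>2 + a * b + 4 * b" by (simp add: power2_eq_square algebra_simps)
  also have "\<dots> \<le> 49 * P + 7 * b + 4 * b" using a b0 by (intro add_mono mult_right_mono) auto
  also have "\<dots> \<le> 49 * (N * P) + 11 * (145 * (N * P))" using NP by (simp add: b_def)
  finally have x2: "x\<^sup>2 \<le> 1644 * (N * P)" by simp
  have "\<bar>2 * v z * y\<bar> \<le> 4 * (151 * (N * P))" unfolding abs_mult by (intro mult_mono yb) (use v2 in auto)
  moreover have "(v w)\<^sup>2 - (v z)\<^sup>2 + 2 * v z * (Y3 w - Y3 z) = x\<^sup>2 + 2 * v z * y"
    by (simp add: x_def y_def power2_eq_square algebra_simps)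
  ultimately have "\<bar>(v w)\<^sup>2 - (v z)\<^sup>2 + 2 * v z * (Y3 w - Y3 z)\<bar> \<le> 2300 * (N * P)"
    using x2 NP(1) P0 zero_le_power2[of x] by linarith
  then show ?thesis by (simp add: P_def d_def)
qed

text \<open>For the product of \<open>v^2\<close> with \<open>\<tau>1\<close> an expansion without
  gradient term is enough: the orders after changing the base point are 9/10 - 11/20 and 9/20 -
  1/20. The constant is 2300 + 2 * 152.\<close>

lemma germ2:
  assumes z0: "z0 \<in> past_cyl 0 (1/4)" and T: "0 < T" "T \<le> 1/8"
  shows "\<bar>conv (PsiT \<Phi> T) (\<lambda>y. ((v y)\<^sup>2 - (v z0)\<^sup>2 + 2 * v z0 * (Y3 y - Y3 z0)) * \<tau>1 y) z0\<bar> \<le> 7 * (2604 * N * \<delta>) * T powr (1/5)"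
proof (rule reconstruction[OF ker T(1), where F="\<lambda>z y. ((v y)\<^sup>2 - (v z)\<^sup>2 + 2 * v z * (Y3 y - Y3 z)) * \<tau>1 y"])
  show "0 \<le> 2604 * N * \<delta>" using N1 del by simp
  show "continuous_on UNIV (\<lambda>(z, y). ((v y)\<^sup>2 - (v z)\<^sup>2 + 2 * v z * (Y3 y - Y3 z)) * \<tau>1 y)"
    unfolding split_beta by (intro continuous_intros)
  fix S z w assume S: "0 < S" "S \<le> T / 2" and z: "z \<in> past_cyl z0 (T - 2 * S)" and w: "w \<in> past_cyl z S"
  have z38: "z \<in> past_cyl 0 (3/8)" using past_cyl_sub[OF z0, of "T - 2 * S" "3/8"] z S T by auto
  then have z12: "z \<in> past_cyl 0 (1/2)" using past_cyl_mono[of "3/8" "1/2" 0] by auto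
  have w8: "w \<in> past_cyl z (1/8)" "w \<in> past_cyl z (1/4)" using w past_cyl_mono[of S "1/8" z] past_cyl_mono[of S "1/4" z] S T by auto
  have w1: "w \<in> past_cyl 0 1" using past_cyl_sub[OF z38, of "1/8" 1] w8 by auto
  have S1: "S < 1" using S T by simp
  have d: "pdist w z \<le> S" using w S by (simp add: past_cyl_iff)
  let ?W = "(v w)\<^sup>2 - (v z)\<^sup>2 + 2 * v z * (Y3 w - Y3 z)"
  let ?I8 = "conv (PsiT \<Phi> S) (\<lambda>y. (Y3 y - Y3 w) * \<tau>1 y) w"
  let ?I1 = "conv (PsiT \<Phi> S) \<tau>1 w"
  have eq: "((v y)\<^sup>2 - (v z)\<^sup>2 + 2 * v z * (Y3 y - Y3 z)) * \<tau>1 y - ((v y)\<^sup>2 - (v w)\<^sup>2 + 2 * v w * (Y3 y - Y3 w)) * \<tau>1 y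
      = ?W * \<tau>1 y + (2 * (v z - v w)) * ((Y3 y - Y3 w) * \<tau>1 y)" for y by (simp add: algebra_simps)
  have "has_conv (PsiT \<Phi> S) w (\<lambda>y. ?W * \<tau>1 y + (2 * (v z - v w)) * ((Y3 y - Y3 w) * \<tau>1 y)) (?W * ?I1 + (2 * (v z - v w)) * ?I8)"
    by (intro has_conv_add has_conv_cmult has_convI psi_cont_csupp S continuous_intros)
  then have "conv (PsiT \<Phi> S) (\<lambda>y. ((v y)\<^sup>2 - (v z)\<^sup>2 + 2 * v z * (Y3 y - Y3 z)) * \<tau>1 y - ((v y)\<^sup>2 - (v w)\<^sup>2 + 2 * v w * (Y3 y - Y3 w)) * \<tau>1 y) w
      = ?W * ?I1 + (2 * (v z - v w)) * ?I8" unfolding eq by (rule has_convD)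
  moreover have "\<bar>?W * ?I1\<bar> \<le> (2300 * N) * \<delta> * S powr (1/5)"
  proof (rule mult_powr_bound)
    show "\<bar>?W\<bar> \<le> 2300 * N * S powr (9/10)"
      by (rule pdist_powr_mono[OF W_bd[OF z12 w8(2)] d]) (use N1 in auto)
    show "\<bar>?I1\<bar> \<le> \<delta> * S powr (-11/20)" by (rule n1[OF w1 S(1) S1])
  qed (use S S1 N1 del in auto)
  moreover have "\<bar>(2 * (v z - v w)) * ?I8\<bar> \<le> (304 * N) * \<delta> * S powr (1/5)"
  proof (rule mult_powr_bound)
    show "\<bar>2 * (v z - v w)\<bar> \<le> 304 * N * S powr (9/20)"
      using pdist_powr_mono[OF dv2[OF z12 w8(2)] d] N1 by (simp add: abs_mult abs_minus_commute)
    show "\<bar>?I8\<bar> \<le> \<delta> * S powr (-1/20)" by (rule n8[OF w1 S(1) S1])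
  qed (use S S1 N1 del in auto)
  ultimately show "\<bar>conv (PsiT \<Phi> S) (\<lambda>y. ((v y)\<^sup>2 - (v z)\<^sup>2 + 2 * v z * (Y3 y - Y3 z)) * \<tau>1 y - ((v y)\<^sup>2 - (v w)\<^sup>2 + 2 * v w * (Y3 y - Y3 w)) * \<tau>1 y) w\<bar>
      \<le> 2604 * N * \<delta> * S powr (1/5)" by linarith
qed simp

lemma fz_bound:
  assumes z: "z \<in> past_cyl 0 (1/4)" and T: "0 < T" "T \<le> 1/8"
  shows "\<bar>conv (PsiT \<Phi> T) (\<lambda>y. heat_op v y + heat_op Y3 y + 3 * v z * heat_op Y2 y + (v y)^3) z\<bar> \<le> 100000 * N * \<delta> * T powr (-11/20)"
proof -
  have T1: "T < 1" using T by simp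
  have z1: "z \<in> past_cyl 0 1" and z12: "z \<in> past_cyl 0 (1/2)" using z past_cyl_mono[of "1/4" 1 0] past_cyl_mono[of "1/4" "1/2" 0] by auto
  have Q: "y \<in> past_cyl 0 1" if "y \<in> past_cyl z T" for y using past_cyl_sub[OF z, of T 1] that T by auto
  let ?F1 = "\<lambda>y. uh y z * \<tau>2 y + 3 * C * (v y - v z)"
  let ?F2 = "\<lambda>y. ((v y)\<^sup>2 - (v z)\<^sup>2 + 2 * v z * (Y3 y - Y3 z)) * \<tau>1 y"
  let ?g7 = "\<lambda>y. (Y2 y - Y2 z) * \<tau>2 y - C"
  let ?g8 = "\<lambda>y. (Y3 y - Y3 z) * \<tau>1 y"
  let ?g9 = "\<lambda>y. (Y3 y - Y3 z) * \<tau>2 y - 3 * C * \<tau>1 y"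
  let ?g6 = "\<lambda>i y. snd (y - z) $ i * \<tau>2 y"
  \<comment> \<open>The counterterm \<open>9 * C * (v y + \<tau>1 y)\<close> is distributed over
    three products: \<open>9 * C * \<tau>1 y\<close> goes into \<open>?g9\<close>,
    \<open>9 * C * v z\<close> into \<open>?g7\<close>, and the increment
    \<open>9 * C * (v y - v z)\<close> into \<open>?F1\<close>.\<close>
  let ?E = "\<lambda>y. (-3 * (v z)\<^sup>2) * \<tau>1 y + (6 * v z) * ?g8 y - 3 * ?F2 y + 3 * ?g9 y + (9 * v z) * ?g7 y - 3 * ?F1 y - (\<Sum>i\<in>UNIV. (3 * n i z) * ?g6 i y)"
  let ?I = "\<lambda>f. conv (PsiT \<Phi> T) f z"
  have "has_conv (PsiT \<Phi> T) z ?E ((-3 * (v z)\<^sup>2) * ?I \<tau>1 + (6 * v z) * ?I ?g8 - 3 * ?I ?F2 + 3 * ?I ?g9 + (9 * v z) * ?I ?g7 - 3 * ?I ?F1 - (\<Sum>i\<in>UNIV. (3 * n i z) * ?I (?g6 i)))"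
    by (intro has_conv_diff[where g="\<lambda>y. \<Sum>i\<in>UNIV. (3 * n i z) * ?g6 i y"] has_conv_diff[where g="\<lambda>y. 3 * ?F1 y"] has_conv_add[where g="\<lambda>y. (9 * v z) * ?g7 y"] has_conv_add[where g="\<lambda>y. 3 * ?g9 y"]
       has_conv_diff[where g="\<lambda>y. 3 * ?F2 y"] has_conv_add[where g="\<lambda>y. (6 * v z) * ?g8 y"] has_conv_sum has_conv_cmult has_convI psi_cont_csupp T continuous_intros)
  then have IE: "?I ?E = (-3 * (v z)\<^sup>2) * ?I \<tau>1 + (6 * v z) * ?I ?g8 - 3 * ?I ?F2 + 3 * ?I ?g9 + (9 * v z) * ?I ?g7 - 3 * ?I ?F1 - (\<Sum>i\<in>UNIV. (3 * n i z) * ?I (?g6 i))"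
    by (rule has_convD)
  have "?I (\<lambda>y. heat_op v y + heat_op Y3 y + 3 * v z * heat_op Y2 y + (v y)^3) = ?I ?E"
  proof (rule conv_cong[OF PsiT_bump[OF ker T(1)]])
    show "continuous_on UNIV (\<lambda>y. heat_op v y + heat_op Y3 y + 3 * v z * heat_op Y2 y + (v y)^3)"
      by (intro continuous_intros C12_heat_op_cont reg)
    show "continuous_on UNIV ?E" by (intro continuous_intros)
    fix q assume "q \<in> supp_box T"
    then have y: "z - q \<in> past_cyl 0 1" by (intro Q) (simp add: supp_box_Qc[of q _ z])
    define y where "y = z - q"
    have s: "(\<Sum>i\<in>UNIV. (3 * n i z) * ?g6 i y) = 3 * (vinc v Y2 Y3 y z - uh y z) * \<tau>2 y"
      unfolding vrem_def by (simp add: sum_distrib_right sum_distrib_left mult_ac)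
    have "heat_op v y + heat_op Y3 y + 3 * v z * heat_op Y2 y + (v y)^3 = ?E y"
      unfolding eqv[OF y, folded y_def] eq2[OF y, folded y_def] eq3[OF y, folded y_def] s unfolding vinc_def by algebra
    then show "heat_op v (z - q) + heat_op Y3 (z - q) + 3 * v z * heat_op Y2 (z - q) + (v (z - q))^3 = ?E (z - q)" by (simp only: y_def)
  qed
  also note IE
  finally have eq: "?I (\<lambda>y. heat_op v y + heat_op Y3 y + 3 * v z * heat_op Y2 y + (v y)^3) = (-3 * (v z)\<^sup>2) * ?I \<tau>1 + (6 * v z) * ?I ?g8 - 3 * ?I ?F2 + 3 * ?I ?g9 + (9 * v z) * ?I ?g7 - 3 * ?I ?F1 - (\<Sum>i\<in>UNIV. (3 * n i z) * ?I (?g6 i))" .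
  define P where "P = N * \<delta> * T powr (-11/20)"
  have vz: "\<bar>v z\<bar> \<le> 2" by (rule vb[OF z1])
  have v2: "(v z)\<^sup>2 \<le> 4" using power_mono[OF vz, of 2] by simp
  have Nd: "\<delta> \<le> N * \<delta>" using mult_right_mono[OF N1, of \<delta>] del by simp
  have conv1: "\<delta> * T powr a \<le> P" if "-11/20 \<le> a" for a
    unfolding P_def using T Nd del that by (intro mult_mono powr_le_powr) auto
  have conv2: "k * (N * \<delta>) * T powr (1/5) \<le> k * P" if "0 \<le> k" for k
  proof -
    have "(k * (N * \<delta>)) * T powr (1/5) \<le> (k * (N * \<delta>)) * T powr (-11/20)"
      using T that N1 del by (intro mult_left_mono powr_le_powr) auto
    then show ?thesis by (simp add: P_def)
  qed
  have b1: "\<bar>(-3 * (v z)\<^sup>2) * ?I \<tau>1\<bar> \<le> 12 * P" unfolding abs_mult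
    by (intro mult_mono order_trans[OF n1[OF z1 T(1) T1] conv1]) (use v2 in auto)
  have b8: "\<bar>(6 * v z) * ?I ?g8\<bar> \<le> 12 * P" unfolding abs_mult
    by (intro mult_mono order_trans[OF n8[OF z1 T(1) T1] conv1]) (use vz in auto)
  have b9: "\<bar>3 * ?I ?g9\<bar> \<le> 3 * P" unfolding abs_mult
    by (intro mult_mono order_trans[OF n9[OF z1 T(1) T1] conv1]) auto
  have b7: "\<bar>(9 * v z) * ?I ?g7\<bar> \<le> 18 * P" unfolding abs_mult
    by (intro mult_mono order_trans[OF n7[OF z1 T(1) T1] conv1]) (use vz in auto)
  have bF1: "\<bar>3 * ?I ?F1\<bar> \<le> 38640 * P" using germ1[OF z T] conv2[of 12880] by (simp add: abs_mult)
  have bF2: "\<bar>3 * ?I ?F2\<bar> \<le> 54684 * P" using germ2[OF z T] conv2[of 18228] by (simp add: abs_mult)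
  have b6: "\<bar>\<Sum>i\<in>UNIV. (3 * n i z) * ?I (?g6 i)\<bar> \<le> 432 * P"
  proof -
    have "\<bar>\<Sum>i\<in>UNIV. (3 * n i z) * ?I (?g6 i)\<bar> \<le> 3 * ((144 * N) * (\<delta> * T powr (-1/20)))"
    proof (rule sum_comp_bound)
      show "\<bar>3 * n i z\<bar> \<le> 144 * N" for i using nu_bound[OF z12, of i] by (simp add: abs_mult)
      show "\<bar>?I (?g6 i)\<bar> \<le> \<delta> * T powr (-1/20)" for i by (rule n6[OF z1 T(1) T1])
    qed
    also have "\<dots> \<le> 3 * ((144 * N) * (\<delta> * T powr (-11/20)))"
      using T N1 del by (intro mult_left_mono powr_le_powr) auto
    finally show ?thesis by (simp add: P_def)
  qed
  have "0 \<le> P" using N1 del by (simp add: P_def)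
  then have "\<bar>?I (\<lambda>y. heat_op v y + heat_op Y3 y + 3 * v z * heat_op Y2 y + (v y)^3)\<bar> \<le> 100000 * P"
    unfolding eq by (intro order_trans[OF abs_triangle7[OF b1 b8 bF2 b9 b7 bF1 b6]]) simp
  then show ?thesis by (simp add: P_def)
qed

end

section \<open>Affine approximation of the remainder at a single scale\<close>

lemma powr_half_le:
  fixes x :: real
  assumes "0 < x" "0 \<le> a" "a \<le> 2" shows "(x / 2) powr (- a) \<le> 4 * x powr (- a)"
proof -
  have "(x / 2) powr (- a) = 2 powr a * x powr (- a)" using assms by (simp add: powr_divide powr_minus_divide)
  also have "(2::real) powr a \<le> 2 powr 2" using assms by (intro powr_mono) auto
  finally show ?thesis by (simp add: mult_right_mono)
qed

context local_pde begin

lemma v_cube_bound: "y \<in> past_cyl 0 1 \<Longrightarrow> \<bar>(v y)^3\<bar> \<le> 8"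
  using power_mono[OF vb, of y 3] by (simp add: power_abs)

text \<open>The approximation is centred at 0, so the coefficient must be frozen there and not at
  \<open>z\<close>; this costs the oscillation of \<open>v\<close> times a mollified
  \<open>\<tau>2\<close>. The cube is not small and is responsible for the 8, the only contribution
  without the factor \<open>N * \<delta>\<close>.\<close>

lemma f0_bound:
  assumes z: "z \<in> past_cyl 0 L" and L: "0 < L" "L \<le> 1/4" and T: "0 < T" "T \<le> 1/8"
  shows "\<bar>conv (PsiT \<Phi> T) (\<lambda>y. heat_op v y + heat_op Y3 y + 3 * v 0 * heat_op Y2 y) z\<bar>
    \<le> 8 + 100000 * N * \<delta> * (T powr (-11/20) + L powr (9/20) * T powr (-21/20))"
proof -
  have T1: "T < 1" using T by simp
  have z4: "z \<in> past_cyl 0 (1/4)" using z past_cyl_mono[of L "1/4" 0] L by auto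
  have z1: "z \<in> past_cyl 0 1" using z4 past_cyl_mono[of "1/4" 1 0] by auto
  have Q: "y \<in> past_cyl 0 1" if "y \<in> past_cyl z T" for y using past_cyl_sub[OF z4, of T 1] that T by auto
  let ?I = "\<lambda>f. conv (PsiT \<Phi> T) f z"
  let ?f = "\<lambda>y. heat_op v y + heat_op Y3 y + 3 * v z * heat_op Y2 y + (v y)^3"
  have "has_conv (PsiT \<Phi> T) z (\<lambda>y. ?f y - (v y)^3 + (3 * (v 0 - v z)) * heat_op Y2 y) (?I ?f - ?I (\<lambda>y. (v y)^3) + (3 * (v 0 - v z)) * ?I (heat_op Y2))"
    by (intro has_conv_add[where g="\<lambda>y. (3 * (v 0 - v z)) * heat_op Y2 y"] has_conv_diff[where g="\<lambda>y. (v y)^3"] has_conv_cmult has_convI psi_cont_csupp T continuous_intros C12_heat_op_cont reg)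
  moreover have "(\<lambda>y. ?f y - (v y)^3 + (3 * (v 0 - v z)) * heat_op Y2 y) = (\<lambda>y. heat_op v y + heat_op Y3 y + 3 * v 0 * heat_op Y2 y)"
    by (auto simp: algebra_simps)
  ultimately have "has_conv (PsiT \<Phi> T) z (\<lambda>y. heat_op v y + heat_op Y3 y + 3 * v 0 * heat_op Y2 y) (?I ?f - ?I (\<lambda>y. (v y)^3) + (3 * (v 0 - v z)) * ?I (heat_op Y2))"
    by (simp only:)
  then have eq: "?I (\<lambda>y. heat_op v y + heat_op Y3 y + 3 * v 0 * heat_op Y2 y) = ?I ?f - ?I (\<lambda>y. (v y)^3) + (3 * (v 0 - v z)) * ?I (heat_op Y2)"
    by (rule has_convD)
  have b1: "\<bar>?I ?f\<bar> \<le> 100000 * N * \<delta> * T powr (-11/20)" by (rule fz_bound[OF z4 T])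
  have b2: "\<bar>?I (\<lambda>y. (v y)^3)\<bar> \<le> 8"
    by (rule conv_bound[OF PsiT_bump[OF ker T(1)]])
       (auto intro!: continuous_intros v_cube_bound Q simp: supp_box_Qc[of _ _ z])
  have "?I (heat_op Y2) = ?I \<tau>2"
    by (rule conv_cong[OF PsiT_bump[OF ker T(1)]])
       (auto intro!: C12_heat_op_cont reg eq2 Q simp: supp_box_Qc[of _ _ z])
  then have "\<bar>?I (heat_op Y2)\<bar> \<le> \<delta> * T powr (-21/20)" using n2[OF z1 T(1) T1] by simp
  moreover have "\<bar>3 * (v 0 - v z)\<bar> \<le> 456 * N * L powr (9/20)"
  proof -
    have "pdist z 0 \<le> L" using z L by (simp add: past_cyl_iff)
    from pdist_powr_mono[OF dv2[OF past_cyl_center z4] this] N1 show ?thesis by (simp add: abs_mult abs_minus_commute)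
  qed
  ultimately have b3: "\<bar>(3 * (v 0 - v z)) * ?I (heat_op Y2)\<bar> \<le> (456 * N * L powr (9/20)) * (\<delta> * T powr (-21/20))"
    unfolding abs_mult[of "3 * (v 0 - v z)"] by (intro mult_mono) (use N1 in auto)
  have "(456 * N * L powr (9/20)) * (\<delta> * T powr (-21/20)) = 456 * (N * \<delta> * (L powr (9/20) * T powr (-21/20)))" by simp
  also have "\<dots> \<le> 100000 * (N * \<delta> * (L powr (9/20) * T powr (-21/20)))" using N1 del by (intro mult_right_mono) auto
  finally have b4: "\<bar>(3 * (v 0 - v z)) * ?I (heat_op Y2)\<bar> \<le> 100000 * (N * \<delta> * (L powr (9/20) * T powr (-21/20)))" using b3 by linarith
  have "8 + 100000 * N * \<delta> * (T powr (-11/20) + L powr (9/20) * T powr (-21/20))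
     = 8 + 100000 * N * \<delta> * T powr (-11/20) + 100000 * (N * \<delta> * (L powr (9/20) * T powr (-21/20)))" by (simp add: distrib_left)
  then show ?thesis unfolding eq using b1 b2 b4 by linarith
qed

text \<open>The subtracted affine function is annihilated by the heat operator, so the remainder
  solves the equation of \<open>v + Y3 + 3 * v p * Y2\<close>.\<close>

lemma uh_C12:
  "C12 (\<lambda>y. uh y p)" "heat_op (\<lambda>y. uh y p) z = heat_op v z + heat_op Y3 z + 3 * v p * heat_op Y2 z"
proof -
  let ?a = "\<lambda>y. 1 * v y + 1 * Y3 y + 0"
  let ?b = "\<lambda>y. 1 * ?a y + (3 * v p) * Y2 y + (- v p - Y3 p - 3 * v p * Y2 p)"
  let ?c = "\<lambda>y. \<Sum>i\<in>UNIV. n i p * snd (y - p) $ i"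
  note A = C12_lin[OF reg(1) reg(3), where a=1 and b=1 and c=0]
  note B = C12_lin[OF A(1) reg(2), where a=1 and b="3 * v p" and c="- v p - Y3 p - 3 * v p * Y2 p"]
  note Cc = C12_lin[OF B(1) affine_C12(1)[of "\<lambda>i. n i p" p], where a=1 and b="-1" and c=0]
  have e: "(\<lambda>y. uh y p) = (\<lambda>y. 1 * ?b y + (-1) * ?c y + 0)"
    unfolding vrem_def vinc_def by (auto simp: algebra_simps)
  show "C12 (\<lambda>y. uh y p)" unfolding e by (rule Cc(1))
  show "heat_op (\<lambda>y. uh y p) z = heat_op v z + heat_op Y3 z + 3 * v p * heat_op Y2 z"
    unfolding e Cc(5) B(5) A(5) affine_C12(2) by simp
qed

text \<open>Three scales are separated by the ratio \<open>l\<close>: mollification at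
  \<open>l * r\<close>, approximation at \<open>r\<close>, interior regularity at
  \<open>r / l\<close>. Mollification turns the right-hand side into a bounded, spatially Lipschitz
  function, and the large radius makes the Taylor error small. As a result \<open>N\<close> occurs
  only with a positive power of \<open>l\<close> or with \<open>\<delta>\<close>; the negative
  powers of \<open>l\<close> are harmless because \<open>\<delta>\<close> is chosen after
  \<open>l\<close>.\<close>

lemma one_scale:
  assumes lip: "\<And>T f z s i B. \<lbrakk>T > 0; continuous_on UNIV f; \<bar>s\<bar> \<le> T;
      \<And>y. y \<in> supp_box (2 * T) \<Longrightarrow> \<bar>conv (PsiT \<Phi> (T / 2)) f (z - y)\<bar> \<le> B\<rbrakk>
      \<Longrightarrow> \<bar>conv (PsiT \<Phi> T) f (z + s *\<^sub>R ex_dir i) - conv (PsiT \<Phi> T) f z\<bar> \<le> \<Lambda> * \<bar>s\<bar> * B / T"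
    and \<Lambda>: "0 \<le> \<Lambda>" and l: "0 < l" "l \<le> 1/4" and r: "0 < r" "r \<le> l / 8"
  shows "\<exists>a c. \<forall>y\<in>past_cyl 0 r. \<bar>uh y 0 - c - (\<Sum>i\<in>UNIV. a i * snd y $ i)\<bar>
    \<le> (24000 * (3 * N * l powr (3/4) + (1 + \<Lambda> / l\<^sup>2) * (8 + 2000000 * N * \<delta> / l\<^sup>2)) + N * l powr (5/4) + 456 * N * \<delta>) * r powr (5/4)"
proof -
  define L where "L = r / l"
  define T where "T = l * r"
  have L: "0 < L" "L \<le> 1/8" "r = l * L" using l r by (auto simp: L_def field_simps)
  have "T = l * l * L" unfolding T_def L(3) by simp
  moreover have ll: "l * l \<le> 1/4 * (1/4)" using l by (intro mult_mono) auto
  ultimately have TL: "T \<le> 1/16 * L" using L by (simp add: mult_right_mono)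
  have Tr: "T \<le> r / 4" using l r by (simp add: T_def)
  have T0: "0 < T" using l r by (simp add: T_def)
  have T: "0 < T" "T \<le> 1/8" "T / 2 \<le> 1/8" "T \<le> 1" using TL L(1,2) T0 by linarith+
  have rL: "r \<le> L / 4" using L l by (simp add: mult_right_mono)
  have r1: "r \<le> 1" using rL L(2) by linarith
  define f where "f = (\<lambda>y. heat_op v y + heat_op Y3 y + 3 * v 0 * heat_op Y2 y)"
  have cf: "continuous_on UNIV f" unfolding f_def by (intro continuous_intros C12_heat_op_cont reg)
  define k where "k = conv (PsiT \<Phi> T) (\<lambda>y. uh y 0)"
  have kC2: "C12 k" unfolding k_def by (rule C12_conv[OF psi_cont_csupp[OF T(1)] uh_C12(1)])
  have "heat_op (\<lambda>y. uh y 0) = f" unfolding f_def by (rule ext) (rule uh_C12(2))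
  then have kh: "heat_op k z = conv (PsiT \<Phi> T) f z" for z
    unfolding k_def using C12_conv(2)[OF psi_cont_csupp[OF T(1)] uh_C12(1)[of 0]] by simp
  define A where "A = N * (2 * L) powr (5/4)"
  define P where "P = T powr (-11/20) + L powr (9/20) * T powr (-21/20)"
  define B where "B = 8 + 1000000 * N * \<delta> * P"
  have A0: "A > 0" using N1 L by (simp add: A_def)
  have P0: "P \<ge> 0" by (simp add: P_def)
  have B0: "B \<ge> 0" using P0 N1 del by (simp add: B_def)
  have zero: "(0::pt) \<in> past_cyl 0 (1/2)" by (rule past_cyl_center) simp
  have kA: "\<bar>k z\<bar> \<le> A" if z: "z \<in> past_cyl 0 L" for z
    unfolding k_def
  proof (rule conv_bound[OF PsiT_bump[OF ker T(1)]])
    show "continuous_on UNIV (\<lambda>y. uh y 0)" by (intro continuous_intros)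
    fix y assume "y \<in> supp_box T"
    then have "z - y \<in> past_cyl z T" by (simp add: supp_box_Qc[of y _ z])
    then have q: "z - y \<in> past_cyl 0 (2 * L)" using past_cyl_sub[OF z, of T "2 * L"] TL L(1) T(1) by (auto simp: algebra_simps)
    then have q4: "z - y \<in> past_cyl 0 (1/4)" using past_cyl_mono[of "2 * L" "1/4" 0] L by auto
    show "\<bar>uh (z - y) 0\<bar> \<le> A" unfolding A_def
      by (rule pdist_powr_mono[OF HN[OF zero q4]]) (use q L N1 in \<open>auto simp: past_cyl_iff\<close>)
  qed
  have hB: "\<bar>heat_op k z\<bar> \<le> B" if z: "z \<in> past_cyl 0 L" for z
  proof -
    have "\<bar>heat_op k z\<bar> \<le> 8 + 100000 * N * \<delta> * P" unfolding kh f_def P_def by (rule f0_bound[OF z]) (use L T in auto)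
    also have "\<dots> \<le> B" unfolding B_def using N1 del P0 by (intro add_left_mono mult_right_mono) auto
    finally show ?thesis .
  qed
  have hB': "\<bar>heat_op k (z + s *\<^sub>R ex_dir j) - heat_op k z\<bar> \<le> (\<Lambda> * B / T) * \<bar>s\<bar>" if z: "z \<in> past_cyl 0 L" and s: "\<bar>s\<bar> \<le> T" for z s j
  proof -
    have "\<bar>conv (PsiT \<Phi> T) f (z + s *\<^sub>R ex_dir j) - conv (PsiT \<Phi> T) f z\<bar> \<le> \<Lambda> * \<bar>s\<bar> * B / T"
    proof (rule lip[OF T(1) cf s])
      fix y assume "y \<in> supp_box (2 * T)"
      then have "z - y \<in> past_cyl z (2 * T)" by (simp add: supp_box_Qc[of y _ z])
      then have q: "z - y \<in> past_cyl 0 (2 * L)" using past_cyl_sub[OF z, of "2 * T" "2 * L"] TL L T by auto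
      have "\<bar>conv (PsiT \<Phi> (T / 2)) f (z - y)\<bar> \<le> 8 + 100000 * N * \<delta> * ((T/2) powr (-11/20) + (2 * L) powr (9/20) * (T/2) powr (-21/20))"
        unfolding f_def by (rule f0_bound[OF q]) (use L T in auto)
      also have "\<dots> \<le> 8 + 100000 * N * \<delta> * (10 * P)"
      proof (intro add_left_mono mult_left_mono)
        have 1: "(T/2) powr (-11/20) \<le> 4 * T powr (-11/20)" "(T/2) powr (-21/20) \<le> 4 * T powr (-21/20)"
          using powr_half_le[OF T(1), of "11/20"] powr_half_le[OF T(1), of "21/20"] by auto
        have "(2 * L) powr (9/20) = 2 powr (9/20) * L powr (9/20)" using L by (simp add: powr_mult)
        also have "\<dots> \<le> 2 powr 1 * L powr (9/20)" by (intro mult_right_mono powr_mono) auto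
        finally have "(2 * L) powr (9/20) * (T/2) powr (-21/20) \<le> (2 * L powr (9/20)) * (4 * T powr (-21/20))"
          by (intro mult_mono 1) auto
        also have "\<dots> = 8 * (L powr (9/20) * T powr (-21/20))" by simp
        finally have "(2 * L) powr (9/20) * (T/2) powr (-21/20) \<le> 8 * (L powr (9/20) * T powr (-21/20))" .
        moreover have "0 \<le> T powr (-11/20)" "0 \<le> L powr (9/20) * T powr (-21/20)" by auto
        ultimately show "(T/2) powr (-11/20) + (2 * L) powr (9/20) * (T/2) powr (-21/20) \<le> 10 * P"
          using 1(1) unfolding P_def distrib_left by linarith
      qed (use N1 del in auto)
      finally show "\<bar>conv (PsiT \<Phi> (T / 2)) f (z - y)\<bar> \<le> B" by (simp add: B_def)
    qed
    then show ?thesis unfolding kh by (simp add: mult_ac)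
  qed
  have tay: "\<bar>k y - k 0 - (\<Sum>i\<in>UNIV. pdv (ex_dir i) k 0 * snd y $ i)\<bar> \<le> 24000 * (A / L\<^sup>2 + B + (\<Lambda> * B / T) * L) * r\<^sup>2" if y: "y \<in> past_cyl 0 r" for y
    using interior_taylor[OF kC2 L(1) A0 kA hB hB' T(1) _ rL y] r by simp
  have Lp: "L powr a = l powr (- a) * r powr a" and Tp: "T powr a = l powr a * r powr a" for a
    using l r by (simp_all add: L_def T_def powr_divide powr_mult powr_minus_divide)
  have r2: "r powr (-3/4) * r\<^sup>2 = r powr (5/4)" "r powr (-11/20) * r\<^sup>2 = r powr (29/20)"
    "r powr (9/20) * r powr (-21/20) * r\<^sup>2 = r powr (7/5)"
    using powr_add[of r "-3/4" 2] powr_add[of r "-11/20" 2] powr_add[of r "9/20" "-21/20"] powr_add[of r "9/20 - 21/20" 2] r by simp_all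
  have t1: "A / L\<^sup>2 * r\<^sup>2 \<le> 3 * N * l powr (3/4) * r powr (5/4)"
  proof -
    have "A / L\<^sup>2 * r\<^sup>2 = N * 2 powr (5/4) * (L powr (5/4) / L\<^sup>2 * r\<^sup>2)" using L by (simp add: A_def powr_mult)
    also have "L powr (5/4) / L\<^sup>2 = L powr (-3/4)" using L powr_diff[of L "5/4" 2] by simp
    also have "L powr (-3/4) * r\<^sup>2 = l powr (3/4) * r powr (5/4)"
      using r2(1) by (simp add: Lp mult.assoc)
    also have "N * 2 powr (5/4) * (l powr (3/4) * r powr (5/4)) \<le> N * 3 * (l powr (3/4) * r powr (5/4))"
    proof (intro mult_right_mono mult_left_mono)
      have "((2::real) powr (5/4))^4 = 2^5" by (simp add: powr_power)
      then have "((2::real) powr (5/4))^4 \<le> 3^4" by simp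
      then show "(2::real) powr (5/4) \<le> 3" using power_le_imp_le_base[of _ 3 "3::real"] by simp
    qed (use N1 in auto)
    finally show ?thesis by (simp add: mult_ac)
  qed
  have il: "l powr a \<le> 1 / l\<^sup>2" if "-2 \<le> a" for a
    using powr_le_powr[of l "-2" a] l that by (simp add: powr_minus_divide)
  \<comment> \<open>In powers of \<open>r\<close> the two parts of \<open>P * r^2\<close> have
    exponents 2 - 11/20 = 29/20 and 2 + 9/20 - 21/20 = 7/5, both above 5/4. The worst power of
    \<open>l\<close> is -3/2, rounded to -2.\<close>
  have t2: "B * r\<^sup>2 \<le> (8 + 2000000 * N * \<delta> / l\<^sup>2) * r powr (5/4)"
  proof -
    have "T powr (-11/20) * r\<^sup>2 = l powr (-11/20) * r powr (29/20)"
      using r2(2) by (simp add: Tp mult.assoc)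
    also have "\<dots> \<le> 1 / l\<^sup>2 * r powr (5/4)" using r r1 by (intro mult_mono il powr_le_powr) auto
    finally have 1: "T powr (-11/20) * r\<^sup>2 \<le> 1 / l\<^sup>2 * r powr (5/4)" .
    have "L powr (9/20) * T powr (-21/20) * r\<^sup>2 = l powr (-9/20) * l powr (-21/20) * (r powr (9/20) * r powr (-21/20) * r\<^sup>2)"
      by (simp add: Lp Tp mult_ac)
    also have "\<dots> = l powr (-3/2) * r powr (7/5)" unfolding r2(3) using powr_add[of l "-9/20" "-21/20"] by simp
    also have "\<dots> \<le> 1 / l\<^sup>2 * r powr (5/4)" using r r1 by (intro mult_mono il powr_le_powr) auto
    finally have 2: "L powr (9/20) * T powr (-21/20) * r\<^sup>2 \<le> 1 / l\<^sup>2 * r powr (5/4)" .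
    have "P * r\<^sup>2 \<le> 2 * (1 / l\<^sup>2 * r powr (5/4))" using 1 2 by (simp add: P_def distrib_right)
    then have "1000000 * N * \<delta> * (P * r\<^sup>2) \<le> 1000000 * N * \<delta> * (2 * (1 / l\<^sup>2 * r powr (5/4)))" using N1 del by (intro mult_left_mono) auto
    moreover have "8 * r\<^sup>2 \<le> 8 * r powr (5/4)" using powr_le_powr[of r "5/4" 2] r r1 by simp
    ultimately show ?thesis by (simp add: B_def distrib_right)
  qed
  \<comment> \<open>The Lipschitz bound loses \<open>1 / T\<close> and the Taylor estimate
    multiplies it by \<open>L\<close>; their quotient is \<open>1 / l^2\<close>.\<close>
  have t3: "(\<Lambda> * B / T) * L * r\<^sup>2 = \<Lambda> / l\<^sup>2 * (B * r\<^sup>2)"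
    using l r by (simp add: L_def T_def power2_eq_square)
  have tay2: "24000 * (A / L\<^sup>2 + B + (\<Lambda> * B / T) * L) * r\<^sup>2 \<le> 24000 * (3 * N * l powr (3/4) + (1 + \<Lambda> / l\<^sup>2) * (8 + 2000000 * N * \<delta> / l\<^sup>2)) * r powr (5/4)"
  proof -
    have "24000 * (A / L\<^sup>2 + B + (\<Lambda> * B / T) * L) * r\<^sup>2 = 24000 * (A / L\<^sup>2 * r\<^sup>2 + B * r\<^sup>2 + (\<Lambda> * B / T) * L * r\<^sup>2)"
      by (simp only: distrib_right mult.assoc)
    also have "\<dots> = 24000 * (A / L\<^sup>2 * r\<^sup>2 + (1 + \<Lambda> / l\<^sup>2) * (B * r\<^sup>2))"
      unfolding t3 by (simp add: algebra_simps)
    also have "\<dots> \<le> 24000 * (3 * N * l powr (3/4) * r powr (5/4) + (1 + \<Lambda> / l\<^sup>2) * ((8 + 2000000 * N * \<delta> / l\<^sup>2) * r powr (5/4)))"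
      using \<Lambda> by (intro mult_left_mono add_mono t1 t2) auto
    finally show ?thesis by (simp only: distrib_right mult.assoc)
  qed
  \<comment> \<open>The remainder is expanded around \<open>y\<close> instead of 0. Its affine part
    is reproduced by the even kernel, so only the remainder based at \<open>y\<close> and an
    increment of \<open>Y2\<close> have to be averaged, both over distances up to
    \<open>T\<close>.\<close>
  have close: "\<bar>k y - uh y 0\<bar> \<le> (N * l powr (5/4) + 456 * N * \<delta>) * r powr (5/4)" if y: "y \<in> past_cyl 0 r" for y
  proof -
    have y12: "y \<in> past_cyl 0 (1/2)" using y past_cyl_mono[of r "1/2" 0] r rL L by auto
    have y4: "y \<in> past_cyl 0 (1/4)" using y past_cyl_mono[of r "1/4" 0] r rL L by auto
    let ?g = "\<lambda>w. uh w y + (3 * (v 0 - v y)) * (Y2 w - Y2 y)"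
    have e: "uh w 0 = ?g w + uh y 0 - (\<Sum>i\<in>UNIV. (n i 0 - n i y) * snd (w - y) $ i)" for w
      using vrem_three[of v Y2 Y3 w 0 y] by simp
    let ?I = "\<lambda>f. conv (PsiT \<Phi> T) f y"
    have "has_conv (PsiT \<Phi> T) y (\<lambda>w. ?g w + uh y 0 - (\<Sum>i\<in>UNIV. (n i 0 - n i y) * snd (w - y) $ i))
        (?I ?g + ?I (\<lambda>_. uh y 0) - (\<Sum>i\<in>UNIV. (n i 0 - n i y) * ?I (\<lambda>w. snd (w - y) $ i)))"
      by (intro has_conv_diff[where g="\<lambda>w. \<Sum>i\<in>UNIV. (n i 0 - n i y) * snd (w - y) $ i"] has_conv_add[where g="\<lambda>_. uh y 0"] has_conv_sum has_conv_cmult has_convI psi_cont_csupp T continuous_intros)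
    from has_convD[OF this] have "?I (\<lambda>w. uh w 0) = ?I ?g + uh y 0"
      unfolding e[symmetric] conv_const[OF PsiT_bump[OF ker T(1)]] conv_linear_zero[OF PsiT_bump[OF ker T(1)]] by simp
    then have "k y - uh y 0 = ?I ?g" by (simp add: k_def)
    also have "\<bar>\<dots>\<bar> \<le> N * T powr (5/4) + 456 * N * r powr (9/20) * (\<delta> * T powr (19/20))"
    proof (rule conv_bound[OF PsiT_bump[OF ker T(1)]])
      show "continuous_on UNIV ?g" by (intro continuous_intros)
      fix q assume "q \<in> supp_box T"
      then have w: "y - q \<in> past_cyl y T" by (simp add: supp_box_Qc[of q _ y])
      define w where "w = y - q"
      have w4: "w \<in> past_cyl y (1/4)" using w past_cyl_mono[of T "1/4" y] T by (auto simp: w_def)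
      have d: "pdist w y \<le> T" using w T by (simp add: past_cyl_iff w_def)
      have 1: "\<bar>uh w y\<bar> \<le> N * T powr (5/4)" by (rule pdist_powr_mono[OF HN[OF y12 w4] d]) (use N1 in auto)
      have 2: "\<bar>Y2 w - Y2 y\<bar> \<le> \<delta> * T powr (19/20)" by (rule pdist_powr_mono[OF Y2h d]) (use d T del in auto)
      have 3: "\<bar>3 * (v 0 - v y)\<bar> \<le> 456 * N * r powr (9/20)"
        using pdist_powr_mono[OF dv2[OF zero y4], of r] y r N1 by (simp add: abs_mult abs_minus_commute past_cyl_iff)
      have "\<bar>(3 * (v 0 - v y)) * (Y2 w - Y2 y)\<bar> \<le> 456 * N * r powr (9/20) * (\<delta> * T powr (19/20))"
        unfolding abs_mult[of "3 * (v 0 - v y)"] by (intro mult_mono 2 3) (use N1 in auto)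
      with 1 show "\<bar>uh (y - q) y + (3 * (v 0 - v y)) * (Y2 (y - q) - Y2 y)\<bar> \<le> N * T powr (5/4) + 456 * N * r powr (9/20) * (\<delta> * T powr (19/20))"
        unfolding w_def by linarith
    qed
    also have "\<dots> \<le> N * (l powr (5/4) * r powr (5/4)) + 456 * N * \<delta> * r powr (5/4)"
    proof (intro add_mono mult_left_mono)
      show "T powr (5/4) \<le> l powr (5/4) * r powr (5/4)" using l r by (simp add: T_def powr_mult)
      have "T powr (19/20) \<le> r powr (19/20)" using T Tr r by (intro powr_mono2) auto
      then have "r powr (9/20) * T powr (19/20) \<le> r powr (9/20) * r powr (19/20)" by (intro mult_left_mono) auto
      also have "\<dots> \<le> r powr (5/4)" using r r1 powr_le_powr[of r "5/4" "7/5"] by (simp flip: powr_add)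
      finally have "456 * N * \<delta> * (r powr (9/20) * T powr (19/20)) \<le> 456 * N * \<delta> * r powr (5/4)" using N1 del by (intro mult_left_mono) auto
      then show "456 * N * r powr (9/20) * (\<delta> * T powr (19/20)) \<le> 456 * N * \<delta> * r powr (5/4)" by (simp add: mult_ac)
    qed (use N1 in auto)
    finally show ?thesis by (simp add: distrib_right mult.assoc)
  qed
  show ?thesis
  proof (intro exI ballI)
    fix y assume y: "y \<in> past_cyl 0 r"
    show "\<bar>uh y 0 - k 0 - (\<Sum>i\<in>UNIV. pdv (ex_dir i) k 0 * snd y $ i)\<bar> \<le> (24000 * (3 * N * l powr (3/4) + (1 + \<Lambda> / l\<^sup>2) * (8 + 2000000 * N * \<delta> / l\<^sup>2)) + N * l powr (5/4) + 456 * N * \<delta>) * r powr (5/4)"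
      using order_trans[OF tay[OF y] tay2] close[OF y] unfolding distrib_right by (simp only: distrib_right abs_le_iff) linarith
  qed
qed

end

section \<open>Campanato iteration and the improved local bound\<close>

context local_pde begin

text \<open>Affine approximation at all scales makes the slopes \<open>a r\<close> nearly constant
  under halving of \<open>r\<close>. Because the remainder is already stripped of its gradient, the
  slopes tend to 0 with \<open>r\<close>, and summing their differences bounds them by a multiple of
  \<open>\<omega>\<close>. Three components with constant 64, plus 2, give 194.\<close>

lemma campanato:
  assumes l: "0 < l" "l \<le> 1" and \<omega>: "0 \<le> \<omega>"
    and ap: "\<And>r. 0 < r \<Longrightarrow> r \<le> l / 8 \<Longrightarrow> \<exists>a c. \<forall>y\<in>past_cyl 0 r. \<bar>uh y 0 - c - (\<Sum>i\<in>UNIV. a i * snd y $ i)\<bar> \<le> \<omega> * r powr (5/4)"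
    and y: "y \<in> past_cyl 0 (l / 8)"
  shows "\<bar>uh y 0\<bar> \<le> 194 * \<omega> * pdist y 0 powr (5/4)"
proof -
  \<comment> \<open>The constant term costs only a factor 2, since the remainder vanishes at
    0.\<close>
  have exA: "\<exists>a. \<forall>y\<in>past_cyl 0 r. \<bar>uh y 0 - (\<Sum>i\<in>UNIV. a i * snd y $ i)\<bar> \<le> 2 * \<omega> * r powr (5/4)" if r: "0 < r" "r \<le> l / 8" for r
  proof -
    from ap[OF r] obtain a c where ac: "\<And>y. y \<in> past_cyl 0 r \<Longrightarrow> \<bar>uh y 0 - c - (\<Sum>i\<in>UNIV. a i * snd y $ i)\<bar> \<le> \<omega> * r powr (5/4)" by blast
    have c: "\<bar>c\<bar> \<le> \<omega> * r powr (5/4)" using ac[OF past_cyl_center] r by (simp add: vrem_self)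
    show ?thesis
    proof (intro exI[of _ a] ballI)
      fix y assume "y \<in> past_cyl 0 r"
      from ac[OF this] c show "\<bar>uh y 0 - (\<Sum>i\<in>UNIV. a i * snd y $ i)\<bar> \<le> 2 * \<omega> * r powr (5/4)" by linarith
    qed
  qed
  define a where "a = (\<lambda>r. SOME a. \<forall>y\<in>past_cyl 0 r. \<bar>uh y 0 - (\<Sum>i\<in>UNIV. a i * snd y $ i)\<bar> \<le> 2 * \<omega> * r powr (5/4))"
  have a: "\<bar>uh y 0 - (\<Sum>i\<in>UNIV. a r i * snd y $ i)\<bar> \<le> 2 * \<omega> * r powr (5/4)" if "0 < r" "r \<le> l / 8" "y \<in> past_cyl 0 r" for r y
    using someI_ex[OF exA[OF that(1,2)]] that(3) unfolding a_def by (rule bspec)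
  have zero: "(0::pt) \<in> past_cyl 0 (1/2)" by (rule past_cyl_center) simp
  have axisb: "\<bar>uh (s *\<^sub>R ex_dir i) 0 - a r i * s\<bar> \<le> 2 * \<omega> * r powr (5/4)" if "0 < r" "r \<le> l / 8" "0 \<le> s" "s \<le> r" for r s i
  proof -
    have "s *\<^sub>R ex_dir i \<in> past_cyl 0 r" using ex_in_Qc[of 0 s i] past_cyl_mono[of "\<bar>s\<bar>" r 0] that by auto
    from a[OF that(1,2) this] show ?thesis by (simp only: sum_axis)
  qed
  \<comment> \<open>\<open>HN\<close> enters only at the last of \<open>m\<close> halvings, so its
    constant is damped by \<open>(7/8)^m\<close> and disappears in the limit. The number 64 is 8 /
    (1 - 7/8).\<close>
  have ab: "\<bar>a r i\<bar> \<le> (64 * \<omega> + (N + 2 * \<omega>) * (7/8)^m) * r powr (1/4)" if "0 < r" "r \<le> l / 8" for r i m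
    using that
  proof (induction m arbitrary: r)
    case 0
    have "r *\<^sub>R ex_dir i \<in> past_cyl 0 (1/4)" using ex_in_Qc[of 0 r i] past_cyl_mono[of "\<bar>r\<bar>" "1/4" 0] 0 l by auto
    from HN[OF zero this] have "\<bar>uh (r *\<^sub>R ex_dir i) 0\<bar> \<le> N * r powr (5/4)" using pdist_ex[of 0 r i] 0 by simp
    with axisb[OF 0, of r i] 0 have "\<bar>a r i * r\<bar> \<le> N * r powr (5/4) + 2 * \<omega> * r powr (5/4)" by linarith
    also have "\<dots> = (N + 2 * \<omega>) * r powr (1/4) * r" using powr_add[of r "1/4" 1] 0 by (simp add: algebra_simps)
    finally have "\<bar>a r i\<bar> \<le> (N + 2 * \<omega>) * r powr (1/4)" using 0 by (simp add: abs_mult)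
    also have "\<dots> \<le> (64 * \<omega> + (N + 2 * \<omega>) * (7/8)^0) * r powr (1/4)" using \<omega> by (intro mult_right_mono) auto
    finally show ?case .
  next
    case (Suc m)
    have r2: "0 < r / 2" "r / 2 \<le> l / 8" using Suc by auto
    have "(r/2) powr (5/4) \<le> r powr (5/4)" using Suc by (intro powr_mono2) auto
    then have "2 * \<omega> * (r/2) powr (5/4) \<le> 2 * \<omega> * r powr (5/4)" using \<omega> by (intro mult_left_mono) auto
    with axisb[OF Suc(2,3), of "r/2" i] axisb[OF r2, of "r/2" i] Suc
    have "\<bar>a r i * (r/2) - a (r/2) i * (r/2)\<bar> \<le> 4 * \<omega> * r powr (5/4)" by fastforce
    also have "a r i * (r/2) - a (r/2) i * (r/2) = (a r i - a (r/2) i) * (r/2)" by (simp add: algebra_simps)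
    finally have "\<bar>a r i - a (r/2) i\<bar> * (r/2) \<le> 8 * \<omega> * r powr (1/4) * (r/2)"
      using powr_add[of r "1/4" 1] Suc by (simp add: abs_mult)
    then have d: "\<bar>a r i - a (r/2) i\<bar> \<le> 8 * \<omega> * r powr (1/4)" using Suc by (simp only: mult_le_cancel_right_pos[OF r2(1)])
    have q: "(r/2) powr (1/4) \<le> 7/8 * r powr (1/4)"
    proof -
      have "((1/2::real) powr (1/4))^4 = 1/2" by (simp add: powr_power)
      then have "((1/2::real) powr (1/4))^4 \<le> (7/8)^4" by (simp add: eval_nat_numeral)
      then have "(1/2::real) powr (1/4) \<le> 7/8" using power_le_imp_le_base[of _ 3 "7/8::real"] by simp
      then have "(1/2::real) powr (1/4) * r powr (1/4) \<le> 7/8 * r powr (1/4)" by (intro mult_right_mono) auto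
      moreover have "(r/2) powr (1/4) = (1/2::real) powr (1/4) * r powr (1/4)" using powr_mult[of "1/2" r "1/4"] Suc by simp
      ultimately show ?thesis by simp
    qed
    have "\<bar>a (r/2) i\<bar> \<le> (64 * \<omega> + (N + 2 * \<omega>) * (7/8)^m) * (r/2) powr (1/4)" by (rule Suc.IH[OF r2])
    also have "\<dots> \<le> (64 * \<omega> + (N + 2 * \<omega>) * (7/8)^m) * (7/8 * r powr (1/4))"
      using \<omega> N1 by (intro mult_left_mono q) auto
    finally have "\<bar>a r i\<bar> \<le> (64 * \<omega> + (N + 2 * \<omega>) * (7/8)^m) * (7/8 * r powr (1/4)) + 8 * \<omega> * r powr (1/4)" using d by linarith
    also have "\<dots> = (64 * \<omega> + (N + 2 * \<omega>) * (7/8)^(Suc m)) * r powr (1/4)" by (simp add: algebra_simps)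
    finally show ?case .
  qed
  have ab2: "\<bar>a r i\<bar> \<le> 64 * \<omega> * r powr (1/4)" if "0 < r" "r \<le> l / 8" for r i
  proof (rule LIMSEQ_le_const)
    have "(\<lambda>m. (7/8::real)^m) \<longlonglongrightarrow> 0" by (rule LIMSEQ_power_zero) simp
    from tendsto_mult[OF tendsto_add[OF tendsto_const tendsto_mult[OF tendsto_const this]] tendsto_const, of "64 * \<omega>" "N + 2 * \<omega>" "r powr (1/4)"]
    show "(\<lambda>m. (64 * \<omega> + (N + 2 * \<omega>) * (7/8)^m) * r powr (1/4)) \<longlonglongrightarrow> 64 * \<omega> * r powr (1/4)" by simp
    show "\<exists>N'. \<forall>m\<ge>N'. \<bar>a r i\<bar> \<le> (64 * \<omega> + (N + 2 * \<omega>) * (7/8)^m) * r powr (1/4)" using ab[OF that] by blast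
  qed
  show ?thesis
  proof (cases "y = 0")
    case False
    define d where "d = pdist y 0"
    have d: "0 < d" "d \<le> l / 8" using False y l by (auto simp: d_def pdist_pos past_cyl_iff)
    have yd: "y \<in> past_cyl 0 d" using y l by (simp add: d_def past_cyl_iff)
    have "\<bar>\<Sum>i\<in>UNIV. a d i * snd y $ i\<bar> \<le> 3 * (64 * \<omega> * d powr (1/4) * d)"
    proof (rule sum_comp_bound[OF ab2[OF d]])
      show "\<bar>snd y $ i\<bar> \<le> d" for i using pdist_comp[of y 0 i] by (simp add: d_def)
    qed
    also have "\<dots> = 192 * \<omega> * d powr (5/4)" using powr_add[of d "1/4" 1] d by simp
    finally show ?thesis using a[OF d yd] unfolding d_def[symmetric] by linarith
  qed (simp add: vrem_self)
qed

text \<open>At distances above \<open>l / 8\<close> the power of the distance is at least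
  \<open>l^2 / 64\<close>, so the plain sup bound suffices. The gradient is controlled by
  \<open>nu_sigma\<close> with a step so small that the coefficient of \<open>N\<close> becomes 3/2
  * 64/2000 < 1/20.\<close>

lemma far_bound:
  assumes l: "0 < l" "l \<le> 1" and s: "0 < \<sigma>" "\<sigma> \<le> 1/4" "\<sigma> powr (1/4) \<le> l\<^sup>2 / 2000"
    and y: "y \<in> past_cyl 0 (1/2)" and far: "l / 8 \<le> pdist y 0"
  shows "\<bar>uh y 0\<bar> \<le> (N / 20 + 64 / l\<^sup>2 * (11 + 17 / \<sigma>)) * pdist y 0 powr (5/4)"
proof -
  define d where "d = pdist y 0"
  have d: "0 < d" "d \<le> 1/2" "l / 8 \<le> d" using y far l by (auto simp: d_def past_cyl_iff)
  have zero: "(0::pt) \<in> past_cyl 0 (1/2)" by (rule past_cyl_center) simp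
  have n: "\<bar>n i 0\<bar> \<le> N * \<sigma> powr (1/4) + 11 / \<sigma>" for i
  proof -
    have "\<bar>n i 0\<bar> * \<sigma> \<le> N * \<sigma> powr (5/4) + 11" by (rule nu_sigma[OF zero s(1,2)])
    also have "\<dots> = (N * \<sigma> powr (1/4) + 11 / \<sigma>) * \<sigma>" using s powr_add[of \<sigma> "1/4" 1] by (simp add: distrib_right)
    finally show ?thesis using s by simp
  qed
  have "y \<in> past_cyl 0 1" using y past_cyl_mono[of "1/2" 1 0] by auto
  then have "\<bar>vinc v Y2 Y3 y 0\<bar> \<le> 11" using d past_cyl_center[of 1 0] by (intro U_bd) (auto simp: d_def)
  moreover have "\<bar>\<Sum>i\<in>UNIV. n i 0 * snd (y - 0) $ i\<bar> \<le> 3 * ((N * \<sigma> powr (1/4) + 11 / \<sigma>) * (1/2))"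
  proof (rule sum_comp_bound[OF n])
    show "\<bar>snd (y - 0) $ i\<bar> \<le> 1/2" for i using pdist_comp[of y 0 i] d by (simp add: d_def)
  qed
  moreover have "3 * ((N * \<sigma> powr (1/4) + 11 / \<sigma>) * (1/2)) = 3/2 * (N * \<sigma> powr (1/4)) + 33/2 * (1 / \<sigma>)" by (simp add: field_simps)
  moreover have "17 / \<sigma> = 17 * (1 / \<sigma>)" "0 < 1 / \<sigma>" using s by auto
  ultimately have "\<bar>uh y 0\<bar> \<le> 11 + 3/2 * (N * \<sigma> powr (1/4)) + 17 / \<sigma>"
    unfolding vrem_def by linarith
  also have "\<dots> \<le> 11 + 3/2 * (N * (l\<^sup>2 / 2000)) + 17 / \<sigma>"
    using s N1 by (intro add_mono mult_left_mono) auto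
  finally have b: "\<bar>uh y 0\<bar> \<le> 11 + 3/2 * (N * (l\<^sup>2 / 2000)) + 17 / \<sigma>" .
  have dl: "1 \<le> 64 / l\<^sup>2 * d powr (5/4)"
  proof -
    have "(l/8)\<^sup>2 \<le> d powr 2" using power_mono[OF d(3), of 2] l d by simp
    also have "\<dots> \<le> d powr (5/4)" using d by (intro powr_le_powr) auto
    finally have "l\<^sup>2 / 64 \<le> d powr (5/4)" by (simp add: power_divide)
    then show ?thesis using l by (simp add: field_simps)
  qed
  have "0 \<le> 11 + 3/2 * (N * (l\<^sup>2 / 2000)) + 17 / \<sigma>" using N1 s by (intro add_nonneg_nonneg) auto
  from mult_left_mono[OF dl this] b
  have "\<bar>uh y 0\<bar> \<le> (11 + 3/2 * (N * (l\<^sup>2 / 2000)) + 17 / \<sigma>) * (64 / l\<^sup>2 * d powr (5/4))" by simp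
  also have "\<dots> = (3/2 * (64/2000) * N + 64 / l\<^sup>2 * (11 + 17 / \<sigma>)) * d powr (5/4)" using l by (simp add: field_simps)
  also have "\<dots> \<le> (N / 20 + 64 / l\<^sup>2 * (11 + 17 / \<sigma>)) * d powr (5/4)" using N1 by (intro mult_right_mono add_right_mono) auto
  finally show ?thesis by (simp add: d_def)
qed

text \<open>Near 0 the Campanato bound is used, away from 0 the crude one. The value of
  \<open>l\<close> makes the factor of \<open>N\<close> in \<open>\<omega>\<close> at most 1/10^6,
  hence 194 times it below 1/20; the hypothesis on \<open>\<delta>\<close> controls the terms with
  negative powers of \<open>l\<close>. The cube contributes 24000 * 8 = 192000, which does not
  involve \<open>N\<close>.\<close>

lemma improve:
  assumes lip: "\<And>T f z s i B. \<lbrakk>T > 0; continuous_on UNIV f; \<bar>s\<bar> \<le> T;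
      \<And>y. y \<in> supp_box (2 * T) \<Longrightarrow> \<bar>conv (PsiT \<Phi> (T / 2)) f (z - y)\<bar> \<le> B\<rbrakk>
      \<Longrightarrow> \<bar>conv (PsiT \<Phi> T) f (z + s *\<^sub>R ex_dir i) - conv (PsiT \<Phi> T) f z\<bar> \<le> \<Lambda> * \<bar>s\<bar> * B / T"
    and \<Lambda>: "0 \<le> \<Lambda>" and l: "l = 1 / 10^16"
    and \<delta>: "\<delta> * (24000 * (1 + \<Lambda> / l\<^sup>2) * (2000000 / l\<^sup>2) + 456) \<le> 1 / 10^7"
    and y: "y \<in> past_cyl 0 (1/2)"
  shows "\<bar>uh y 0\<bar> \<le> (N / 20 + (194 * (192000 * (1 + \<Lambda> / l\<^sup>2)) + 64 / l\<^sup>2 * (11 + 17 / (l\<^sup>2 / 2000)^4))) * pdist y 0 powr (5/4)"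
proof (cases "pdist y 0 \<le> l / 8")
  case True
  define G where "G = 1 + \<Lambda> / l\<^sup>2"
  have G: "0 \<le> G" using \<Lambda> by (simp add: G_def)
  define \<omega> where "\<omega> = 24000 * (3 * N * l powr (3/4) + (1 + \<Lambda> / l\<^sup>2) * (8 + 2000000 * N * \<delta> / l\<^sup>2)) + N * l powr (5/4) + 456 * N * \<delta>"
  \<comment> \<open>A fourth power turns the quarter exponents into integer ones, so
    \<open>l powr (3/4)\<close> is evaluated exactly.\<close>
  have l4: "l = (1/10000) powr 4" unfolding l by (simp add: power_divide)
  have p34: "l powr (3/4) = 1 / 10^12" unfolding l4 powr_powr by (simp add: power_divide)
  have "l powr (5/4) \<le> l powr (3/4)" by (rule powr_le_powr) (use l in auto)
  then have p54: "N * l powr (5/4) \<le> N * (1 / 10^12)" using p34 N1 by (intro mult_left_mono) auto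
  have \<omega>0: "0 \<le> \<omega>" using N1 del \<Lambda> by (auto simp: \<omega>_def intro!: add_nonneg_nonneg mult_nonneg_nonneg divide_nonneg_nonneg)
  have "\<omega> = 72000 * N / 10^12 + 192000 * G + N * (\<delta> * (24000 * G * (2000000 / l\<^sup>2) + 456)) + N * l powr (5/4)"
    unfolding \<omega>_def p34 G_def[symmetric] by (simp add: algebra_simps)
  also have "N * (\<delta> * (24000 * G * (2000000 / l\<^sup>2) + 456)) \<le> N * (1 / 10^7)"
    using \<delta> N1 unfolding G_def by (intro mult_left_mono) auto
  finally have "\<omega> \<le> 72000 * N / 10^12 + 192000 * G + N * (1 / 10^7) + N * (1 / 10^12)" using p54 by linarith
  also have "\<dots> \<le> N / 10^6 + 192000 * G" using N1 by simp
  finally have \<omega>1: "\<omega> \<le> N / 10^6 + 192000 * G" .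
  have "\<bar>uh y 0\<bar> \<le> 194 * \<omega> * pdist y 0 powr (5/4)"
  proof (rule campanato[of l])
    show "y \<in> past_cyl 0 (l/8)" using True y l by (simp add: past_cyl_iff)
    show "\<exists>a c. \<forall>y\<in>past_cyl 0 r. \<bar>uh y 0 - c - (\<Sum>i\<in>UNIV. a i * snd y $ i)\<bar> \<le> \<omega> * r powr (5/4)" if r: "0 < r" "r \<le> l / 8" for r
      unfolding \<omega>_def by (rule one_scale[OF lip \<Lambda> _ _ r]) (use l in auto)
  qed (use l \<omega>0 in auto)
  also have "\<dots> \<le> (N / 20 + (194 * (192000 * (1 + \<Lambda> / l\<^sup>2)) + 64 / l\<^sup>2 * (11 + 17 / (l\<^sup>2 / 2000)^4))) * pdist y 0 powr (5/4)"
  proof (rule mult_right_mono)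
    have "0 \<le> 64 / l\<^sup>2 * (11 + 17 / (l\<^sup>2 / 2000)^4)" by (intro mult_nonneg_nonneg add_nonneg_nonneg divide_nonneg_nonneg) auto
    moreover have "194 * \<omega> \<le> 194 * (N / 10^6) + 194 * (192000 * G)" using \<omega>1 by (simp add: distrib_left)
    moreover have "194 * (N / 10^6) \<le> N / 20" using N1 by simp
    ultimately show "194 * \<omega> \<le> N / 20 + (194 * (192000 * (1 + \<Lambda> / l\<^sup>2)) + 64 / l\<^sup>2 * (11 + 17 / (l\<^sup>2 / 2000)^4))"
      unfolding G_def[symmetric] by linarith
  qed simp
  finally show ?thesis .
next
  case False
  have "((l\<^sup>2 / 2000)^4) powr (1/4) = ((l\<^sup>2 / 2000) powr 4) powr (1/4)" using l by simp
  also have "\<dots> = l\<^sup>2 / 2000" unfolding powr_powr using l by simp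
  finally have s: "((l\<^sup>2 / 2000)^4) powr (1/4) \<le> l\<^sup>2 / 2000" by simp
  have "\<bar>uh y 0\<bar> \<le> (N / 20 + 64 / l\<^sup>2 * (11 + 17 / (l\<^sup>2 / 2000)^4)) * pdist y 0 powr (5/4)"
  proof (rule far_bound[OF _ _ _ _ s y])
    show "(l\<^sup>2 / 2000)^4 \<le> 1/4" unfolding l by (simp add: power_divide)
  qed (use l False in auto)
  also have "\<dots> \<le> (N / 20 + (194 * (192000 * (1 + \<Lambda> / l\<^sup>2)) + 64 / l\<^sup>2 * (11 + 17 / (l\<^sup>2 / 2000)^4))) * pdist y 0 powr (5/4)"
    using \<Lambda> by (intro mult_right_mono) (auto intro!: add_nonneg_nonneg)
  finally show ?thesis .
qed

end

section \<open>Iteration and barrier\<close>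

text \<open>At a positive maximum of \<open>h\<close> minus the barrier one has
  \<open>heat_op h z >= - 7 * b\<close>, with 1 from time and 2 from each space direction, while
  \<open>h z >= 1/2\<close> makes the cube at least 1/8. With error 1/16 this is contradictory as
  soon as \<open>7 * b < 1/16\<close>; for \<open>b = 2 / m^2\<close> the radius 16 suffices, since
  14/256 < 1/16.\<close>

lemma barrier:
  assumes h: "C12 h" and m: "16 \<le> m" and h2: "\<And>z. z \<in> past_cyl 0 m \<Longrightarrow> \<bar>h z\<bar> \<le> 2"
    and e: "\<And>z. z \<in> past_cyl 0 m \<Longrightarrow> \<bar>heat_op h z + (h z)^3\<bar> \<le> 1/16"
  shows "h 0 \<le> 1/2"
proof -
  define b where "b = 2 / m\<^sup>2"
  have b: "0 < b" "b * m\<^sup>2 = 2" using m by (auto simp: b_def)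
  have "16\<^sup>2 \<le> m\<^sup>2" using m by (intro power_mono) auto
  then have b7: "7 * b \<le> 7 * (2 / 256)" unfolding b_def by (intro mult_left_mono divide_left_mono) auto
  define sq where "sq = (\<lambda>z::pt. snd z \<bullet> snd z)"
  define w where "w = (\<lambda>z. h z - 1/2 - b * (sq z - fst z))"
  have "continuous_on (past_cyl 0 m) w" unfolding w_def sq_def
    by (intro continuous_intros continuous_on_subset[OF C12D(1)[OF h]]) auto
  moreover have "past_cyl (0::pt) m \<noteq> {}" using past_cyl_center[of m 0] m by fastforce
  ultimately obtain z where z: "z \<in> past_cyl 0 m" and mx': "\<forall>y\<in>past_cyl 0 m. w y \<le> w z"
    using continuous_attains_sup[OF past_cyl_compact, of 0 m w] by metis
  note mx = bspec[OF mx']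
  have "w z \<le> 0"
  proof (rule ccontr)
    assume pos: "\<not> w z \<le> 0"
    have sq0: "0 \<le> sq z" "0 \<le> - fst z" using z by (auto simp: sq_def past_cyl_def)
    have hz: "h z \<le> 2" using h2[OF z] by simp
    have far: "sq z - fst z < m\<^sup>2"
    proof (rule ccontr)
      assume "\<not> sq z - fst z < m\<^sup>2"
      then have "b * m\<^sup>2 \<le> b * (sq z - fst z)" using b by (intro mult_left_mono) auto
      with pos hz b show False unfolding w_def by linarith
    qed
    then have tL: "- (m\<^sup>2) < fst z" using sq0 by linarith
    have xL: "infnorm (snd z) < m"
    proof (rule ccontr)
      assume "\<not> infnorm (snd z) < m"
      then have "m\<^sup>2 \<le> (norm (snd z))\<^sup>2" using infnorm_le_norm[of "snd z"] m by (intro power_mono) auto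
      then have "m\<^sup>2 \<le> sq z" by (simp add: sq_def power2_norm_eq_inner)
      with far sq0 show False by linarith
    qed
    have T: "pdv et_dir h z + b \<ge> 0"
    proof (rule deriv_nonneg_left_max)
      have "((\<lambda>\<sigma>. h (z + \<sigma> *\<^sub>R et_dir) - 1/2 - b * (sq z - (fst z + \<sigma>))) has_real_derivative pdv et_dir h z + b) (at 0)"
        using C12D(2)[OF h] unfolding has_pdv_def by (auto intro!: derivative_eq_intros)
      then show "((\<lambda>\<sigma>. w (z + \<sigma> *\<^sub>R et_dir)) has_real_derivative pdv et_dir h z + b) (at 0)"
        by (simp add: w_def sq_def et_dir_def)
      show "fst z + m\<^sup>2 > 0" using tL by simp
      show "w (z + \<sigma> *\<^sub>R et_dir) \<le> w (z + 0 *\<^sub>R et_dir)" if "- (fst z + m\<^sup>2) \<le> \<sigma>" "\<sigma> \<le> 0" for \<sigma>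
      proof -
        have "z + \<sigma> *\<^sub>R et_dir \<in> past_cyl 0 m" using that z by (auto simp: past_cyl_def et_dir_def)
        from mx[OF this] show ?thesis by simp
      qed
    qed
    have J: "pdv (ex_dir j) (pdv (ex_dir j) h) z - 2 * b \<le> 0" for j
    proof (rule deriv2_nonpos_max)
      let ?c = "2 * (snd z \<bullet> axis j 1)"
      have sqe: "sq (z + \<sigma> *\<^sub>R ex_dir j) = sq z + ?c * \<sigma> + \<sigma>\<^sup>2" for \<sigma>
      proof -
        have "sq (z + \<sigma> *\<^sub>R ex_dir j) = (snd z + \<sigma> *\<^sub>R axis j 1) \<bullet> (snd z + \<sigma> *\<^sub>R axis j 1)"
          by (simp add: sq_def ex_dir_def)
        also have "\<dots> = snd z \<bullet> snd z + ?c * \<sigma> + \<sigma>\<^sup>2"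
          by (simp only: inner_add inner_scaleR_left inner_scaleR_right) 
             (simp add: inner_axis_axis power2_eq_square inner_commute distrib_left)
        finally show ?thesis by (simp add: sq_def)
      qed
      have "((\<lambda>\<sigma>. h (z + \<sigma> *\<^sub>R ex_dir j) - 1/2 - b * (sq z + ?c * \<sigma> + \<sigma>\<^sup>2 - fst z))
        has_real_derivative pdv (ex_dir j) h (z + \<sigma> *\<^sub>R ex_dir j) - b * (?c + 2 * \<sigma>)) (at \<sigma>)" for \<sigma>
        by (auto intro!: derivative_eq_intros has_pdv_at[OF C12D(4)[OF h]])
      moreover have "w (z + \<sigma> *\<^sub>R ex_dir j) = h (z + \<sigma> *\<^sub>R ex_dir j) - 1/2 - b * (sq z + ?c * \<sigma> + \<sigma>\<^sup>2 - fst z)" for \<sigma>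
        unfolding w_def sqe by (simp add: ex_dir_def)
      ultimately show "((\<lambda>\<sigma>. w (z + \<sigma> *\<^sub>R ex_dir j)) has_real_derivative pdv (ex_dir j) h (z + \<sigma> *\<^sub>R ex_dir j) - b * (?c + 2 * \<sigma>)) (at \<sigma>)" for \<sigma> by simp
      show "((\<lambda>\<sigma>. pdv (ex_dir j) h (z + \<sigma> *\<^sub>R ex_dir j) - b * (?c + 2 * \<sigma>)) has_real_derivative pdv (ex_dir j) (pdv (ex_dir j) h) z - 2 * b) (at 0)"
        using C12D(6)[OF h, of j j] unfolding has_pdv_def by (auto intro!: derivative_eq_intros)
      show "m - infnorm (snd z) > 0" using xL by simp
      show "w (z + \<sigma> *\<^sub>R ex_dir j) \<le> w (z + 0 *\<^sub>R ex_dir j)" if "\<bar>\<sigma>\<bar> < m - infnorm (snd z)" for \<sigma>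
      proof -
        have "infnorm (snd (z + \<sigma> *\<^sub>R ex_dir j)) \<le> infnorm (snd z) + infnorm (\<sigma> *\<^sub>R (axis j 1 :: real^3))"
          using infnorm_triangle[of "snd z" "\<sigma> *\<^sub>R axis j 1"] by (simp add: ex_dir_def)
        then have "infnorm (snd (z + \<sigma> *\<^sub>R ex_dir j)) \<le> m" using infnorm_axis_le[of \<sigma> j] that by linarith
        then have "z + \<sigma> *\<^sub>R ex_dir j \<in> past_cyl 0 m" using z by (auto simp: past_cyl_def ex_dir_def)
        from mx[OF this] show ?thesis by simp
      qed
    qed
    have "(\<Sum>j\<in>(UNIV::3 set). pdv (ex_dir j) (pdv (ex_dir j) h) z) \<le> (\<Sum>j\<in>(UNIV::3 set). 2 * b)"
      by (rule sum_mono) (use J in simp)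
    then have heat_op: "heat_op h z \<ge> - 7 * b" using T unfolding heat_op_def by simp
    have "b * (sq z - fst z) \<ge> 0" using b sq0 by (intro mult_nonneg_nonneg) auto
    then have "h z \<ge> 1/2" using pos unfolding w_def by linarith
    then have "(h z)^3 \<ge> (1/2)^3" by (intro power_mono) auto
    then have "(h z)^3 \<ge> 1/8" by (simp add: power3_eq_cube)
    with heat_op b7 e[OF z] show False by linarith
  qed
  then have "w 0 \<le> 0" using mx[OF past_cyl_center] m by force
  then show ?thesis by (simp add: w_def sq_def)
qed

lemma barrier_abs:
  assumes h: "C12 h" and m: "16 \<le> m" and h2: "\<And>z. z \<in> past_cyl 0 m \<Longrightarrow> \<bar>h z\<bar> \<le> 2"
    and e: "\<And>z. z \<in> past_cyl 0 m \<Longrightarrow> \<bar>heat_op h z + (h z)^3\<bar> \<le> 1/16"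
  shows "\<bar>h 0\<bar> \<le> 1/2"
proof -
  note c = C12_lin[OF h C12_const[of 0], where a="-1" and b=0 and c=0, simplified]
  have "- h 0 \<le> 1/2"
  proof (rule barrier[OF c(1) m])
    fix z assume z: "z \<in> past_cyl 0 m"
    show "\<bar>- h z\<bar> \<le> 2" using h2[OF z] by simp
    have "heat_op (\<lambda>z. - h z) z + (- h z)^3 = - (heat_op h z + (h z)^3)" by (simp add: c(5))
    then show "\<bar>heat_op (\<lambda>z. - h z) z + (- h z)^3\<bar> \<le> 1/16" using e[OF z] by (simp only: abs_minus_cancel)
  qed
  with barrier[OF h m h2 e] show ?thesis by (simp add: abs_le_iff)
qed

lemma C12_bounded:
  assumes f: "C12 f" shows "\<exists>M\<ge>0. \<forall>y\<in>past_cyl 0 R. \<bar>pdv et_dir f y\<bar> \<le> M \<and> (\<forall>i j. \<bar>pdv (ex_dir j) (pdv (ex_dir i) f) y\<bar> \<le> M)"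
proof -
  have bd: "\<exists>M\<ge>0. \<forall>y\<in>past_cyl 0 R. \<bar>g y\<bar> \<le> M" if "continuous_on UNIV g" for g :: "pt \<Rightarrow> real"
  proof -
    have "compact (g ` past_cyl 0 R)" using that by (intro compact_continuous_image past_cyl_compact) (auto intro: continuous_on_subset)
    then have "bounded (g ` past_cyl 0 R)" by (rule compact_imp_bounded)
    then obtain M where "\<forall>y\<in>past_cyl 0 R. \<bar>g y\<bar> \<le> M" unfolding bounded_iff by auto
    then show ?thesis by (intro exI[of _ "max 0 M"]) (auto simp: le_max_iff_disj)
  qed
  obtain M0 where M0: "M0 \<ge> 0" "\<And>y. y \<in> past_cyl 0 R \<Longrightarrow> \<bar>pdv et_dir f y\<bar> \<le> M0" using bd[OF C12D(3)[OF f]] by metis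
  have "\<forall>p. \<exists>M\<ge>0. \<forall>y\<in>past_cyl 0 R. \<bar>pdv (ex_dir (fst p)) (pdv (ex_dir (snd p)) f) y\<bar> \<le> M" using bd[OF C12D(7)[OF f]] by blast
  then obtain M where M: "\<And>p. M p \<ge> 0" "\<And>p y. y \<in> past_cyl 0 R \<Longrightarrow> \<bar>pdv (ex_dir (fst p)) (pdv (ex_dir (snd p)) f) y\<bar> \<le> M p" by metis
  define S where "S = M0 + (\<Sum>p\<in>UNIV. M p)"
  have "M (j, i) \<le> (\<Sum>p\<in>UNIV. M p)" for i j by (rule member_le_sum) (use M in auto)
  then have S: "M (j, i) \<le> S" "M0 \<le> S" "0 \<le> S" for i j using M0 sum_nonneg[of UNIV M] M(1) by (auto simp: S_def add_increasing)
  show ?thesis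
  proof (intro exI[of _ S] conjI ballI allI)
    fix y i j assume y: "y \<in> past_cyl 0 R"
    show "\<bar>pdv et_dir f y\<bar> \<le> S" using M0(2)[OF y] S by linarith
    show "\<bar>pdv (ex_dir j) (pdv (ex_dir i) f) y\<bar> \<le> S" using M(2)[OF y, of "(j, i)"] S(1)[of j i] by simp
  qed (rule S)
qed

section \<open>The weighted remainder bound over all subcylinders\<close>

context pde begin

definition adm :: "pt \<Rightarrow> real \<Rightarrow> bool" where
  "adm x r \<longleftrightarrow> 0 < r \<and> r \<le> 1 \<and> past_cyl x r \<subseteq> past_cyl 0 R"

text \<open>The weight is scale invariant: rescaling by \<open>r\<close> multiplies the remainder by
  \<open>r\<close> and divides distances by \<open>r\<close>, and 9/4 = 1 + 5/4. Taking all
  admissible cylinders at once allows each improvement to use the bound on smaller cylinders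
  inside.\<close>

definition UB :: "real \<Rightarrow> bool" where
  "UB N \<longleftrightarrow> (\<forall>x r y. adm x r \<longrightarrow> y \<in> past_cyl x (r/2) \<longrightarrow> r powr (9/4) * \<bar>vrem v Y2 Y3 y x\<bar> \<le> N * pdist y x powr (5/4))"

lemma UB_mono: "UB N \<Longrightarrow> N \<le> N' \<Longrightarrow> UB N'"
  unfolding UB_def by (meson mult_right_mono order_trans powr_ge_zero)

text \<open>Qualitative input only: second order Taylor expansion with derivatives bounded on a
  compact cylinder. The size of this constant is forgotten in \<open>UB_final\<close>.\<close>

lemma UB_exists: "\<exists>N\<ge>1. UB N"
proof -
  obtain Mv where Mv0: "0 \<le> Mv" and Mv: "\<forall>y\<in>past_cyl 0 R. \<bar>pdv et_dir v y\<bar> \<le> Mv \<and> (\<forall>i j. \<bar>pdv (ex_dir j) (pdv (ex_dir i) v) y\<bar> \<le> Mv)"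
    using C12_bounded[OF reg(1), of R] by (elim exE conjE)
  obtain M2 where M20: "0 \<le> M2" and M2: "\<forall>y\<in>past_cyl 0 R. \<bar>pdv et_dir Y2 y\<bar> \<le> M2 \<and> (\<forall>i j. \<bar>pdv (ex_dir j) (pdv (ex_dir i) Y2) y\<bar> \<le> M2)"
    using C12_bounded[OF reg(2), of R] by (elim exE conjE)
  obtain M3 where M30: "0 \<le> M3" and M3: "\<forall>y\<in>past_cyl 0 R. \<bar>pdv et_dir Y3 y\<bar> \<le> M3 \<and> (\<forall>i j. \<bar>pdv (ex_dir j) (pdv (ex_dir i) Y3) y\<bar> \<le> M3)"
    using C12_bounded[OF reg(3), of R] by (elim exE conjE)
  note M = Mv0 M20 M30
  define a where "a = Mv + M3 + 6 * M2"
  have a0: "0 \<le> a" using M by (simp add: a_def)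
  have "UB (10 * a)"
    unfolding UB_def
  proof (intro allI impI)
    fix x r y assume ad: "adm x r" and y: "y \<in> past_cyl x (r/2)"
    define d where "d = pdist y x"
    have r: "0 < r" "r \<le> 1" "past_cyl x r \<subseteq> past_cyl 0 R" using ad by (auto simp: adm_def)
    have d: "0 \<le> d" "d \<le> r / 2" "y \<in> past_cyl x d" using y r by (auto simp: d_def past_cyl_iff)
    have sub: "past_cyl x d \<subseteq> past_cyl 0 R" using past_cyl_mono[of d r x] d r by auto
    have "x \<in> past_cyl 0 R" using r past_cyl_center[of r x] by auto
    then have vx: "\<bar>3 * v x\<bar> \<le> 6" using vb by (simp add: abs_mult)
    let ?a = "\<lambda>y. 1 * v y + 1 * Y3 y + 0"
    let ?b = "\<lambda>y. 1 * ?a y + (3 * v x) * Y2 y + 0"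
    note A = C12_lin[OF reg(1) reg(3), where a=1 and b=1 and c=0]
    note B = C12_lin[OF A(1) reg(2), where a=1 and b="3 * v x" and c=0]
    have tri: "\<bar>1 * (1 * p + 1 * q) + (3 * v x) * s\<bar> \<le> a" if "\<bar>p\<bar> \<le> Mv" "\<bar>q\<bar> \<le> M3" "\<bar>s\<bar> \<le> M2" for p q s
    proof -
      have "\<bar>(3 * v x) * s\<bar> \<le> 6 * M2" unfolding abs_mult[of _ s] by (intro mult_mono vx that) auto
      then show ?thesis using that by (simp add: a_def)
    qed
    have "\<bar>?b y - ?b x - (\<Sum>i\<in>UNIV. pdv (ex_dir i) ?b x * (snd y - snd x) $ i)\<bar> \<le> (a + 9 * a) * d\<^sup>2"
    proof (rule taylor_par[OF B(1) d(1) d(3)])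
      fix z assume "z \<in> past_cyl x d"
      then have z: "z \<in> past_cyl 0 R" using sub by auto
      show "\<bar>pdv et_dir ?b z\<bar> \<le> a" unfolding B(2) A(2) by (rule tri) (use bspec[OF Mv z] bspec[OF M2 z] bspec[OF M3 z] in auto)
      show "\<bar>pdv (ex_dir j) (pdv (ex_dir i) ?b) z\<bar> \<le> a" for i j unfolding B(4) A(4) by (rule tri) (use bspec[OF Mv z] bspec[OF M2 z] bspec[OF M3 z] in auto)
    qed
    moreover have "?b y - ?b x - (\<Sum>i\<in>UNIV. pdv (ex_dir i) ?b x * (snd y - snd x) $ i) = vrem v Y2 Y3 y x"
      unfolding vrem_def vinc_def vgrad_def B(3) A(3) by (simp add: algebra_simps)
    ultimately have u: "\<bar>vrem v Y2 Y3 y x\<bar> \<le> 10 * a * d\<^sup>2" by simp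
    have "d\<^sup>2 \<le> d powr (5/4)" using powr_le_powr[of d "5/4" 2] d r by (cases "d = 0") auto
    then have "10 * a * d\<^sup>2 \<le> 10 * a * d powr (5/4)" using a0 by (intro mult_left_mono) auto
    moreover have "r powr (9/4) * \<bar>vrem v Y2 Y3 y x\<bar> \<le> 1 * \<bar>vrem v Y2 Y3 y x\<bar>" using r by (intro mult_right_mono powr_le1) auto
    ultimately show "r powr (9/4) * \<bar>vrem v Y2 Y3 y x\<bar> \<le> 10 * a * pdist y x powr (5/4)" using u by (simp add: d_def)
  qed
  then have "UB (max 1 (10 * a))" by (rule UB_mono) simp
  then show ?thesis by (intro exI[of _ "max 1 (10 * a)"]) auto
qed

text \<open>A base point in the half cylinder is still the centre of an admissible cylinder of
  radius \<open>r/2\<close>. Halving the radius in the weight costs \<open>2 powr (9/4)\<close>,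
  which is at most 5.\<close>

lemma rescale_loc:
  assumes UB: "UB N" and N: "1 \<le> N" and ad: "adm x r"
  shows "local_pde \<Phi> \<delta> (\<lambda>z. r * v (x + dil r z)) (\<lambda>z. Y2 (x + dil r z)) (\<lambda>z. r * Y3 (x + dil r z))
    (\<lambda>z. r * \<tau>1 (x + dil r z)) (\<lambda>z. r\<^sup>2 * \<tau>2 (x + dil r z)) (\<lambda>z. r^3 * \<tau>3 (x + dil r z)) (r\<^sup>2 * C) (5 * N)"
proof -
  have r: "0 < r" "r \<le> 1" "past_cyl x r \<subseteq> past_cyl 0 R" using ad by (auto simp: adm_def)
  interpret p: pde \<Phi> \<delta> 1 "\<lambda>z. r * v (x + dil r z)" "\<lambda>z. Y2 (x + dil r z)" "\<lambda>z. r * Y3 (x + dil r z)"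
    "\<lambda>z. r * \<tau>1 (x + dil r z)" "\<lambda>z. r\<^sup>2 * \<tau>2 (x + dil r z)" "\<lambda>z. r^3 * \<tau>3 (x + dil r z)" "r\<^sup>2 * C"
    by (rule rescale) (use r in auto)
  show ?thesis
  proof
    show "1 \<le> 5 * N" using N by simp
    fix z y :: pt assume z: "z \<in> past_cyl 0 (1/2)" and y: "y \<in> past_cyl z (1/4)"
    let ?S = "\<lambda>y. x + dil r y"
    have S0: "?S 0 = x" by (simp add: dil_def zero_prod_def[symmetric])
    have Sz: "?S z \<in> past_cyl x (r * (1/2))" using dil_in_Qc[of r "1/2" x z 0] z r S0 by simp
    have Sy: "?S y \<in> past_cyl (?S z) (r * (1/4))" using dil_in_Qc[of r "1/4" x y z] y r by simp
    have "past_cyl (?S z) (r/2) \<subseteq> past_cyl x r" by (rule past_cyl_sub[OF Sz]) (use r in auto)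
    then have "adm (?S z) (r/2)" using r by (auto simp: adm_def)
    moreover have "?S y \<in> past_cyl (?S z) (r/2/2)" using Sy by simp
    ultimately have "(r/2) powr (9/4) * \<bar>vrem v Y2 Y3 (?S y) (?S z)\<bar> \<le> N * pdist (?S y) (?S z) powr (5/4)"
      using UB[unfolded UB_def, rule_format] by metis
    also have "\<dots> = N * (r powr (5/4) * pdist y z powr (5/4))" using r by (simp add: pdist_scale powr_mult)
    finally have 1: "(r/2) powr (9/4) * \<bar>vrem v Y2 Y3 (?S y) (?S z)\<bar> \<le> N * (r powr (5/4) * pdist y z powr (5/4))" .
    have 2: "(r/2) powr (9/4) = r powr (5/4) * r / 2 powr (9/4)" using r powr_add[of r "5/4" 1] by (simp add: powr_divide)
    have "r powr (5/4) * (r * \<bar>vrem v Y2 Y3 (?S y) (?S z)\<bar>) \<le> r powr (5/4) * (2 powr (9/4) * N * pdist y z powr (5/4))"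
      using 1 unfolding 2 by (simp add: field_simps)
    then have "r * \<bar>vrem v Y2 Y3 (?S y) (?S z)\<bar> \<le> 2 powr (9/4) * N * pdist y z powr (5/4)"
      using r by (subst (asm) mult_le_cancel_left_pos) auto
    also have "\<dots> \<le> 5 * N * pdist y z powr (5/4)"
    proof (intro mult_right_mono)
      have "((2::real) powr (9/4))^4 = 2^9" by (simp add: powr_power)
      then have "((2::real) powr (9/4))^4 \<le> 5^4" by simp
      then show "(2::real) powr (9/4) \<le> 5" using power_le_imp_le_base[of _ 3 "5::real"] by simp
    qed (use N in auto)
    finally show "\<bar>vrem (\<lambda>z. r * v (?S z)) (\<lambda>z. Y2 (?S z)) (\<lambda>z. r * Y3 (?S z)) y z\<bar> \<le> 5 * N * pdist y z powr (5/4)"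
      unfolding vrem_scale[OF reg(1,2,3)] using r by (simp add: abs_mult)
  qed
qed

text \<open>The local improvement is applied with constant \<open>5 * N\<close>; its factor 1/20
  therefore compensates the loss in \<open>rescale_loc\<close> and still leaves 1/4.\<close>

lemma UB_improve:
  assumes lip: "\<And>T f z s i B. \<lbrakk>T > 0; continuous_on UNIV f; \<bar>s\<bar> \<le> T;
      \<And>y. y \<in> supp_box (2 * T) \<Longrightarrow> \<bar>conv (PsiT \<Phi> (T / 2)) f (z - y)\<bar> \<le> B\<rbrakk>
      \<Longrightarrow> \<bar>conv (PsiT \<Phi> T) f (z + s *\<^sub>R ex_dir i) - conv (PsiT \<Phi> T) f z\<bar> \<le> \<Lambda> * \<bar>s\<bar> * B / T"
    and \<Lambda>: "0 \<le> \<Lambda>" and l: "l = 1 / 10^16"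
    and \<delta>: "\<delta> * (24000 * (1 + \<Lambda> / l\<^sup>2) * (2000000 / l\<^sup>2) + 456) \<le> 1 / 10^7"
    and K: "K = 194 * (192000 * (1 + \<Lambda> / l\<^sup>2)) + 64 / l\<^sup>2 * (11 + 17 / (l\<^sup>2 / 2000)^4)"
    and UB: "UB N" and N: "1 \<le> N"
  shows "UB (N / 4 + K)"
  unfolding UB_def
proof (intro allI impI)
  fix x r y assume ad: "adm x r" and y: "y \<in> past_cyl x (r/2)"
  have r: "0 < r" using ad by (auto simp: adm_def)
  interpret p: local_pde \<Phi> \<delta> "\<lambda>z. r * v (x + dil r z)" "\<lambda>z. Y2 (x + dil r z)" "\<lambda>z. r * Y3 (x + dil r z)"
    "\<lambda>z. r * \<tau>1 (x + dil r z)" "\<lambda>z. r\<^sup>2 * \<tau>2 (x + dil r z)" "\<lambda>z. r^3 * \<tau>3 (x + dil r z)" "r\<^sup>2 * C" "5 * N"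
    by (rule rescale_loc[OF UB N ad])
  define y' where "y' = dil (1/r) (y - x)"
  have Sy: "x + dil r y' = y" using r by (simp add: y'_def)
  have S0: "x + dil r 0 = x" by (simp add: dil_def zero_prod_def[symmetric])
  have y': "y' \<in> past_cyl 0 (1/2)" using dil_in_Qc[of r "1/2" x y' 0] y r Sy S0 by simp
  have "\<bar>vrem (\<lambda>z. r * v (x + dil r z)) (\<lambda>z. Y2 (x + dil r z)) (\<lambda>z. r * Y3 (x + dil r z)) y' 0\<bar> \<le> (5 * N / 20 + K) * pdist y' 0 powr (5/4)"
    unfolding K by (rule p.improve[OF lip \<Lambda> l \<delta> y'])
  moreover have "vrem (\<lambda>z. r * v (x + dil r z)) (\<lambda>z. Y2 (x + dil r z)) (\<lambda>z. r * Y3 (x + dil r z)) y' 0 = r * vrem v Y2 Y3 y x"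
    using vrem_scale[OF reg(1,2,3), of r x y' 0] unfolding Sy S0 .
  ultimately have "r * \<bar>vrem v Y2 Y3 y x\<bar> \<le> (N / 4 + K) * pdist y' 0 powr (5/4)"
    using r by (simp add: abs_mult)
  then have "r powr (5/4) * (r * \<bar>vrem v Y2 Y3 y x\<bar>) \<le> r powr (5/4) * ((N / 4 + K) * pdist y' 0 powr (5/4))"
    by (intro mult_left_mono) auto
  also have "\<dots> = (N / 4 + K) * (r * pdist y' 0) powr (5/4)" using r by (simp add: powr_mult)
  also have "r * pdist y' 0 = pdist y x" using pdist_scale[OF r, of x y' 0] Sy S0 by simp
  finally show "r powr (9/4) * \<bar>vrem v Y2 Y3 y x\<bar> \<le> (N / 4 + K) * pdist y x powr (5/4)"
    using r powr_add[of r "5/4" 1] by (simp add: mult.assoc)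
qed

text \<open>The iteration contracts towards 4 K / 3. Carrying \<open>2 * K\<close> instead leaves
  slack, and after finitely many steps the initial constant contributes less than 1.\<close>

lemma UB_final:
  assumes imp: "\<And>N. UB N \<Longrightarrow> 1 \<le> N \<Longrightarrow> UB (N / 4 + K)" and K: "1 \<le> K"
  shows "UB (2 * K + 1)"
proof -
  obtain N0 where N0: "1 \<le> N0" "UB N0" using UB_exists by blast
  have "UB (2 * K + N0 * (1/4)^j)" for j
  proof (induction j)
    case 0 show ?case using UB_mono[OF N0(2), of "2 * K + N0"] K by simp
  next
    case (Suc j)
    have "0 \<le> N0 * (1/4)^j" using N0 by simp
    from imp[OF Suc] this K have "UB ((2 * K + N0 * (1/4)^j) / 4 + K)" by simp
    then show ?case by (rule UB_mono) (use K in \<open>simp add: field_simps\<close>)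
  qed
  moreover obtain j where "(1/4::real)^j < 1 / N0" using real_arch_pow_inv[of "1 / N0" "1/4"] N0 by auto
  then have "N0 * (1/4)^j \<le> 1" using N0 by (simp add: field_simps)
  ultimately show ?thesis using UB_mono[of "2 * K + N0 * (1/4)^j" "2 * K + 1"] by simp
qed

text \<open>The radius 17 is 16 for the barrier plus 1 for the unit cylinder around each of its
  points, in which the local estimates apply. They say that \<open>h\<close>, the mollified
  \<open>v\<close>, solves the equation with the cube up to a small error.\<close>

lemma v0_bound:
  assumes R: "R = 17" and UB: "UB N" and N: "1 \<le> N" and T: "0 < T" "T \<le> 1/8"
    and T1: "18240 * N * T powr (9/20) \<le> 1/32" and T2: "1000000 * N * \<delta> * T powr (-31/20) \<le> 1/32"
  shows "\<bar>v 0\<bar> < 1"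
proof -
  let ?I = "conv (PsiT \<Phi> T)"
  note pb = PsiT_bump[OF ker T(1)]
  have cv: "continuous_on UNIV v" using reg C12D(1) by blast
  have key: "\<bar>?I (\<lambda>y. heat_op v y + heat_op Y3 y + 3 * v z * heat_op Y2 y + (v y)^3) z\<bar> \<le> 500000 * N * \<delta> * T powr (-11/20)"
    "\<And>y. y \<in> past_cyl z (1/4) \<Longrightarrow> \<bar>v y - v z\<bar> \<le> 760 * N * pdist y z powr (9/20)"
    "past_cyl z 1 \<subseteq> past_cyl 0 R" if z: "z \<in> past_cyl 0 16" for z
  proof -
    show s: "past_cyl z 1 \<subseteq> past_cyl 0 R" by (rule past_cyl_sub[OF z]) (use R in auto)
    then have ad: "adm z 1" by (simp add: adm_def)
    have S0: "z + 0 = z" by simp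
    interpret p: local_pde \<Phi> \<delta> "\<lambda>y. v (z + y)" "\<lambda>y. Y2 (z + y)" "\<lambda>y. Y3 (z + y)"
      "\<lambda>y. \<tau>1 (z + y)" "\<lambda>y. \<tau>2 (z + y)" "\<lambda>y. \<tau>3 (z + y)" C "5 * N"
      using rescale_loc[OF UB N ad] by simp
    have hs: "heat_op (\<lambda>y. f (z + y)) y = heat_op f (z + y)" if "C12 f" for f y
      using C12_scale(4)[OF that, of 1 z 1 y] by simp
    define F where "F = (\<lambda>y. heat_op v y + heat_op Y3 y + 3 * v z * heat_op Y2 y + (v y)^3)"
    have cF: "continuous_on UNIV F" unfolding F_def by (intro continuous_intros C12_heat_op_cont reg cv)
    have "\<bar>?I (\<lambda>y. F (z + y)) 0\<bar> \<le> 100000 * (5 * N) * \<delta> * T powr (-11/20)"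
      using p.fz_bound[OF past_cyl_center T] unfolding hs[OF reg(1)] hs[OF reg(2)] hs[OF reg(3)] by (simp add: F_def)
    moreover have "?I (\<lambda>y. F (z + y)) 0 = ?I F z"
      using mollify_scale[OF ker _ T(1) cF, of 1 z 0] by simp
    ultimately show "\<bar>?I (\<lambda>y. heat_op v y + heat_op Y3 y + 3 * v z * heat_op Y2 y + (v y)^3) z\<bar> \<le> 500000 * N * \<delta> * T powr (-11/20)"
      by (simp add: F_def)
    fix y assume y: "y \<in> past_cyl z (1/4)"
    have "y - z \<in> past_cyl 0 (1/4)" using y by (simp add: past_cyl_def)
    from p.dv2[OF past_cyl_center this] have "\<bar>v y - v z\<bar> \<le> 152 * (5 * N) * pdist (y - z) 0 powr (9/20)" by simp
    also have "pdist (y - z) 0 = pdist y z" by (simp add: pdist_def)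
    finally show "\<bar>v y - v z\<bar> \<le> 760 * N * pdist y z powr (9/20)" by simp
  qed
  \<comment> \<open>Bounds the oscillation of \<open>v\<close> over the kernel and hence the
    distance of \<open>h\<close> from \<open>v\<close>. Commuting the cube with mollification and
    replacing \<open>v\<close> by \<open>h\<close> in the cube cost \<open>12 * X\<close> each, and
    24 * 760 = 18240 explains the hypothesis \<open>T1\<close>.\<close>
  define X where "X = 760 * N * T powr (9/20)"
  have X: "24 * X \<le> 1/32" "0 \<le> X" using T1 N by (auto simp: X_def)
  have near: "\<bar>v y - v z\<bar> \<le> X" if "z \<in> past_cyl 0 16" "y \<in> past_cyl z T" for y z
    unfolding X_def
  proof (rule pdist_powr_mono[OF key(2)[OF that(1)]])
    show "y \<in> past_cyl z (1/4)" using that past_cyl_mono[of T "1/4" z] T by auto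
    show "pdist y z \<le> T" using that T by (simp add: past_cyl_iff)
  qed (use N in auto)
  have v2: "\<bar>v y\<bar> \<le> 2" if "z \<in> past_cyl 0 16" "y \<in> past_cyl z T" for y z
  proof -
    have "y \<in> past_cyl z 1" using that(2) past_cyl_mono[of T 1 z] T by auto
    then have "y \<in> past_cyl 0 R" using key(3)[OF that(1)] by blast
    then show ?thesis by (rule vb)
  qed
  have cube: "\<bar>a^3 - b^3\<bar> \<le> 12 * \<bar>a - b\<bar>" if "\<bar>a\<bar> \<le> 2" "\<bar>b\<bar> \<le> 2" for a b :: real
  proof -
    have "\<bar>a * a\<bar> \<le> 2 * 2" "\<bar>a * b\<bar> \<le> 2 * 2" "\<bar>b * b\<bar> \<le> 2 * 2" unfolding abs_mult by (intro mult_mono that; simp)+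
    then have "\<bar>a * a + a * b + b * b\<bar> \<le> 12" by linarith
    then have "\<bar>a * a + a * b + b * b\<bar> * \<bar>a - b\<bar> \<le> 12 * \<bar>a - b\<bar>" by (intro mult_right_mono) auto
    moreover have "a^3 - b^3 = (a * a + a * b + b * b) * (a - b)" by (simp add: power3_eq_cube algebra_simps)
    ultimately show ?thesis by (simp add: abs_mult)
  qed
  have cubeX: "\<bar>a^3 - b^3\<bar> \<le> 12 * X" if "\<bar>a\<bar> \<le> 2" "\<bar>b\<bar> \<le> 2" "\<bar>a - b\<bar> \<le> X" for a b :: real
    by (rule order_trans[OF cube[OF that(1,2)]]) (use that(3) in simp)
  define h where "h = ?I v"
  have hC: "C12 h" and hhh: "\<And>z. heat_op h z = ?I (heat_op v) z" unfolding h_def using C12_conv[OF bump_cont_csupp[OF pb] reg(1)] by auto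
  have sb: "z - q \<in> past_cyl z T" if "q \<in> supp_box T" for z q using that by (simp add: supp_box_Qc[of q _ z])
  have h2: "\<bar>h z\<bar> \<le> 2" if z: "z \<in> past_cyl 0 16" for z
    unfolding h_def by (rule conv_bound[OF pb cv v2[OF z sb]])
  have hv: "\<bar>h z - v z\<bar> \<le> X" if z: "z \<in> past_cyl 0 16" for z
  proof -
    have "h z - v z = ?I (\<lambda>y. v y - v z) z"
      unfolding h_def using conv_diff[OF bump_cont_csupp[OF pb] cv, of "\<lambda>_. v z" z] conv_const[OF pb, of "v z" z] by simp
    also have "\<bar>\<dots>\<bar> \<le> X"
    proof (rule conv_bound[OF pb])
      show "\<bar>v (z - q) - v z\<bar> \<le> X" if "q \<in> supp_box T" for q by (rule near[OF z sb[OF that]])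
    qed (intro continuous_intros cv)
    finally show ?thesis .
  qed
  have "\<bar>h 0\<bar> \<le> 1/2"
  proof (rule barrier_abs[OF hC, of 16])
    fix z assume z: "z \<in> past_cyl 0 16"
    show "\<bar>h z\<bar> \<le> 2" by (rule h2[OF z])
    have zz: "z \<in> past_cyl z T" using past_cyl_center[of T z] T by simp
    have zR: "z \<in> past_cyl 0 R" using key(3)[OF z] past_cyl_center[of 1 z] by auto
    have yR: "z - q \<in> past_cyl 0 R" if "q \<in> supp_box T" for q
      using key(3)[OF z] past_cyl_mono[of T 1 z] sb[OF that, of z] T by auto
    have c3: "continuous_on UNIV (\<lambda>y. (v y)^3)" by (intro continuous_intros cv)
    have vc: "\<bar>?I (\<lambda>y. (v y)^3) z - (v z)^3\<bar> \<le> 12 * X"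
    proof -
      have "?I (\<lambda>y. (v y)^3) z - (v z)^3 = ?I (\<lambda>y. (v y)^3 - (v z)^3) z"
        using conv_diff[OF bump_cont_csupp[OF pb] c3, of "\<lambda>_. (v z)^3" z] conv_const[OF pb, of "(v z)^3" z] by simp
      also have "\<bar>\<dots>\<bar> \<le> 12 * X"
      proof (rule conv_bound[OF pb])
        fix q assume q: "q \<in> supp_box T"
        show "\<bar>(v (z - q))^3 - (v z)^3\<bar> \<le> 12 * X"
          by (rule cubeX[OF v2[OF z sb[OF q]] v2[OF z zz] near[OF z sb[OF q]]])
      qed (intro continuous_intros cv)
      finally show ?thesis .
    qed
    have hc3: "\<bar>(h z)^3 - (v z)^3\<bar> \<le> 12 * X" by (rule cubeX[OF h2[OF z] v2[OF z zz] hv[OF z]])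
    let ?f = "\<lambda>y. heat_op v y + heat_op Y3 y + 3 * v z * heat_op Y2 y + (v y)^3"
    have "has_conv (PsiT \<Phi> T) z (\<lambda>y. ?f y - heat_op Y3 y - (3 * v z) * heat_op Y2 y - (v y)^3) (?I ?f z - ?I (heat_op Y3) z - (3 * v z) * ?I (heat_op Y2) z - ?I (\<lambda>y. (v y)^3) z)"
      by (intro has_conv_diff[where g="\<lambda>y. (v y)^3"] has_conv_diff[where g="\<lambda>y. (3 * v z) * heat_op Y2 y"] has_conv_diff[where g="heat_op Y3"] has_conv_cmult has_convI bump_cont_csupp[OF pb] continuous_intros C12_heat_op_cont reg cv)
    moreover have "(\<lambda>y. ?f y - heat_op Y3 y - (3 * v z) * heat_op Y2 y - (v y)^3) = heat_op v" by auto
    ultimately have eq: "heat_op h z = ?I ?f z - ?I (heat_op Y3) z - (3 * v z) * ?I (heat_op Y2) z - ?I (\<lambda>y. (v y)^3) z"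
      unfolding hhh by (simp only: has_conv_def)
    have e3: "?I (heat_op Y3) z = ?I \<tau>3 z" by (rule conv_cong[OF pb C12_heat_op_cont[OF reg(3)] reg(6)]) (rule eq3[OF yR])
    have e2: "?I (heat_op Y2) z = ?I \<tau>2 z" by (rule conv_cong[OF pb C12_heat_op_cont[OF reg(2)] reg(5)]) (rule eq2[OF yR])
    define P where "P = N * \<delta> * T powr (-31/20)"
    have T1': "T < 1" using T by simp
    have Nd: "\<delta> \<le> N * \<delta>" using mult_right_mono[OF N, of \<delta>] del by simp
    have toP: "\<delta> * T powr a \<le> P" if "-31/20 \<le> a" for a
      unfolding P_def using T Nd del that by (intro mult_mono powr_le_powr) auto
    have b3: "\<bar>?I \<tau>3 z\<bar> \<le> P" using n3[OF zR T(1) T1'] toP[of "-31/20"] by simp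
    have b2: "\<bar>(3 * v z) * ?I \<tau>2 z\<bar> \<le> 6 * P" unfolding abs_mult
      by (intro mult_mono order_trans[OF n2[OF zR T(1) T1'] toP]) (use v2[OF z zz] in auto)
    have b1: "\<bar>?I ?f z\<bar> \<le> 500000 * P"
    proof -
      have "500000 * N * \<delta> * T powr (-11/20) \<le> 500000 * N * \<delta> * T powr (-31/20)"
        using T N del by (intro mult_left_mono powr_le_powr) auto
      with key(1)[OF z] show ?thesis by (simp add: P_def)
    qed
    have "0 \<le> P" using N del by (simp add: P_def)
    moreover have "1000000 * P \<le> 1/32" using T2 by (simp add: P_def)
    ultimately show "\<bar>heat_op h z + (h z)^3\<bar> \<le> 1/16"
      unfolding eq e2 e3 using b1 b2 b3 vc hc3 X by linarith
  qed simp
  with hv[OF past_cyl_center[of 16 0]] X show ?thesis by linarith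
qed

end

text \<open>Only the order of choices is at stake: \<open>N\<close> depends on the kernel alone,
  \<open>T\<close> is then taken small for \<open>N\<close>, and \<open>\<delta>\<close> last. Thus
  neither the negative power of \<open>T\<close> nor that of \<open>l\<close> causes
  circularity.\<close>

lemma unit_bound:
  assumes ker: "kernel \<Phi>"
  shows "\<exists>\<delta>>0. \<delta> \<le> 1 \<and> (\<forall>v Y2 Y3 \<tau>1 \<tau>2 \<tau>3 C. pde \<Phi> \<delta> 17 v Y2 Y3 \<tau>1 \<tau>2 \<tau>3 C \<longrightarrow> \<bar>v 0\<bar> < 1)"
proof -
  obtain \<Lambda> where \<Lambda>: "0 \<le> \<Lambda>" and lip: "\<And>T f z s i B. \<lbrakk>T > 0; continuous_on UNIV f; \<bar>s\<bar> \<le> T;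
      \<And>y. y \<in> supp_box (2 * T) \<Longrightarrow> \<bar>conv (PsiT \<Phi> (T / 2)) f (z - y)\<bar> \<le> B\<rbrakk>
      \<Longrightarrow> \<bar>conv (PsiT \<Phi> T) f (z + s *\<^sub>R ex_dir i) - conv (PsiT \<Phi> T) f z\<bar> \<le> \<Lambda> * \<bar>s\<bar> * B / T"
    using mollify_lipschitz[OF ker] by blast
  define l :: real where "l = 1 / 10^16"
  define K where "K = 194 * (192000 * (1 + \<Lambda> / l\<^sup>2)) + 64 / l\<^sup>2 * (11 + 17 / (l\<^sup>2 / 2000)^4)"
  have K1: "1 \<le> K"
  proof -
    have "0 \<le> \<Lambda> / l\<^sup>2" using \<Lambda> by simp
    moreover have "0 \<le> 64 / l\<^sup>2 * (11 + 17 / (l\<^sup>2 / 2000)^4)" by (intro mult_nonneg_nonneg add_nonneg_nonneg divide_nonneg_nonneg) auto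
    ultimately show ?thesis by (simp add: K_def)
  qed
  define N where "N = 2 * K + 1"
  have N: "1 \<le> N" using K1 by (simp add: N_def)
  \<comment> \<open>The exponent 20/9 inverts the Hoelder exponent 9/20 of \<open>v\<close>.\<close>
  define T where "T = (1 / (1000000 * N)) powr (20/9)"
  have T0: "0 < T" using N by (simp add: T_def)
  have "T powr (9/20) = 1 / (1000000 * N)" using N by (simp add: T_def powr_powr)
  then have T1: "18240 * N * T powr (9/20) \<le> 1/32" using N by simp
  have T8: "T \<le> 1/8"
  proof -
    have "T \<le> (1/8) powr (20/9)" unfolding T_def using N by (intro powr_mono2) (auto simp: field_simps)
    also have "\<dots> \<le> (1/8) powr 1" by (intro powr_le_powr) auto
    finally show ?thesis by simp
  qed
  define K2 where "K2 = 24000 * (1 + \<Lambda> / l\<^sup>2) * (2000000 / l\<^sup>2) + 456"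
  have K2: "0 < K2" using \<Lambda> by (auto simp: K2_def intro!: add_nonneg_pos mult_nonneg_nonneg)
  define K3 where "K3 = 1000000 * N * T powr (-31/20)"
  have K3: "0 < K3" using N T0 by (simp add: K3_def)
  \<comment> \<open>The two reciprocals serve the local improvement and the error in the mollified
    equation, respectively.\<close>
  define \<delta> where "\<delta> = min 1 (min (1 / (10^7 * K2)) (1 / (32 * K3)))"
  have \<delta>: "0 < \<delta>" "\<delta> \<le> 1" using K2 K3 by (auto simp: \<delta>_def)
  have "\<delta> * K2 \<le> 1 / (10^7 * K2) * K2" using K2 by (intro mult_right_mono) (auto simp: \<delta>_def)
  then have d1: "\<delta> * K2 \<le> 1 / 10^7" using K2 by simp
  have "\<delta> * K3 \<le> 1 / (32 * K3) * K3" using K3 by (intro mult_right_mono) (auto simp: \<delta>_def)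
  then have "\<delta> * K3 \<le> 1/32" using K3 by simp
  moreover have "\<delta> * K3 = 1000000 * N * \<delta> * T powr (-31/20)" by (simp add: K3_def)
  ultimately have d2: "1000000 * N * \<delta> * T powr (-31/20) \<le> 1/32" by simp
  show ?thesis
  proof (intro exI[of _ \<delta>] conjI allI impI \<delta>)
    fix v Y2 Y3 \<tau>1 \<tau>2 \<tau>3 C assume "pde \<Phi> \<delta> 17 v Y2 Y3 \<tau>1 \<tau>2 \<tau>3 C"
    then interpret pde \<Phi> \<delta> 17 v Y2 Y3 \<tau>1 \<tau>2 \<tau>3 C .
    have "UB N" unfolding N_def
      by (rule UB_final[OF UB_improve[OF lip \<Lambda> l_def d1[unfolded K2_def] K_def] K1])
    then show "\<bar>v 0\<bar> < 1" by (rule v0_bound[OF refl _ N T0 T8 T1 d2])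
  qed
qed

section \<open>The blow-up argument\<close>

text \<open>A finite bound on the power also excludes an infinite quantity, since
  \<open>epow\<close> preserves infinity; from here on all noise bounds are real.\<close>

lemma epow_le_imp:
  assumes "epow Q (1 / \<beta>) \<le> ereal m" "0 < \<beta>" "0 < m"
  shows "Q \<le> ereal (m powr \<beta>)"
proof (cases Q)
  case (real q)
  show ?thesis
  proof (cases "q \<le> 0")
    case True
    then show ?thesis using real by (simp add: order_trans[OF True])
  next
    case False
    then have "q powr (1 / \<beta>) \<le> m" using assms real by (simp add: epow_def)
    then have "(q powr (1 / \<beta>)) powr \<beta> \<le> m powr \<beta>" using assms by (intro powr_mono2) auto
    then show ?thesis using False assms real by (simp add: powr_powr)
  qed
qed (use assms in \<open>auto simp: epow_def\<close>)

lemma powr_mult_le_imp: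
  assumes "T powr (- a) * x \<le> q" "0 < (T::real)" shows "x \<le> q * T powr a"
proof -
  have "T powr a * (T powr (- a) * x) \<le> T powr a * q" using assms by (intro mult_left_mono) auto
  moreover have "T powr a * T powr (- a) = 1" using assms(2) by (simp add: powr_minus)
  then have "T powr a * (T powr (- a) * x) = x" by (simp only: mult.assoc[symmetric] mult_1_left)
  ultimately show ?thesis by (simp only: mult.commute)
qed

lemma negnorm_leD:
  assumes "negnorm \<Phi> \<alpha> f \<le> ereal q" "z \<in> Pset" "0 < T" "T \<le> 1"
  shows "\<bar>conv (PsiT \<Phi> T) f z\<bar> \<le> q * T powr \<alpha>"
proof -
  have "ereal (T powr (- \<alpha>) * \<bar>mollify \<Phi> T f z\<bar>) \<le> (SUP T\<in>{0<..1}. ereal (T powr (- \<alpha>) * \<bar>mollify \<Phi> T f z\<bar>))"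
    by (rule SUP_upper) (use assms in auto)
  also have "\<dots> \<le> negnorm \<Phi> \<alpha> f" unfolding negnorm_def by (rule SUP_upper[OF assms(2)])
  finally have "T powr (- \<alpha>) * \<bar>mollify \<Phi> T f z\<bar> \<le> q" using assms(1) by (meson ereal_less_eq(3) order_trans)
  from powr_mult_le_imp[OF this assms(3)] show ?thesis by (simp add: mollify_def)
qed

lemma wsup_leD:
  assumes "wsup \<Phi> a F \<le> ereal q" "z \<in> Pset" "0 < T" "T < 1"
  shows "\<bar>conv (PsiT \<Phi> T) (F z) z\<bar> \<le> q * T powr (- a)"
proof -
  let ?g = "\<lambda>T. ereal (T powr a * \<bar>integral UNIV (\<lambda>y. F z y * PsiT \<Phi> T (z - y))\<bar>)"
  have "?g T \<le> (SUP T\<in>{0<..<1}. ?g T)" by (rule SUP_upper) (use assms in auto)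
  also have "\<dots> \<le> wsup \<Phi> a F" unfolding wsup_def by (rule SUP_upper[OF assms(2)])
  finally have "T powr a * \<bar>integral UNIV (\<lambda>y. F z y * PsiT \<Phi> T (z - y))\<bar> \<le> q" using assms(1) by (meson ereal_less_eq(3) order_trans)
  then have "T powr (- (- a)) * \<bar>conv (PsiT \<Phi> T) (F z) z\<bar> \<le> q" by (simp add: conv_def mult.commute)
  from powr_mult_le_imp[OF this assms(3)] show ?thesis .
qed

text \<open>The definition integrates a vector. Componentwise integrability is what permits passing
  from the integral to its components.\<close>

lemma wsupX_leD:
  assumes "wsupX \<Phi> a g \<le> ereal q" "z \<in> Pset" "0 < T" "T < 1" and k: "kernel \<Phi>" and g: "continuous_on UNIV g"
  shows "\<bar>conv (PsiT \<Phi> T) (\<lambda>y. snd (y - z) $ i * g y) z\<bar> \<le> q * T powr (- a)"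
proof -
  let ?F = "\<lambda>T y. (g y * PsiT \<Phi> T (z - y)) *\<^sub>R snd (y - z)"
  let ?h = "\<lambda>T. ereal (T powr a * infnorm (integral UNIV (?F T)))"
  have "?h T \<le> (SUP T\<in>{0<..<1}. ?h T)" by (rule SUP_upper) (use assms in auto)
  also have "\<dots> \<le> wsupX \<Phi> a g" unfolding wsupX_def by (rule SUP_upper[OF assms(2)])
  finally have 1: "T powr a * infnorm (integral UNIV (?F T)) \<le> q" using assms(1) by (meson ereal_less_eq(3) order_trans)
  have c: "continuous_on UNIV (\<lambda>y. snd (y - z) $ j * g y)" for j by (intro continuous_intros g)
  have cb: "?F T y $ j = PsiT \<Phi> T (z - y) * (snd (y - z) $ j * g y)" for y j by simp
  have int: "(\<lambda>y. ?F T y $ j) integrable_on UNIV" for j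
  proof -
    have "integrable lborel (\<lambda>y. ?F T y $ j)"
      unfolding cb by (rule conv_swap(4)[OF bump_cont_csupp[OF PsiT_bump[OF k assms(3)]] c])
    from has_integral_integral_lborel[OF this] show ?thesis by (auto simp: integrable_on_def)
  qed
  have "?F T integrable_on UNIV"
    unfolding integrable_componentwise_iff[of "?F T"]
  proof
    fix b :: "real^3" assume "b \<in> Basis"
    then obtain j where "b = axis j 1" by (auto simp: Basis_vec_def)
    then have "(\<lambda>y. ?F T y \<bullet> b) = (\<lambda>y. ?F T y $ j)" by (simp add: inner_axis)
    then show "(\<lambda>y. ?F T y \<bullet> b) integrable_on UNIV" using int by (simp only:)
  qed
  then have "integral UNIV (\<lambda>y. ?F T y $ i) = integral UNIV (?F T) $ i" by (rule integral_component_eq_cart)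
  then have "conv (PsiT \<Phi> T) (\<lambda>y. snd (y - z) $ i * g y) z = integral UNIV (?F T) $ i" unfolding cb conv_def .
  then have "\<bar>conv (PsiT \<Phi> T) (\<lambda>y. snd (y - z) $ i * g y) z\<bar> \<le> infnorm (integral UNIV (?F T))"
    by (simp only: component_le_infnorm_cart)
  then have "T powr a * \<bar>conv (PsiT \<Phi> T) (\<lambda>y. snd (y - z) $ i * g y) z\<bar> \<le> T powr a * infnorm (integral UNIV (?F T))"
    by (intro mult_left_mono) auto
  with 1 have "T powr (- (- a)) * \<bar>conv (PsiT \<Phi> T) (\<lambda>y. snd (y - z) $ i * g y) z\<bar> \<le> q" by simp
  from powr_mult_le_imp[OF this assms(3)] show ?thesis .
qed

lemma hoelder_leD:
  assumes "hoelder \<alpha> f \<le> ereal q" shows "\<bar>f y - f z\<bar> \<le> q * pdist y z powr \<alpha>"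
proof (cases "y = z")
  case False
  have "ereal (\<bar>f (fst (y, z)) - f (snd (y, z))\<bar> / pdist (fst (y, z)) (snd (y, z)) powr \<alpha>) \<le> hoelder \<alpha> f"
    unfolding hoelder_def by (rule SUP_upper) (use False in auto)
  from order_trans[OF this assms] have "\<bar>f y - f z\<bar> / pdist y z powr \<alpha> \<le> q" by simp
  then show ?thesis using pdist_pos[OF False] by (simp add: divide_le_eq)
qed simp

text \<open>Since \<open>\<beta>\<close> equals \<open>real k + a\<close>, the scaling dimension,
  all powers of \<open>M\<close> cancel and the factor \<open>C powr (- \<beta>)\<close> remains.
  The common lower bound 2/5 for \<open>\<beta>\<close> allows one choice of \<open>C\<close> for
  all nine quantities. The role of \<open>T\<close> is played by a distance in the two Hoelder
  bounds.\<close>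

lemma noise_scale:
  fixes X :: real
  assumes X: "\<bar>X\<bar> \<le> (M / C) powr \<beta> * (r * T) powr a" and M: "0 < M" "r = 1 / M" and C: "1 \<le> C" "C powr (-2/5) \<le> \<delta>"
    and k: "real k + a = \<beta>" "2/5 \<le> \<beta>" and b: "b \<le> a" and T: "0 \<le> T" "T \<le> 1"
  shows "r ^ k * \<bar>X\<bar> \<le> \<delta> * T powr b"
proof -
  have r: "0 < r" using M by simp
  have "r ^ k * \<bar>X\<bar> \<le> r ^ k * ((M / C) powr \<beta> * (r * T) powr a)" using X r by (intro mult_left_mono) auto
  also have "\<dots> = (r powr real k * r powr a) * (M / C) powr \<beta> * T powr a" using r T by (simp add: powr_mult powr_realpow)
  also have "r powr real k * r powr a = r powr \<beta>" using k by (simp flip: powr_add)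
  also have "r powr \<beta> * (M / C) powr \<beta> = (1 / C) powr \<beta>"
  proof -
    have "r powr \<beta> * (M / C) powr \<beta> = (r * (M / C)) powr \<beta>" using r M C by (subst powr_mult) auto
    also have "r * (M / C) = 1 / C" using M by simp
    finally show ?thesis .
  qed
  also have "(1 / C) powr \<beta> * T powr a \<le> \<delta> * T powr b"
  proof (rule mult_mono)
    have "(1 / C) powr \<beta> \<le> (1 / C) powr (2/5)" using C k by (intro powr_le_powr) auto
    also have "\<dots> = C powr (-2/5)" using C by (simp add: powr_divide powr_minus_divide)
    finally show 1: "(1 / C) powr \<beta> \<le> \<delta>" using C by simp
    show "0 \<le> \<delta>" by (rule order_trans[OF _ 1]) simp
  qed (use T b powr_le_powr in auto)
  finally show ?thesis .
qed

text \<open>At a maximum point of |v| times the distance \<open>d\<close>, halving \<open>d\<close>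
  can at most double |v|. The hypothesis gives \<open>34 < M * m\<close>, so the radius
  \<open>17 / M\<close> is below half the distance, which yields both the inclusion in
  \<open>Pset\<close> and the doubling bound.\<close>

lemma blow_up_point:
  assumes v: "continuous_on UNIV v" and R: "0 < R" "R < 1" and z1: "z1 \<in> PRset R" and C: "34 < \<bar>v z1\<bar> * R"
  obtains p where "0 < \<bar>v p\<bar>" "\<bar>v z1\<bar> \<le> \<bar>v p\<bar>" "past_cyl p (17 / \<bar>v p\<bar>) \<subseteq> Pset"
    "\<And>z. z \<in> past_cyl p (17 / \<bar>v p\<bar>) \<Longrightarrow> \<bar>v z\<bar> \<le> 2 * \<bar>v p\<bar>"
proof -
  have z1': "R\<^sup>2 < fst z1" "fst z1 < 1" "infnorm (snd z1) < 1 - R" using z1 by (auto simp: PRset_def)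
  \<comment> \<open>Stopping at the time of \<open>z1\<close> gives a compact set that avoids the
    final time 1, where the equation is not assumed.\<close>
  define K where "K = {z::pt. 0 \<le> fst z \<and> fst z \<le> fst z1 \<and> infnorm (snd z) \<le> 1}"
  have K_eq: "K = cbox (0, \<chi> i. - 1) (fst z1, \<chi> i. 1)"
    unfolding K_def by (auto simp: cbox_Pair_eq mem_box_cart infnorm_le_iff abs_le_iff minus_le_iff)
  \<comment> \<open>Truncation at \<open>R\<close> gives \<open>z1\<close> the weight exactly
    \<open>R\<close> and no point a larger one; hence the maximum point also satisfies
    \<open>\<bar>v z1\<bar> \<le> \<bar>v p\<bar>\<close>.\<close>
  define d where "d = (\<lambda>z::pt. min (min (sqrt (fst z)) (1 - infnorm (snd z))) R)"
  define W where "W = (\<lambda>z. \<bar>v z\<bar> * d z)"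
  have c: "continuous_on K W" unfolding W_def d_def
    by (intro continuous_intros continuous_on_subset[OF v]) auto
  have z1K: "z1 \<in> K" using z1' R zero_le_power2[of R] unfolding K_def by (auto intro: order_trans[OF zero_le_power2[of R]])
  have cK: "compact K" unfolding K_eq by simp
  have ne: "K \<noteq> {}" using z1K by (metis empty_iff)
  obtain p where p: "p \<in> K" and mx': "\<forall>y\<in>K. W y \<le> W p" using continuous_attains_sup[OF cK ne c] by metis
  note mx = bspec[OF mx']
  have "R \<le> sqrt (fst z1)" using z1' R by (intro real_le_rsqrt) auto
  then have dz1: "d z1 = R" using z1' by (auto simp: d_def)
  define m where "m = d p"
  define M where "M = \<bar>v p\<bar>"
  have Wp: "\<bar>v z1\<bar> * R \<le> M * m" using mx[OF z1K] dz1 by (simp add: W_def M_def m_def)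
  have mR: "m \<le> R" by (simp add: m_def d_def)
  have M0: "0 \<le> M" by (simp add: M_def)
  have Mm: "34 < M * m" using Wp C by linarith
  have m0: "0 < m" using Mm M0 by (metis linorder_not_less mult_nonneg_nonpos order_less_trans zero_less_numeral)
  have Mp: "0 < M" using Mm m0 M0 by (cases "M = 0") auto
  have "\<bar>v z1\<bar> * R \<le> M * R" using Wp mult_left_mono[OF mR M0] by linarith
  then have vM: "\<bar>v z1\<bar> \<le> M" using R by simp
  define q where "q = 17 / M"
  have q: "0 < q" "q \<le> m / 2" using Mp Mm by (auto simp: q_def field_simps)
  have ms: "m \<le> sqrt (fst p)" "m \<le> 1 - infnorm (snd p)" by (auto simp: m_def d_def)
  have mt: "m\<^sup>2 \<le> fst p"
  proof -
    have "0 \<le> fst p" using p by (simp add: K_def)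
    moreover have "m\<^sup>2 \<le> (sqrt (fst p))\<^sup>2" using ms m0 by (intro power_mono) auto
    ultimately show ?thesis by simp
  qed
  have q2: "q\<^sup>2 \<le> m\<^sup>2 / 4" using power_mono[OF q(2), of 2] q by (simp add: power_divide)
  have in1: "z \<in> Pset \<and> \<bar>v z\<bar> \<le> 2 * M" if z: "z \<in> past_cyl p q" for z
  proof -
    have t: "fst p - q\<^sup>2 \<le> fst z" "fst z \<le> fst p" using z by (auto simp: past_cyl_def)
    have x: "infnorm (snd z) \<le> infnorm (snd p) + q" using z infnorm_triangle[of "snd z - snd p" "snd p"] by (simp add: past_cyl_def)
    have m4: "m\<^sup>2 / 4 \<le> fst z" using t mt q2 zero_le_power2[of m] by linarith
    have m2: "0 < m\<^sup>2" using m0 by simp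
    have "fst p \<le> fst z1" using p by (simp add: K_def)
    then have fz: "0 < fst z" "fst z \<le> fst z1" using m4 m2 t by linarith+
    have xz: "infnorm (snd z) \<le> 1 - m / 2" using x ms(2) q by linarith
    have zP: "z \<in> Pset" using fz z1' xz m0 by (auto simp: Pset_def split_beta)
    have zK: "z \<in> K" using fz xz m0 by (auto simp: K_def)
    have "m / 2 \<le> sqrt (fst z)" using m4 m0 by (intro real_le_rsqrt) (auto simp: power_divide)
    then have "m / 2 \<le> d z" using xz mR m0 by (auto simp: d_def)
    then have "\<bar>v z\<bar> * (m / 2) \<le> W z" unfolding W_def by (intro mult_left_mono) auto
    also have "\<dots> \<le> M * m" using mx[OF zK] by (simp add: W_def M_def m_def)
    finally have "\<bar>v z\<bar> * (m / 2) \<le> (2 * M) * (m / 2)" by simp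
    then have "\<bar>v z\<bar> \<le> 2 * M" using m0 by (simp only: mult_le_cancel_right_pos half_gt_zero)
    with zP show ?thesis by blast
  qed
  show thesis
  proof (rule that[of p])
    show "0 < \<bar>v p\<bar>" "\<bar>v z1\<bar> \<le> \<bar>v p\<bar>" using Mp vM by (auto simp: M_def)
    show "past_cyl p (17 / \<bar>v p\<bar>) \<subseteq> Pset" using in1 unfolding q_def M_def by (intro subsetI) (rule conjunct1)
    show "\<And>z. z \<in> past_cyl p (17 / \<bar>v p\<bar>) \<Longrightarrow> \<bar>v z\<bar> \<le> 2 * \<bar>v p\<bar>" using in1 unfolding q_def M_def by (rule conjunct2)
  qed
qed

text \<open>The radius is now the reciprocal of the size of \<open>v\<close>, so that the rescaled
  solution is bounded by 2. For \<open>\<epsilon> < 1/100\<close> all exponents are stronger than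
  those of \<open>pde\<close>; the tightest case is \<open>Q9\<close>, where
  \<open>1/2 + 5 * \<epsilon>\<close> approaches 11/20.\<close>

lemma blow_up_pde:
  fixes M :: real
  assumes ker: "kernel \<Phi>" and \<delta>: "0 < \<delta>" "\<delta> \<le> 1" and \<epsilon>: "0 < \<epsilon>" "\<epsilon> < 1/100" and C: "1 \<le> C" "C powr (-2/5) \<le> \<delta>"
    and M: "1 \<le> M" and r: "r = 1 / M"
    and reg: "C12 v" "C12 Y2" "C12 Y3" "continuous_on UNIV \<tau>1" "continuous_on UNIV \<tau>2" "continuous_on UNIV \<tau>3"
    and eqv: "\<And>z. z \<in> Pset \<Longrightarrow> heat_op v z = - ((v z)^3) - 3 * (v z)\<^sup>2 * \<tau>1 z - 3 * v z * \<tau>2 z - \<tau>3 z - 9 * C' * (v z + \<tau>1 z)"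
    and eq2: "\<And>z. z \<in> Pset \<Longrightarrow> heat_op Y2 z = \<tau>2 z"
    and eq3: "\<And>z. z \<in> Pset \<Longrightarrow> heat_op Y3 z = \<tau>3 z"
    and sub: "past_cyl p (17 / M) \<subseteq> Pset" and vb: "\<And>z. z \<in> past_cyl p (17 / M) \<Longrightarrow> \<bar>v z\<bar> \<le> 2 * M"
    and Q1: "negnorm \<Phi> (-1/2 - \<epsilon>) \<tau>1 \<le> ereal ((M / C) powr (real 1 * (1/2 - \<epsilon>)))"
    and Q2: "negnorm \<Phi> (-1 - 2*\<epsilon>) \<tau>2 \<le> ereal ((M / C) powr (real 2 * (1/2 - \<epsilon>)))"
    and Q3: "negnorm \<Phi> (-3/2 - 3*\<epsilon>) \<tau>3 \<le> ereal ((M / C) powr (real 3 * (1/2 - \<epsilon>)))"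
    and Q4: "hoelder (1 - 2*\<epsilon>) Y2 \<le> ereal ((M / C) powr (real 2 * (1/2 - \<epsilon>)))"
    and Q5: "hoelder (1/2 - 3*\<epsilon>) Y3 \<le> ereal ((M / C) powr (real 3 * (1/2 - \<epsilon>)))"
    and Q6: "wsupX \<Phi> (2*\<epsilon>) \<tau>2 \<le> ereal ((M / C) powr (real 2 * (1/2 - \<epsilon>)))"
    and Q7: "wsup \<Phi> (4*\<epsilon>) (\<lambda>x y. Y2 y * \<tau>2 y - C' - Y2 x * \<tau>2 y) \<le> ereal ((M / C) powr (real 4 * (1/2 - \<epsilon>)))"
    and Q8: "wsup \<Phi> (4*\<epsilon>) (\<lambda>x y. Y3 y * \<tau>1 y - Y3 x * \<tau>1 y) \<le> ereal ((M / C) powr (real 4 * (1/2 - \<epsilon>)))"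
    and Q9: "wsup \<Phi> (1/2 + 5*\<epsilon>) (\<lambda>x y. Y3 y * \<tau>2 y - 3 * C' * \<tau>1 y - Y3 x * \<tau>2 y) \<le> ereal ((M / C) powr (real 5 * (1/2 - \<epsilon>)))"
  shows "pde \<Phi> \<delta> 17 (\<lambda>z. r * v (p + dil r z)) (\<lambda>z. Y2 (p + dil r z)) (\<lambda>z. r * Y3 (p + dil r z))
    (\<lambda>z. r * \<tau>1 (p + dil r z)) (\<lambda>z. r\<^sup>2 * \<tau>2 (p + dil r z)) (\<lambda>z. r^3 * \<tau>3 (p + dil r z)) (r\<^sup>2 * C')"
proof -
  let ?S = "\<lambda>y. p + dil r y"
  have r1: "0 < r" "r \<le> 1" "M * r = 1" using M r by auto
  have M0: "0 < M" using M by simp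
  have inQ: "?S z \<in> past_cyl p (17 / M)" if "z \<in> past_cyl 0 17" for z
  proof -
    have "?S z \<in> past_cyl (?S 0) (r * 17)" using that r1 by (subst dil_in_Qc) auto
    also have "?S 0 = p" by (simp add: dil_def zero_prod_def[symmetric])
    finally show ?thesis using r by simp
  qed
  have inP: "?S z \<in> Pset" if "z \<in> past_cyl 0 17" for z using inQ[OF that] sub by (rule subsetD[rotated])
  have cS: "continuous_on UNIV (\<lambda>z. f (?S z))" if "continuous_on UNIV f" for f :: "pt \<Rightarrow> real"
    by (intro continuous_on_compose2[OF that] continuous_intros) auto
  have rT: "0 < r * T" "r * T < 1" if "0 < T" "T < 1" for T
  proof -
    have "r * T \<le> 1 * T" using that r1 by (intro mult_right_mono) auto
    then show "r * T < 1" using that by linarith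
  qed (use that r1 in simp)
  have c: "continuous_on UNIV v" "continuous_on UNIV Y2" "continuous_on UNIV Y3" using reg C12D(1) by blast+
  have moll: "\<bar>conv (PsiT \<Phi> T) g z\<bar> \<le> \<delta> * T powr b"
    if T: "0 < T" "T < 1" and g: "\<And>y. g y = r ^ k * F (?S y)" and F: "continuous_on UNIV F"
      and X: "\<bar>conv (PsiT \<Phi> (r * T)) F (?S z)\<bar> \<le> (M / C) powr \<beta> * (r * T) powr a" and ka: "real k + a = \<beta>" "2/5 \<le> \<beta>" "b \<le> a" for g F T z a b k \<beta>
  proof -
    have "g = (\<lambda>y. r ^ k * F (?S y))" using g by (rule ext)
    then have "conv (PsiT \<Phi> T) g z = r ^ k * conv (PsiT \<Phi> (r * T)) F (?S z)"
      using conv_cmult[OF bump_cont_csupp[OF PsiT_bump[OF ker T(1)]] cS[OF F], of "r ^ k" z] mollify_scale[OF ker r1(1) T(1) F, of p z] by simp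
    then have "\<bar>conv (PsiT \<Phi> T) g z\<bar> = r ^ k * \<bar>conv (PsiT \<Phi> (r * T)) F (?S z)\<bar>" using r1 by (simp add: abs_mult)
    also have "\<dots> \<le> \<delta> * T powr b" by (rule noise_scale[OF X M0 r C ka]) (use T in auto)
    finally show ?thesis .
  qed
  note ct = continuous_on_add continuous_on_mult continuous_on_diff continuous_on_const reg c
  show ?thesis
  proof
    show "C12 (\<lambda>z. r * v (?S z))" "C12 (\<lambda>z. r * Y3 (?S z))" using C12_scale(1) reg by blast+
    show "C12 (\<lambda>z. Y2 (?S z))" using C12_scale(1)[OF reg(2), of 1 p r] by simp
    show "continuous_on UNIV (\<lambda>z. r * \<tau>1 (?S z))" "continuous_on UNIV (\<lambda>z. r\<^sup>2 * \<tau>2 (?S z))" "continuous_on UNIV (\<lambda>z. r^3 * \<tau>3 (?S z))"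
      by (intro continuous_intros cS reg)+
    fix z :: pt assume z: "z \<in> past_cyl 0 17"
    note zP = inP[OF z]
    show "heat_op (\<lambda>z. r * v (?S z)) z = - ((r * v (?S z)) ^ 3) - 3 * (r * v (?S z))\<^sup>2 * (r * \<tau>1 (?S z)) -
         3 * (r * v (?S z)) * (r\<^sup>2 * \<tau>2 (?S z)) - r ^ 3 * \<tau>3 (?S z) - 9 * (r\<^sup>2 * C') * (r * v (?S z) + r * \<tau>1 (?S z))"
      unfolding C12_scale(4)[OF reg(1)] eqv[OF zP] by (simp add: algebra_simps power2_eq_square power3_eq_cube)
    show "heat_op (\<lambda>z. Y2 (?S z)) z = r\<^sup>2 * \<tau>2 (?S z)" using C12_scale(4)[OF reg(2), of 1 p r z] eq2[OF zP] by simp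
    show "heat_op (\<lambda>z. r * Y3 (?S z)) z = r ^ 3 * \<tau>3 (?S z)"
      unfolding C12_scale(4)[OF reg(3)] eq3[OF zP] by (simp add: power2_eq_square power3_eq_cube)
    have "r * \<bar>v (?S z)\<bar> \<le> r * (2 * M)" using r1 vb[OF inQ[OF z]] by (intro mult_left_mono) auto
    moreover have "r * (2 * M) = 2" using r1(3) by (simp add: mult.commute)
    ultimately show "\<bar>r * v (?S z)\<bar> \<le> 2" using r1(1) unfolding abs_mult by linarith
  next
    fix y z :: pt assume d: "pdist y z \<le> 1"
    have d': "pdist (?S y) (?S z) = r * pdist y z" by (rule pdist_scale[OF r1(1)])
    have "\<bar>Y2 (?S y) - Y2 (?S z)\<bar> \<le> (M / C) powr (real 2 * (1/2 - \<epsilon>)) * (r * pdist y z) powr (1 - 2*\<epsilon>)"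
      using hoelder_leD[OF Q4, of "?S y" "?S z"] unfolding d' .
    from noise_scale[OF this M0 r C, of 0 "19/20"] \<epsilon> d show "\<bar>Y2 (?S y) - Y2 (?S z)\<bar> \<le> \<delta> * pdist y z powr (19/20)" by simp
    have "\<bar>Y3 (?S y) - Y3 (?S z)\<bar> \<le> (M / C) powr (real 3 * (1/2 - \<epsilon>)) * (r * pdist y z) powr (1/2 - 3*\<epsilon>)"
      using hoelder_leD[OF Q5, of "?S y" "?S z"] unfolding d' .
    from noise_scale[OF this M0 r C, of 1 "9/20"] \<epsilon> d have "r * \<bar>Y3 (?S y) - Y3 (?S z)\<bar> \<le> \<delta> * pdist y z powr (9/20)" by (simp add: algebra_simps)
    moreover have "\<bar>r * Y3 (?S y) - r * Y3 (?S z)\<bar> = r * \<bar>Y3 (?S y) - Y3 (?S z)\<bar>"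
      using r1 by (simp add: abs_mult flip: right_diff_distrib)
    ultimately show "\<bar>r * Y3 (?S y) - r * Y3 (?S z)\<bar> \<le> \<delta> * pdist y z powr (9/20)" by simp
  next
    fix z :: pt and T :: real assume z: "z \<in> past_cyl 0 17" and T: "0 < T" "T < 1"
    note zP = inP[OF z]
    note T' = rT[OF T]
    have T'': "r * T \<le> 1" using T' by simp
    have sc: "snd (?S y - ?S z) $ i = r * snd (y - z) $ i" for y i by (simp add: dil_def algebra_simps)
    show "\<bar>conv (PsiT \<Phi> T) (\<lambda>z. r * \<tau>1 (?S z)) z\<bar> \<le> \<delta> * T powr (- 11 / 20)"
      by (rule moll[OF T _ _ negnorm_leD[OF Q1 zP T'(1) T''], where k=1]) (use \<epsilon> reg in auto)
    show "\<bar>conv (PsiT \<Phi> T) (\<lambda>z. r\<^sup>2 * \<tau>2 (?S z)) z\<bar> \<le> \<delta> * T powr (- 21 / 20)"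
      by (rule moll[OF T _ _ negnorm_leD[OF Q2 zP T'(1) T''], where k=2]) (use \<epsilon> reg in auto)
    show "\<bar>conv (PsiT \<Phi> T) (\<lambda>z. r^3 * \<tau>3 (?S z)) z\<bar> \<le> \<delta> * T powr (- 31 / 20)"
      by (rule moll[OF T _ _ negnorm_leD[OF Q3 zP T'(1) T''], where k=3]) (use \<epsilon> reg in auto)
    show "\<bar>conv (PsiT \<Phi> T) (\<lambda>y. snd (y - z) $ i * (r\<^sup>2 * \<tau>2 (?S y))) z\<bar> \<le> \<delta> * T powr (- 1 / 20)" for i
    proof (rule moll[OF T _ _ wsupX_leD[OF Q6 zP T' ker reg(5)], where k=1])
      show "snd (y - z) $ i * (r\<^sup>2 * \<tau>2 (?S y)) = r ^ 1 * (snd (?S y - ?S z) $ i * \<tau>2 (?S y))" for y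
        unfolding sc by (simp add: power2_eq_square)
      show "continuous_on UNIV (\<lambda>w. snd (w - ?S z) $ i * \<tau>2 w)" by (intro continuous_intros reg)
    qed (use \<epsilon> in auto)
    show "\<bar>conv (PsiT \<Phi> T) (\<lambda>y. (Y2 (?S y) - Y2 (?S z)) * (r\<^sup>2 * \<tau>2 (?S y)) - r\<^sup>2 * C') z\<bar> \<le> \<delta> * T powr (- 1 / 20)"
      by (rule moll[OF T _ _ wsup_leD[OF Q7 zP T'], where k=2])
         (use \<epsilon> in \<open>auto intro!: ct simp: algebra_simps\<close>)
    show "\<bar>conv (PsiT \<Phi> T) (\<lambda>y. (r * Y3 (?S y) - r * Y3 (?S z)) * (r * \<tau>1 (?S y))) z\<bar> \<le> \<delta> * T powr (- 1 / 20)"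
      by (rule moll[OF T _ _ wsup_leD[OF Q8 zP T'], where k=2])
         (use \<epsilon> in \<open>auto intro!: ct simp: algebra_simps power2_eq_square\<close>)
    show "\<bar>conv (PsiT \<Phi> T) (\<lambda>y. (r * Y3 (?S y) - r * Y3 (?S z)) * (r\<^sup>2 * \<tau>2 (?S y)) - 3 * (r\<^sup>2 * C') * (r * \<tau>1 (?S y))) z\<bar> \<le> \<delta> * T powr (- 11 / 20)"
      by (rule moll[OF T _ _ wsup_leD[OF Q9 zP T'], where k=3])
         (use \<epsilon> in \<open>auto intro!: ct simp: algebra_simps power2_eq_square power3_eq_cube\<close>)
  qed (use ker \<delta> in auto)
qed

lemma ereal_mult_le_imp:
  assumes "ereal C * x < ereal y" "0 < C" shows "x \<le> ereal (y / C)"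
  using assms by (cases x) (auto simp: field_simps)

text \<open>If the claim fails at \<open>z1\<close>, every entry of the maximum is at most
  \<open>\<bar>v z1\<bar> / C\<close>, hence at most \<open>M / C\<close> at the blow-up point. The
  entry \<open>1 / R\<close> supplies the room for the cylinder, and the other nine become the
  smallness of the rescaled noise.\<close>

lemma main_bound:
  fixes \<Phi> :: "pt \<Rightarrow> real" and \<epsilon> C :: real and \<zeta> \<tau>1 Y2 Y3 u :: "pt \<Rightarrow> real" and C1 C' R :: real
  defines "\<tau>2 \<equiv> \<lambda>z. (\<tau>1 z)\<^sup>2 - C1" and "\<tau>3 \<equiv> \<lambda>z. (\<tau>1 z) ^ 3 - 3 * C1 * \<tau>1 z" and "v \<equiv> \<lambda>z. u z - \<tau>1 z"
    and "e \<equiv> \<lambda>n::nat. 1 / (real n * (1/2 - \<epsilon>))"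
  assumes ker: "kernel \<Phi>" and \<delta>: "0 < \<delta>" "\<delta> \<le> 1"
    and ub: "\<forall>v Y2 Y3 \<tau>1 \<tau>2 \<tau>3 C. pde \<Phi> \<delta> 17 v Y2 Y3 \<tau>1 \<tau>2 \<tau>3 C \<longrightarrow> \<bar>v 0\<bar> < 1"
    and C: "35 \<le> C" "C powr (-2/5) \<le> \<delta>" and \<epsilon>: "0 < \<epsilon>" "\<epsilon> < 1/100"
    and sm: "smooth \<tau>1" "smooth Y2" "smooth Y3" "smooth u"
    and e1: "\<forall>z\<in>Pset. heat \<tau>1 z = \<zeta> z" and e2: "\<forall>z\<in>Pset. heat Y2 z = \<tau>2 z" and e3: "\<forall>z\<in>Pset. heat Y3 z = \<tau>3 z"
    and eu: "\<forall>z\<in>Pset. heat u z = - ((u z) ^ 3) + \<zeta> z + (3 * C1 - 9 * C') * u z"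
    and R: "0 < R" "R < 1"
  shows "(SUP z\<in>PRset R. ereal \<bar>v z\<bar>) \<le> ereal C * Max {ereal (1 / R),
     epow (negnorm \<Phi> (-1/2 - \<epsilon>) \<tau>1) (e 1), epow (negnorm \<Phi> (-1 - 2*\<epsilon>) \<tau>2) (e 2), epow (negnorm \<Phi> (-3/2 - 3*\<epsilon>) \<tau>3) (e 3),
     epow (hoelder (1 - 2*\<epsilon>) Y2) (e 2), epow (hoelder (1/2 - 3*\<epsilon>) Y3) (e 3), epow (wsupX \<Phi> (2*\<epsilon>) \<tau>2) (e 2),
     epow (wsup \<Phi> (4*\<epsilon>) (\<lambda>x y. Y2 y * \<tau>2 y - C' - Y2 x * \<tau>2 y)) (e 4), epow (wsup \<Phi> (4*\<epsilon>) (\<lambda>x y. Y3 y * \<tau>1 y - Y3 x * \<tau>1 y)) (e 4),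
     epow (wsup \<Phi> (1/2 + 5*\<epsilon>) (\<lambda>x y. Y3 y * \<tau>2 y - 3 * C' * \<tau>1 y - Y3 x * \<tau>2 y)) (e 5)}" (is "_ \<le> ereal C * Max ?A")
proof (rule SUP_least, rule ccontr)
  fix z1 assume z1: "z1 \<in> PRset R" and "\<not> ereal \<bar>v z1\<bar> \<le> ereal C * Max ?A"
  then have big: "ereal C * Max ?A < ereal \<bar>v z1\<bar>" by (simp only: not_le)
  have fin: "finite ?A" by simp
  have mem: "x \<le> ereal (\<bar>v z1\<bar> / C)" if "x \<in> ?A" for x
  proof (rule ereal_mult_le_imp)
    have "ereal C * x \<le> ereal C * Max ?A" using C by (intro ereal_mult_left_mono Max_ge[OF fin that]) auto
    then show "ereal C * x < ereal \<bar>v z1\<bar>" using big by (rule le_less_trans)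
  qed (use C in simp)
  have "ereal (1 / R) \<le> ereal (\<bar>v z1\<bar> / C)" by (rule mem) simp
  then have CR: "C \<le> \<bar>v z1\<bar> * R" using R C by (simp add: field_simps)
  then have v34: "34 < \<bar>v z1\<bar> * R" using C by linarith
  note C12s = smooth_C12(1)[OF sm(1)] smooth_C12(1)[OF sm(2)] smooth_C12(1)[OF sm(3)] smooth_C12(1)[OF sm(4)]
  have v_eq: "v = (\<lambda>z. 1 * u z + (-1) * \<tau>1 z + 0)" by (auto simp: v_def)
  note L = C12_lin[OF C12s(4) C12s(1), where a=1 and b="-1" and c=0, folded v_eq]
  have cv: "continuous_on UNIV v" using C12D(1)[OF L(1)] .
  have c1: "continuous_on UNIV \<tau>1" using smooth_continuous[OF sm(1)] .
  obtain p where p: "0 < \<bar>v p\<bar>" "\<bar>v z1\<bar> \<le> \<bar>v p\<bar>" "past_cyl p (17 / \<bar>v p\<bar>) \<subseteq> Pset"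
    "\<And>z. z \<in> past_cyl p (17 / \<bar>v p\<bar>) \<Longrightarrow> \<bar>v z\<bar> \<le> 2 * \<bar>v p\<bar>"
    using blow_up_point[OF cv R z1 v34] by metis
  define M where "M = \<bar>v p\<bar>"
  have "\<bar>v z1\<bar> * R \<le> \<bar>v z1\<bar> * 1" using R by (intro mult_left_mono) auto
  then have M1: "1 \<le> M" using v34 p(2) by (simp add: M_def)
  have mM: "x \<le> ereal (M / C)" if "x \<in> ?A" for x
  proof -
    have "\<bar>v z1\<bar> / C \<le> M / C" using p(2) C unfolding M_def by (intro divide_right_mono) auto
    with mem[OF that] show ?thesis by (meson ereal_less_eq(3) order_trans)
  qed
  have MC: "0 < M / C" using M1 C by simp
  have Q: "Q \<le> ereal ((M / C) powr (real n * (1/2 - \<epsilon>)))" if "epow Q (e n) \<in> ?A" "0 < n" for Q n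
    by (rule epow_le_imp[OF mM[OF that(1), unfolded e_def] _ MC]) (use \<epsilon> that(2) in auto)
  have "pde \<Phi> \<delta> 17 (\<lambda>z. (1/M) * v (p + dil (1/M) z)) (\<lambda>z. Y2 (p + dil (1/M) z)) (\<lambda>z. (1/M) * Y3 (p + dil (1/M) z))
    (\<lambda>z. (1/M) * \<tau>1 (p + dil (1/M) z)) (\<lambda>z. (1/M)\<^sup>2 * \<tau>2 (p + dil (1/M) z)) (\<lambda>z. (1/M)^3 * \<tau>3 (p + dil (1/M) z)) ((1/M)\<^sup>2 * C')"
  proof (rule blow_up_pde[OF ker \<delta> \<epsilon> _ C(2) M1 refl L(1) C12s(2,3) c1])
    show "continuous_on UNIV \<tau>2" "continuous_on UNIV \<tau>3" unfolding \<tau>2_def \<tau>3_def by (intro continuous_intros c1)+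
    show "past_cyl p (17 / M) \<subseteq> Pset" using p(3) by (simp add: M_def)
    show "\<bar>v z\<bar> \<le> 2 * M" if "z \<in> past_cyl p (17 / M)" for z using p(4)[of z] that by (simp add: M_def)
    fix z assume z: "z \<in> Pset"
    show "heat_op Y2 z = \<tau>2 z" using bspec[OF e2 z] smooth_C12(2)[OF sm(2), of z] by simp
    show "heat_op Y3 z = \<tau>3 z" using bspec[OF e3 z] smooth_C12(2)[OF sm(3), of z] by simp
    have "heat_op v z = heat_op u z - heat_op \<tau>1 z" using L(5)[of z] by simp
    also have "\<dots> = - ((u z) ^ 3) + (3 * C1 - 9 * C') * u z"
      using bspec[OF eu z] bspec[OF e1 z] smooth_C12(2)[OF sm(4), of z] smooth_C12(2)[OF sm(1), of z] by simp
    also have "\<dots> = - ((v z)^3) - 3 * (v z)\<^sup>2 * \<tau>1 z - 3 * v z * \<tau>2 z - \<tau>3 z - 9 * C' * (v z + \<tau>1 z)"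
      unfolding v_def \<tau>2_def \<tau>3_def by (simp add: algebra_simps power2_eq_square power3_eq_cube)
    finally show "heat_op v z = - ((v z)^3) - 3 * (v z)\<^sup>2 * \<tau>1 z - 3 * v z * \<tau>2 z - \<tau>3 z - 9 * C' * (v z + \<tau>1 z)" .
  qed (use C in simp, (rule Q; simp)+)
  \<comment> \<open>By the choice of the scale, the rescaled solution has absolute value exactly 1
    at the origin.\<close>
  from ub[rule_format, OF this] have "\<bar>(1/M) * v (p + dil (1/M) 0)\<bar> < 1" .
  also have "p + dil (1/M) 0 = p" by (simp add: dil_def zero_prod_def[symmetric])
  finally show False using p(1) by (simp add: M_def abs_mult)
qed

theorem theorem2p1:
  fixes \<Phi> :: "pt \<Rightarrow> real"
  assumes "kernel \<Phi>"
  shows "\<exists>\<epsilon>0>0. \<forall>\<epsilon>. 0 < \<epsilon> \<and> \<epsilon> < \<epsilon>0 \<longrightarrow> (\<exists>C::real.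
    \<forall>(\<zeta>::pt \<Rightarrow> real) (\<tau>1::pt \<Rightarrow> real) (Y2::pt \<Rightarrow> real) (Y3::pt \<Rightarrow> real) (u::pt \<Rightarrow> real) (C1::real) (C2::real).
      let \<tau>2 = (\<lambda>z. (\<tau>1 z)\<^sup>2 - C1);
          \<tau>3 = (\<lambda>z. (\<tau>1 z) ^ 3 - 3 * C1 * \<tau>1 z);
          v = (\<lambda>z. u z - \<tau>1 z);
          Q1 = negnorm \<Phi> (-1/2 - \<epsilon>) \<tau>1;
          Q2 = negnorm \<Phi> (-1 - 2*\<epsilon>) \<tau>2;
          Q3 = negnorm \<Phi> (-3/2 - 3*\<epsilon>) \<tau>3;
          Q4 = hoelder (1 - 2*\<epsilon>) Y2;
          Q5 = hoelder (1/2 - 3*\<epsilon>) Y3;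
          Q6 = wsupX \<Phi> (2*\<epsilon>) \<tau>2;
          Q7 = wsup \<Phi> (4*\<epsilon>) (\<lambda>x y. Y2 y * \<tau>2 y - C2 - Y2 x * \<tau>2 y);
          Q8 = wsup \<Phi> (4*\<epsilon>) (\<lambda>x y. Y3 y * \<tau>1 y - Y3 x * \<tau>1 y);
          Q9 = wsup \<Phi> (1/2 + 5*\<epsilon>) (\<lambda>x y. Y3 y * \<tau>2 y - 3 * C2 * \<tau>1 y - Y3 x * \<tau>2 y);
          e = (\<lambda>n::nat. 1 / (real n * (1/2 - \<epsilon>)))
      in smooth \<zeta> \<longrightarrow> smooth \<tau>1 \<longrightarrow> smooth Y2 \<longrightarrow> smooth Y3 \<longrightarrow> smooth u \<longrightarrow>
         (\<forall>z\<in>Pset. heat \<tau>1 z = \<zeta> z) \<longrightarrow>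
         (\<forall>z\<in>Pset. heat Y2 z = \<tau>2 z) \<longrightarrow>
         (\<forall>z\<in>Pset. heat Y3 z = \<tau>3 z) \<longrightarrow>
         (\<forall>z\<in>Pset. heat u z = - ((u z) ^ 3) + \<zeta> z + (3 * C1 - 9 * C2) * u z) \<longrightarrow>
         (\<forall>R. 0 < R \<and> R < 1 \<longrightarrow>
            (SUP z\<in>PRset R. ereal \<bar>v z\<bar>) \<le> ereal C * Max {ereal (1 / R),
               epow Q1 (e 1), epow Q2 (e 2), epow Q3 (e 3), epow Q4 (e 2), epow Q5 (e 3),
               epow Q6 (e 2), epow Q7 (e 4), epow Q8 (e 4), epow Q9 (e 5)}))"
proof -
  obtain \<delta> where \<delta>: "0 < \<delta>" "\<delta> \<le> 1"
    and ub: "\<forall>v Y2 Y3 \<tau>1 \<tau>2 \<tau>3 C. pde \<Phi> \<delta> 17 v Y2 Y3 \<tau>1 \<tau>2 \<tau>3 C \<longrightarrow> \<bar>v 0\<bar> < 1"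
    using unit_bound[OF assms] by (elim exE conjE)
  \<comment> \<open>The value 35 exceeds 34 = 2 * 17, the room needed for a cylinder of radius
    \<open>17 / M\<close>; the power of \<open>\<delta>\<close> inverts the exponent -2/5 of
    \<open>noise_scale\<close>.\<close>
  define K where "K = max 35 (\<delta> powr (-5/2))"
  have K: "35 \<le> K" "\<delta> powr (-5/2) \<le> K" by (auto simp: K_def)
  have "K powr (-2/5) \<le> (\<delta> powr (-5/2)) powr (-2/5)" using K \<delta> by (intro powr_mono2') auto
  then have Kd: "K powr (-2/5) \<le> \<delta>" using \<delta> by (simp add: powr_powr)
  \<comment> \<open>The threshold 1/100 for \<open>\<epsilon>\<close> is the value at which
    \<open>1/2 + 5 * \<epsilon>\<close> reaches 11/20.\<close>
  show ?thesis
    unfolding Let_def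
    by (rule exI[of _ "1/100"], intro conjI allI impI, simp, rule exI[of _ K], intro allI impI,
      rule main_bound[OF assms \<delta> ub K(1) Kd], (elim conjE, assumption)+)
qed

end
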